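(* The following are equivalent for a ring $R$: (1) $R\propto R$ is left morphic; (2) the element $(0,a)$ is left morphic in $R\propto R$ for every $a\in R$; (3) $R$ is unit regular; (4) $R\propto R$ is morphic; (5) $R[x]/(x^n)$ is strongly morphic for all $n\ge 1$.
   Context: All rings are associative with identity. For a ring $R$ and an $(R,R)$-bimodule $M$, the trivial extension $R\propto M$ is the set of pairs $(r,m)$ with $r\in R$, $m\in M$, with componentwise addition and multiplication $(r,m)(s,n)=(rs,rn+ms)$; in $R\propto R$ the second copy of $R$ is the natural $(R,R)$-bimodule $R$. An element $a$ of a ring $S$ is left morphic if $S/Sa\cong \{x\in S: xa=0\}$ as left $S$-modules; $S$ is left morphic if every element of $S$ is left morphic. Right morphic is defined symmetrically, and a ring is morphic if it is both left and right morphic. A ring $S$ is strongly morphic if the matrix ring $\mathbb{M}_n(S)$ is morphic for every positive integer $n$. A ring $R$ is unit regular if for every $a\in R$ there is a unit $u\in R$ with $a=aua$. Here $R[x]$ is the polynomial ring in a central indeterminate $x$. *)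

theory Defs
  imports "HOL-Algebra.QuotRing" "HOL-Algebra.UnivPoly"
begin

text \<open>
  The locale \<open>module\<close> of HOL-Algebra requires commutative scalars, so only its record type is
  used, as a carrier with addition and a scalar action, for left and for right modules over an
  arbitrary ring. For a right module, \<open>smult M r m\<close> denotes \<open>m \<cdot> r\<close>. As in that locale, the
  fields \<open>mult\<close> and \<open>one\<close> of the record are not part of the module structure.
\<close>

definition module_iso ::
    "('r, 'k) ring_scheme \<Rightarrow> ('r, 'a, 'm) module_scheme \<Rightarrow> ('r, 'b, 'n) module_scheme \<Rightarrow> ('a \<Rightarrow> 'b) set"
  where "module_iso S M N =
    {h. bij_betw h (carrier M) (carrier N) \<and>
        (\<forall>x\<in>carrier M. \<forall>y\<in>carrier M. h (x \<oplus>\<^bsub>M\<^esub> y) = h x \<oplus>\<^bsub>N\<^esub> h y) \<and>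
        (\<forall>r\<in>carrier S. \<forall>x\<in>carrier M. h (r \<odot>\<^bsub>M\<^esub> x) = r \<odot>\<^bsub>N\<^esub> h x)}"

definition is_module_iso ::
    "('r, 'k) ring_scheme \<Rightarrow> ('r, 'a, 'm) module_scheme \<Rightarrow> ('r, 'b, 'n) module_scheme \<Rightarrow> bool"
  where "is_module_iso S M N \<longleftrightarrow> module_iso S M N \<noteq> {}"

text \<open>
  \<open>S/I\<close> for a left (right) ideal \<open>I\<close>. For the coset \<open>X = I + x\<close>, the sum of sets \<open>I + rX\<close> is the
  coset \<open>I + rx\<close> (and \<open>I + Xr\<close> is \<open>I + xr\<close>).
\<close>

definition left_quotient_module ::
    "('a, 'k) ring_scheme \<Rightarrow> 'a set \<Rightarrow> ('a, 'a set) module"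
  where "left_quotient_module S I =
    \<lparr>carrier = a_rcosets\<^bsub>S\<^esub> I, mult = undefined, one = undefined, zero = I, add = set_add S,
     smult = (\<lambda>r X. I <+>\<^bsub>S\<^esub> (r <#\<^bsub>S\<^esub> X))\<rparr>"

definition right_quotient_module ::
    "('a, 'k) ring_scheme \<Rightarrow> 'a set \<Rightarrow> ('a, 'a set) module"
  where "right_quotient_module S I =
    \<lparr>carrier = a_rcosets\<^bsub>S\<^esub> I, mult = undefined, one = undefined, zero = I, add = set_add S,
     smult = (\<lambda>r X. I <+>\<^bsub>S\<^esub> (X #>\<^bsub>S\<^esub> r))\<rparr>"

definition left_annihilator_module ::
    "('a, 'k) ring_scheme \<Rightarrow> 'a \<Rightarrow> ('a, 'a) module"
  where "left_annihilator_module S a =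
    \<lparr>carrier = {x \<in> carrier S. x \<otimes>\<^bsub>S\<^esub> a = \<zero>\<^bsub>S\<^esub>}, mult = undefined, one = undefined,
     zero = \<zero>\<^bsub>S\<^esub>, add = add S, smult = (\<lambda>r x. r \<otimes>\<^bsub>S\<^esub> x)\<rparr>"

definition right_annihilator_module ::
    "('a, 'k) ring_scheme \<Rightarrow> 'a \<Rightarrow> ('a, 'a) module"
  where "right_annihilator_module S a =
    \<lparr>carrier = {x \<in> carrier S. a \<otimes>\<^bsub>S\<^esub> x = \<zero>\<^bsub>S\<^esub>}, mult = undefined, one = undefined,
     zero = \<zero>\<^bsub>S\<^esub>, add = add S, smult = (\<lambda>r x. x \<otimes>\<^bsub>S\<^esub> r)\<rparr>"

definition left_morphic_element :: "('a, 'k) ring_scheme \<Rightarrow> 'a \<Rightarrow> bool"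
  where "left_morphic_element S a \<longleftrightarrow>
    is_module_iso S (left_quotient_module S (carrier S #>\<^bsub>S\<^esub> a)) (left_annihilator_module S a)"

definition right_morphic_element :: "('a, 'k) ring_scheme \<Rightarrow> 'a \<Rightarrow> bool"
  where "right_morphic_element S a \<longleftrightarrow>
    is_module_iso S (right_quotient_module S (a <#\<^bsub>S\<^esub> carrier S)) (right_annihilator_module S a)"

definition left_morphic_ring :: "('a, 'k) ring_scheme \<Rightarrow> bool"
  where "left_morphic_ring S \<longleftrightarrow> (\<forall>a\<in>carrier S. left_morphic_element S a)"

definition right_morphic_ring :: "('a, 'k) ring_scheme \<Rightarrow> bool"
  where "right_morphic_ring S \<longleftrightarrow> (\<forall>a\<in>carrier S. right_morphic_element S a)"

definition morphic_ring :: "('a, 'k) ring_scheme \<Rightarrow> bool"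
  where "morphic_ring S \<longleftrightarrow> left_morphic_ring S \<and> right_morphic_ring S"

text \<open>
  An \<open>n \<times> n\<close> matrix is a function on index pairs with indices \<open>0, \<dots>, n - 1\<close>, fixed to
  \<open>undefined\<close> outside, so that equality of matrices is equality of functions.
\<close>

definition matrix_ring :: "nat \<Rightarrow> ('a, 'k) ring_scheme \<Rightarrow> (nat \<times> nat \<Rightarrow> 'a) ring"
  where "matrix_ring n S =
    \<lparr>carrier = {..<n} \<times> {..<n} \<rightarrow>\<^sub>E carrier S,
     mult = (\<lambda>A B. \<lambda>(i, j)\<in>{..<n} \<times> {..<n}. \<Oplus>\<^bsub>S\<^esub>k\<in>{..<n}. A (i, k) \<otimes>\<^bsub>S\<^esub> B (k, j)),
     one = (\<lambda>(i, j)\<in>{..<n} \<times> {..<n}. if i = j then \<one>\<^bsub>S\<^esub> else \<zero>\<^bsub>S\<^esub>),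
     zero = (\<lambda>(i, j)\<in>{..<n} \<times> {..<n}. \<zero>\<^bsub>S\<^esub>),
     add = (\<lambda>A B. \<lambda>(i, j)\<in>{..<n} \<times> {..<n}. A (i, j) \<oplus>\<^bsub>S\<^esub> B (i, j))\<rparr>"

definition strongly_morphic_ring :: "('a, 'k) ring_scheme \<Rightarrow> bool"
  where "strongly_morphic_ring S \<longleftrightarrow> (\<forall>n\<ge>1. morphic_ring (matrix_ring n S))"

definition unit_regular_ring :: "('a, 'k) ring_scheme \<Rightarrow> bool"
  where "unit_regular_ring R \<longleftrightarrow>
    (\<forall>a\<in>carrier R. \<exists>u\<in>Units R. a = a \<otimes>\<^bsub>R\<^esub> u \<otimes>\<^bsub>R\<^esub> a)"

text \<open>In a bimodule, \<open>smult M r m\<close> is \<open>r \<cdot> m\<close> and \<open>right_smult M m s\<close> is \<open>m \<cdot> s\<close>.\<close>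

record ('a, 'b) bimodule = "('a, 'b) module" +
  right_smult :: "'b \<Rightarrow> 'a \<Rightarrow> 'b"

definition regular_bimodule :: "('a, 'k) ring_scheme \<Rightarrow> ('a, 'a) bimodule"
  where "regular_bimodule R =
    \<lparr>carrier = carrier R, mult = undefined, one = undefined, zero = \<zero>\<^bsub>R\<^esub>, add = add R,
     smult = mult R, right_smult = mult R\<rparr>"

definition trivial_extension ::
    "('a, 'k) ring_scheme \<Rightarrow> ('a, 'b, 'm) bimodule_scheme \<Rightarrow> ('a \<times> 'b) ring" (infixl \<open>\<propto>\<close> 65)
  where "R \<propto> M =
    \<lparr>carrier = carrier R \<times> carrier M,
     mult = (\<lambda>(r, m) (s, n). (r \<otimes>\<^bsub>R\<^esub> s, (r \<odot>\<^bsub>M\<^esub> n) \<oplus>\<^bsub>M\<^esub> right_smult M m s)),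
     one = (\<one>\<^bsub>R\<^esub>, \<zero>\<^bsub>M\<^esub>),
     zero = (\<zero>\<^bsub>R\<^esub>, \<zero>\<^bsub>M\<^esub>),
     add = (\<lambda>(r, m) (s, n). (r \<oplus>\<^bsub>R\<^esub> s, m \<oplus>\<^bsub>M\<^esub> n))\<rparr>"

definition truncated_poly_ring :: "('a, 'k) ring_scheme \<Rightarrow> nat \<Rightarrow> (nat \<Rightarrow> 'a) set ring"
  where "truncated_poly_ring R n =
    UP R Quot (Idl\<^bsub>UP R\<^esub> {monom (UP R) \<one>\<^bsub>R\<^esub> 1 [^]\<^bsub>UP R\<^esub> n})"

end

theory Submission
  imports Defs
begin

text \<open>
  An element \<open>a\<close> is left morphic iff some \<open>b\<close> satisfies \<open>Sa = l(b)\<close> and \<open>l(a) = Sb\<close>, where \<open>l\<close>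
  denotes left annihilators. The rings \<open>R \<propto> R\<close>, \<open>R[x]/(x\<^sup>n)\<close> and the matrix rings over the
  latter all are, up to isomorphism, of the form \<open>T = S[x]/(x\<^sup>n)\<close> with \<open>S = R\<close> or
  \<open>S = M\<^sub>k(R)\<close>, and \<open>M\<^sub>k(R)\<close> is unit regular if \<open>R\<close> is (Henriksen).

  If \<open>S\<close> is unit regular, then every element of \<open>T\<close> is equivalent, under left and right
  multiplication by units, to a sum \<open>\<Sum> e\<^sub>i x\<^sup>i\<close> with orthogonal idempotents
  \<open>e\<^sub>0, \<dots>, e\<^sub>n\<close> of sum \<open>1\<close>: a unit multiple of the lowest coefficient is an idempotent, which
  serves as pivot, and one continues in the complementary corner. Such a sum is left morphic by means of
  \<open>\<Sum> e\<^sub>i x\<^sup>n\<^sup>-\<^sup>i\<close>. The right-hand statements follow by passing to opposite rings.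

  Conversely, let \<open>n = 2\<close> and let \<open>ax\<close> be left morphic by means of \<open>b + cx\<close>. Then \<open>Ra = l(b)\<close> and
  \<open>Rb = l(a)\<close>, and right multiplication by \<open>c\<close> induces an isomorphism \<open>Ra \<rightarrow> R/Rb\<close>. It follows that
  \<open>b\<close>, hence \<open>a\<close>, is von Neumann regular, and a left morphic regular element is unit regular.
\<close>

section \<open>Left morphic elements\<close>

text \<open>The reduction is carried out once, in a locale that describes \<open>S[x]/(x^n)\<close>
  by a central element \<open>x\<close>, the annihilators of its powers and the decomposition
  \<open>t = \<iota> r + x s\<close>. These axioms are left-right symmetric and can be checked entry
  by entry, so they pass to opposite rings and to matrix rings without an isomorphism being written
  down. The obstacle is that units must be controlled more closely than unit regularity says. When a
  new pivot is treated, the diagonal part built so far must not change, so the units have to be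
  trivial on the idempotents already used. This is why unit regularity is restated for corners, with
  units that fix \<open>1 - e\<close> on both sides. The same form makes Henriksen's theorem an
  induction that adds one diagonal position at a time. In the converse direction nothing is known
  about \<open>R\<close> in advance except annihilators, so regularity has to be produced before
  Ehrlich's argument can start.\<close>

definition left_morphic_pair :: "('a, 'k) ring_scheme \<Rightarrow> 'a \<Rightarrow> 'a \<Rightarrow> bool"
  where "left_morphic_pair S a b \<longleftrightarrow> a \<in> carrier S \<and> b \<in> carrier S \<and>
    (\<forall>x\<in>carrier S. (x \<otimes>\<^bsub>S\<^esub> a = \<zero>\<^bsub>S\<^esub> \<longleftrightarrow> (\<exists>s\<in>carrier S. x = s \<otimes>\<^bsub>S\<^esub> b)) \<and>
                     (x \<otimes>\<^bsub>S\<^esub> b = \<zero>\<^bsub>S\<^esub> \<longleftrightarrow> (\<exists>s\<in>carrier S. x = s \<otimes>\<^bsub>S\<^esub> a)))"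

context ring begin

lemma principal_left_ideal_abelian_subgroup:
  assumes "a \<in> carrier R"
  shows "abelian_subgroup (carrier R #> a) R"
proof (rule abelian_subgroupI3[OF additive_subgroupI is_abelian_group])
  show "subgroup (carrier R #> a) (add_monoid R)"
  proof (unfold_locales, goal_cases)
    case 1 then show ?case using assms by (auto simp: r_coset_def)
  next
    case (2 x y) then show ?case using assms 
      by (auto simp: r_coset_def) (metis add.m_closed l_distr)
  next
    case 3 then show ?case using assms 
      by (auto simp: r_coset_def) (metis l_null zero_closed)
  next
    case (4 x) then show ?case using assms 
      by (auto simp: r_coset_def a_inv_def[symmetric]) (metis l_minus a_inv_closed)
  qed
qed

lemma mem_principal_left_ideal:
  "y \<in> carrier R #> a \<longleftrightarrow> (\<exists>s\<in>carrier R. y = s \<otimes> a)"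
  by (auto simp: r_coset_def)

text \<open>Left multiplication by \<open>r\<close> can shrink a coset, to \<open>rI + rx\<close>.
  Since \<open>I\<close> is a left ideal, \<open>rI\<close> lies in \<open>I\<close>, so adding
  \<open>I\<close> restores the full coset of \<open>rx\<close>.\<close>

lemma coset_smult:
  assumes "a \<in> carrier R" "r \<in> carrier R" "x \<in> carrier R"
  defines "I \<equiv> carrier R #> a"
  shows "I <+>\<^bsub>R\<^esub> (r <# (I +> x)) = I +> (r \<otimes> x)"
proof -
  interpret I: abelian_subgroup I R
    unfolding I_def by (rule principal_left_ideal_abelian_subgroup) fact
  have "r \<otimes> i \<in> I" if i: "i \<in> I" for i
  proof -
    obtain s where "s \<in> carrier R" "i = s \<otimes> a" using i by (auto simp: I_def mem_principal_left_ideal)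
    then have "r \<otimes> i = (r \<otimes> s) \<otimes> a" "r \<otimes> s \<in> carrier R" using assms by (auto simp: m_assoc)
    then show ?thesis unfolding I_def mem_principal_left_ideal by blast
  qed
  note rI = this
  show ?thesis
  proof (intro equalityI subsetI)
    fix y assume "y \<in> I <+>\<^bsub>R\<^esub> (r <# (I +> x))"
    then obtain i j where ij: "i \<in> I" "j \<in> I" "y = i \<oplus> r \<otimes> (j \<oplus> x)"
      by (auto simp: set_add_def' l_coset_def a_r_coset_def')
    then have "y = (i \<oplus> r \<otimes> j) \<oplus> r \<otimes> x" "i \<oplus> r \<otimes> j \<in> I"
      using assms(1-3) I.a_Hcarr rI by (auto simp: r_distr a_assoc)
    then show "y \<in> I +> r \<otimes> x" by (auto simp: a_r_coset_def')
  next
    fix y assume "y \<in> I +> r \<otimes> x"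
    then obtain i where i: "i \<in> I" "y = i \<oplus> r \<otimes> x" by (auto simp: a_r_coset_def')
    then have "y = i \<oplus> r \<otimes> (\<zero> \<oplus> x)" using assms by simp
    then show "y \<in> I <+>\<^bsub>R\<^esub> (r <# (I +> x))" using i I.zero_closed
      unfolding set_add_def' l_coset_def a_r_coset_def' by blast
  qed
qed

lemma minus_eq_zero_iff:
  assumes "x \<in> carrier R" "y \<in> carrier R"
  shows "x \<ominus> y = \<zero> \<longleftrightarrow> x = y"
  using assms minus_equality[of x "\<ominus> y"] by (auto simp: minus_eq r_neg add.inv_solve_right)

lemma coset_eq_iff:
  assumes "a \<in> carrier R" "x \<in> carrier R" "y \<in> carrier R"
  shows "carrier R #> a +> x = carrier R #> a +> y \<longleftrightarrow> (\<exists>s\<in>carrier R. x \<ominus> y = s \<otimes> a)"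
proof -
  interpret I: abelian_subgroup "carrier R #> a" R
    by (rule principal_left_ideal_abelian_subgroup) fact
  show ?thesis
    using I.a_rcos_module I.a_repr_independence' I.a_repr_independenceD assms I.a_subgroup I.a_rcos_self
    unfolding mem_principal_left_ideal[symmetric]
    by (metis minus_eq)
qed

text \<open>A homomorphism out of the cyclic module \<open>R/Ra\<close> is determined by the image
  \<open>b\<close> of the coset of \<open>1\<close>, and is then right multiplication by
  \<open>b\<close>. Its being onto \<open>l(a)\<close> says \<open>l(a) = Rb\<close>; its being well
  defined and injective says \<open>l(b) = Ra\<close>.\<close>

lemma left_morphic_element_iff:
  assumes a: "a \<in> carrier R"
  shows "left_morphic_element R a \<longleftrightarrow> (\<exists>b. left_morphic_pair R a b)"
proof
  let ?I = "carrier R #> a"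
  interpret I: abelian_subgroup ?I R
    by (rule principal_left_ideal_abelian_subgroup) fact
  let ?Q = "left_quotient_module R ?I" and ?A = "left_annihilator_module R a"
  have Q: "carrier ?Q = (\<lambda>x. ?I +> x) ` carrier R"
    by (auto simp: left_quotient_module_def A_RCOSETS_def')
  have Qadd: "(?I +> x) \<oplus>\<^bsub>?Q\<^esub> (?I +> y) = ?I +> (x \<oplus> y)" if "x \<in> carrier R" "y \<in> carrier R" for x y
    using that by (simp add: left_quotient_module_def I.a_rcos_sum)
  have Qsmult: "r \<odot>\<^bsub>?Q\<^esub> (?I +> x) = ?I +> (r \<otimes> x)" if "r \<in> carrier R" "x \<in> carrier R" for r x
    using that a by (simp add: left_quotient_module_def coset_smult)
  {
    assume "left_morphic_element R a"
    then obtain h where bij: "bij_betw h (carrier ?Q) (carrier ?A)"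
      and hs: "\<And>r X. r \<in> carrier R \<Longrightarrow> X \<in> carrier ?Q \<Longrightarrow> h (r \<odot>\<^bsub>?Q\<^esub> X) = r \<odot>\<^bsub>?A\<^esub> h X"
      by (auto simp: left_morphic_element_def is_module_iso_def module_iso_def)
    define b where "b = h (?I +> \<one>)"
    have hx: "h (?I +> x) = x \<otimes> b" if "x \<in> carrier R" for x
      using hs[of x "?I +> \<one>"] that Qsmult[of x \<one>] unfolding Q b_def
      by (auto simp: left_annihilator_module_def)
    have b: "b \<in> carrier R" using bij unfolding b_def bij_betw_def Q
      by (auto simp: left_annihilator_module_def)
    have 1: "x \<otimes> a = \<zero> \<longleftrightarrow> (\<exists>s\<in>carrier R. x = s \<otimes> b)" if "x \<in> carrier R" for x
    proof -
      have "x \<otimes> a = \<zero> \<longleftrightarrow> x \<in> h ` carrier ?Q"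
        using bij that by (auto simp: bij_betw_def left_annihilator_module_def)
      also have "\<dots> \<longleftrightarrow> (\<exists>s\<in>carrier R. x = s \<otimes> b)"
        unfolding Q image_image by (auto simp: image_iff hx)
      finally show ?thesis .
    qed
    have 2: "x \<otimes> b = \<zero> \<longleftrightarrow> (\<exists>s\<in>carrier R. x = s \<otimes> a)" if "x \<in> carrier R" for x
    proof -
      have "x \<otimes> b = \<zero> \<longleftrightarrow> h (?I +> x) = h (?I +> \<zero>)" using that b by (simp add: hx)
      also have "\<dots> \<longleftrightarrow> ?I +> x = ?I +> \<zero>"
        using bij that unfolding bij_betw_def Q by (auto simp: inj_on_def)
      also have "\<dots> \<longleftrightarrow> (\<exists>s\<in>carrier R. x = s \<otimes> a)"
        using that a by (subst coset_eq_iff) (auto simp: minus_eq)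
      finally show ?thesis .
    qed
    show "\<exists>b. left_morphic_pair R a b" using a b 1 2 unfolding left_morphic_pair_def by blast
  }
  {
    assume "\<exists>b. left_morphic_pair R a b"
    then obtain b where b: "b \<in> carrier R"
      and 1: "\<And>x. x \<in> carrier R \<Longrightarrow> x \<otimes> a = \<zero> \<longleftrightarrow> (\<exists>s\<in>carrier R. x = s \<otimes> b)"
      and 2: "\<And>x. x \<in> carrier R \<Longrightarrow> x \<otimes> b = \<zero> \<longleftrightarrow> (\<exists>s\<in>carrier R. x = s \<otimes> a)"
      unfolding left_morphic_pair_def by blast
    have eq: "?I +> x = ?I +> y \<longleftrightarrow> x \<otimes> b = y \<otimes> b" if "x \<in> carrier R" "y \<in> carrier R" for x y
    proof -
      have "(x \<ominus> y) \<otimes> b = x \<otimes> b \<ominus> y \<otimes> b" using that b by algebra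
      then show ?thesis using that a b 2[of "x \<ominus> y"] by (auto simp: coset_eq_iff minus_eq_zero_iff)
    qed
    \<comment> \<open>The value on a coset is read off from a chosen representative;
      \<open>eq\<close> makes it independent of the choice.\<close>
    define h where "h X = (SOME x. x \<in> carrier R \<and> X = ?I +> x) \<otimes> b" for X
    have hx: "h (?I +> x) = x \<otimes> b" if "x \<in> carrier R" for x
    proof -
      let ?y = "SOME y. y \<in> carrier R \<and> ?I +> x = ?I +> y"
      have y: "?y \<in> carrier R \<and> ?I +> x = ?I +> ?y"
        by (rule someI) (use that in blast)
      then have "x \<otimes> b = ?y \<otimes> b" using eq[of x ?y] that by blast
      then show ?thesis unfolding h_def by (rule sym)
    qed
    have "h \<in> module_iso R ?Q ?A"
      unfolding module_iso_def
    proof (intro CollectI conjI ballI)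
      show "bij_betw h (carrier ?Q) (carrier ?A)"
        unfolding bij_betw_def Q
        by (auto simp: inj_on_def hx eq left_annihilator_module_def image_image 1 b image_iff)
    next
      fix X Y assume "X \<in> carrier ?Q" "Y \<in> carrier ?Q"
      then show "h (X \<oplus>\<^bsub>?Q\<^esub> Y) = h X \<oplus>\<^bsub>?A\<^esub> h Y"
        unfolding Q by (auto simp: Qadd hx l_distr b left_annihilator_module_def)
    next
      fix r X assume "r \<in> carrier R" "X \<in> carrier ?Q"
      then show "h (r \<odot>\<^bsub>?Q\<^esub> X) = r \<odot>\<^bsub>?A\<^esub> h X"
        unfolding Q by (auto simp: Qsmult hx m_assoc b left_annihilator_module_def)
    qed
    then show "left_morphic_element R a"
      by (auto simp: left_morphic_element_def is_module_iso_def)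
  }
qed

lemma mult_Unit_eq_iff:
  assumes "u \<in> Units R" "x \<in> carrier R" "y \<in> carrier R"
  shows "x \<otimes> u = y \<longleftrightarrow> x = y \<otimes> inv u"
  using assms Units_closed Units_inv_closed by (auto simp: m_assoc)

lemma mult_Unit_eq_zero_iff:
  assumes "u \<in> Units R" "x \<in> carrier R"
  shows "x \<otimes> u = \<zero> \<longleftrightarrow> x = \<zero>"
  using assms mult_Unit_eq_iff[of u x \<zero>] by auto

text \<open>\<open>x(uav) = 0\<close> means that \<open>xu\<close> lies in \<open>l(a) = Rb\<close>,
  so \<open>x\<close> lies in \<open>Rb inv u\<close>, and \<open>R = R inv v\<close> puts the
  missing factor in front. Fact \<open>1\<close> is stated for arbitrary elements because it also
  gives the second annihilator, with \<open>a\<close>, \<open>b\<close> exchanged and with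
  \<open>inv v\<close>, \<open>inv u\<close> as the units.\<close>

lemma left_morphic_pair_mult_Units:
  assumes "left_morphic_pair R a b" "u \<in> Units R" "v \<in> Units R"
  shows "left_morphic_pair R (u \<otimes> a \<otimes> v) (inv v \<otimes> b \<otimes> inv u)"
proof -
  have ab: "a \<in> carrier R" "b \<in> carrier R" using assms by (auto simp: left_morphic_pair_def)
  have 1: "x \<otimes> (u \<otimes> c \<otimes> v) = \<zero> \<longleftrightarrow> (\<exists>s\<in>carrier R. x = s \<otimes> (inv v \<otimes> d \<otimes> inv u))"
    if "x \<in> carrier R" "u \<in> Units R" "v \<in> Units R" and cd: "c \<in> carrier R" "d \<in> carrier R"
     and c: "\<And>x. x \<in> carrier R \<Longrightarrow> x \<otimes> c = \<zero> \<longleftrightarrow> (\<exists>s\<in>carrier R. x = s \<otimes> d)" for x c d u v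
  proof -
    note [simp] = Units_closed[OF that(2)] Units_closed[OF that(3)]
       Units_inv_closed[OF that(2)] Units_inv_closed[OF that(3)]
    have "x \<otimes> (u \<otimes> c \<otimes> v) = \<zero> \<longleftrightarrow> x \<otimes> u \<otimes> c = \<zero>"
      using that(1) cd mult_Unit_eq_zero_iff[of v "x \<otimes> u \<otimes> c"] \<open>v \<in> Units R\<close> by (simp add: m_assoc)
    also have "\<dots> \<longleftrightarrow> (\<exists>s\<in>carrier R. x \<otimes> u = s \<otimes> d)" 
      by (rule c) (intro m_closed that Units_closed)
    also have "\<dots> \<longleftrightarrow> (\<exists>s\<in>carrier R. x = s \<otimes> d \<otimes> inv u)"
      by (intro bex_cong refl mult_Unit_eq_iff m_closed that cd)
    also have "\<dots> \<longleftrightarrow> (\<exists>s\<in>carrier R. x = s \<otimes> (inv v \<otimes> d \<otimes> inv u))"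
    proof
      assume "\<exists>s\<in>carrier R. x = s \<otimes> d \<otimes> inv u"
      then obtain s where s: "s \<in> carrier R" "x = s \<otimes> d \<otimes> inv u" by auto
      have "x = (s \<otimes> v \<otimes> inv v) \<otimes> d \<otimes> inv u" using s cd that(3) by (simp add: m_assoc)
      also have "\<dots> = (s \<otimes> v) \<otimes> (inv v \<otimes> d \<otimes> inv u)" using s that(1) cd by (simp add: m_assoc)
      finally show "\<exists>s\<in>carrier R. x = s \<otimes> (inv v \<otimes> d \<otimes> inv u)"
        by (rule bexI) (simp add: s)
    next
      assume "\<exists>s\<in>carrier R. x = s \<otimes> (inv v \<otimes> d \<otimes> inv u)"
      then obtain s where s: "s \<in> carrier R" "x = s \<otimes> (inv v \<otimes> d \<otimes> inv u)" by auto
      then have "x = (s \<otimes> inv v) \<otimes> d \<otimes> inv u" using s cd by (simp add: m_assoc)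
      then show "\<exists>s\<in>carrier R. x = s \<otimes> d \<otimes> inv u" using s by (metis m_closed Units_inv_closed that(3))
    qed
    finally show ?thesis .
  qed
  have 2: "inv (inv v) = v" "inv (inv u) = u" using assms by auto
  show ?thesis unfolding left_morphic_pair_def
  proof (intro conjI ballI)
    fix x assume x: "x \<in> carrier R"
    show "x \<otimes> (u \<otimes> a \<otimes> v) = \<zero> \<longleftrightarrow> (\<exists>s\<in>carrier R. x = s \<otimes> (inv v \<otimes> b \<otimes> inv u))"
      by (rule 1) (use x ab assms in \<open>auto simp: left_morphic_pair_def\<close>)
    show "x \<otimes> (inv v \<otimes> b \<otimes> inv u) = \<zero> \<longleftrightarrow> (\<exists>s\<in>carrier R. x = s \<otimes> (u \<otimes> a \<otimes> v))"
      using 1[of x "inv v" "inv u" b a] x ab assms unfolding 2 by (auto simp: left_morphic_pair_def)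
  qed (use assms ab in auto)
qed

end

section \<open>Opposite rings\<close>

definition opposite_ring :: "('a, 'k) ring_scheme \<Rightarrow> ('a, 'k) ring_scheme"
  where "opposite_ring S = S\<lparr>mult := \<lambda>x y. y \<otimes>\<^bsub>S\<^esub> x\<rparr>"

lemma opposite_ring_simps [simp]:
  "carrier (opposite_ring S) = carrier S"
  "x \<otimes>\<^bsub>opposite_ring S\<^esub> y = y \<otimes>\<^bsub>S\<^esub> x"
  "\<one>\<^bsub>opposite_ring S\<^esub> = \<one>\<^bsub>S\<^esub>"
  "\<zero>\<^bsub>opposite_ring S\<^esub> = \<zero>\<^bsub>S\<^esub>"
  "x \<oplus>\<^bsub>opposite_ring S\<^esub> y = x \<oplus>\<^bsub>S\<^esub> y"
  by (simp_all add: opposite_ring_def)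

lemma ring_opposite_ring:
  assumes "ring S"
  shows "ring (opposite_ring S)"
proof -
  interpret ring S by fact
  show ?thesis
  proof (rule ringI)
    show "abelian_group (opposite_ring S)"
      by (rule abelian_groupI) (auto simp: a_assoc intro: a_comm bexI[of _ "\<ominus>\<^bsub>S\<^esub> _"] l_neg)
    show "monoid (opposite_ring S)"
      by unfold_locales (auto simp: m_assoc)
  qed (auto simp: l_distr r_distr)
qed

lemma pow_opposite_ring:
  assumes "ring S" "x \<in> carrier S"
  shows "x [^]\<^bsub>opposite_ring S\<^esub> (n::nat) = x [^]\<^bsub>S\<^esub> n"
proof -
  interpret ring S by fact
  have pow: "x [^]\<^bsub>opposite_ring S\<^esub> Suc n = x \<otimes>\<^bsub>S\<^esub> x [^]\<^bsub>opposite_ring S\<^esub> n" for n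
    by (simp add: nat_pow_def)
  show ?thesis
  proof (induction n)
    case (Suc n)
    then show ?case by (simp only: pow nat_pow_Suc2[OF assms(2)])
  qed (simp add: nat_pow_def)
qed

lemma Units_opposite_ring [simp]: "Units (opposite_ring S) = Units S"
  by (auto simp: Units_def)

text \<open>Cosets and sums of sets involve addition alone, which the opposite ring keeps; the
  multiplications that occur are exchanged, so the definitions coincide after unfolding.\<close>

lemma right_morphic_element_opposite_ring:
  "right_morphic_element S a \<longleftrightarrow> left_morphic_element (opposite_ring S) a"
proof -
  have "A_RCOSETS (opposite_ring S) = A_RCOSETS S" "set_add (opposite_ring S) = set_add S"
    by (intro ext; simp add: A_RCOSETS_def' a_r_coset_def' set_add_def')+
  then show ?thesis
    by (simp add: right_morphic_element_def left_morphic_element_def is_module_iso_def module_iso_def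
        right_quotient_module_def left_quotient_module_def r_coset_def l_coset_def
        right_annihilator_module_def left_annihilator_module_def)
qed

lemma right_morphic_ring_opposite_ring:
  "right_morphic_ring S \<longleftrightarrow> left_morphic_ring (opposite_ring S)"
  by (simp add: right_morphic_ring_def left_morphic_ring_def right_morphic_element_opposite_ring)

lemma unit_regular_ring_opposite_ring:
  assumes "ring S" "unit_regular_ring S"
  shows "unit_regular_ring (opposite_ring S)"
proof -
  interpret ring S by fact
  show ?thesis using assms(2) unfolding unit_regular_ring_def
    by (simp add: m_assoc[OF _ Units_closed])
qed

section \<open>Corners of unit regular rings, and Ehrlich's argument\<close>

context ring begin

text \<open>In a product associated to the right, the left side of a relation \<open>a b = c\<close>
  is not a subterm of \<open>a (b x)\<close>. This gives a relation the form with a tail; the lists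
  named \<open>wr\<close> collect such forms so that noncommutative words can be normalised.\<close>

lemma word_rewrite:
  assumes "a \<otimes> b = c" "a \<in> carrier R" "b \<in> carrier R" "x \<in> carrier R"
  shows "a \<otimes> (b \<otimes> x) = c \<otimes> x"
  using assms by (simp add: m_assoc[symmetric])

lemma UnitsI:
  assumes "a \<in> carrier R" "b \<in> carrier R" "a \<otimes> b = \<one>" "b \<otimes> a = \<one>"
  shows "a \<in> Units R"
  using assms by (auto simp: Units_def)

lemma one_plus_square_zero_Units:
  assumes "n \<in> carrier R" "n \<otimes> n = \<zero>"
  shows "\<one> \<oplus> n \<in> Units R"
  by (rule UnitsI[of _ "\<one> \<ominus> n"]) (use assms r_one in algebra)+

lemma one_minus_square_zero_Units:
  assumes "n \<in> carrier R" "n \<otimes> n = \<zero>"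
  shows "\<one> \<ominus> n \<in> Units R"
  by (rule UnitsI[of _ "\<one> \<oplus> n"]) (use assms r_one in algebra)+

text \<open>
  For an idempotent \<open>e\<close>, the corner ring \<open>eRe\<close> is unit regular, with the units \<open>v\<close> of \<open>eRe\<close>
  represented by the units \<open>w = v + (1 - e)\<close> of \<open>R\<close>.
\<close>

definition unit_regular_corner :: "'a \<Rightarrow> bool"
  where "unit_regular_corner e \<longleftrightarrow> (\<forall>a\<in>carrier R. e \<otimes> a = a \<longrightarrow> a \<otimes> e = a \<longrightarrow>
    (\<exists>w\<in>Units R. w \<otimes> (\<one> \<ominus> e) = \<one> \<ominus> e \<and> (\<one> \<ominus> e) \<otimes> w = \<one> \<ominus> e \<and> a \<otimes> w \<otimes> a = a))"

text \<open>Unit regularity is applied to \<open>a + f\<close> with \<open>f = 1 - e\<close> rather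
  than to \<open>a\<close>. Comparing Peirce components of \<open>(a + f) u (a + f) = a + f\<close>
  gives \<open>fuf = f\<close>, so the corner of \<open>u\<close> at \<open>f\<close> is invertible
  and \<open>u\<close> has a Schur complement in \<open>eRe\<close>.\<close>

lemma unit_regular_cornerI:
  assumes ur: "unit_regular_ring R" and e: "e \<in> carrier R" "e \<otimes> e = e"
  shows "unit_regular_corner e"
  unfolding unit_regular_corner_def
proof (intro ballI impI)
  fix a assume a: "a \<in> carrier R" "e \<otimes> a = a" "a \<otimes> e = a"
  define f where "f = \<one> \<ominus> e"
  have f: "f \<in> carrier R" "f \<otimes> f = f" unfolding f_def using e r_one by (auto; algebra)+
  have ef: "e = \<one> \<ominus> f" unfolding f_def using e by algebra
  have fa: "f \<otimes> a = \<zero>" "a \<otimes> f = \<zero>" unfolding f_def using a e r_one by (auto; algebra)+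
  obtain u where u: "u \<in> Units R" and bub: "a \<oplus> f = (a \<oplus> f) \<otimes> u \<otimes> (a \<oplus> f)"
    using ur a f unfolding unit_regular_ring_def by blast
  define v where "v = inv u"
  have uv: "u \<in> carrier R" "v \<in> carrier R" "u \<otimes> v = \<one>" "v \<otimes> u = \<one>"
    using u by (auto simp: v_def)
  note wr = word_rewrite[OF f(2) f(1) f(1)] word_rewrite[OF uv(3) uv(1,2)] word_rewrite[OF uv(4) uv(2,1)]
    word_rewrite[OF fa(1) f(1) a(1)] word_rewrite[OF fa(2) a(1) f(1)]
  have "f \<otimes> ((a \<oplus> f) \<otimes> u \<otimes> (a \<oplus> f)) \<otimes> f = f \<otimes> (u \<otimes> f)"
    "e \<otimes> ((a \<oplus> f) \<otimes> u \<otimes> (a \<oplus> f)) \<otimes> f = a \<otimes> (u \<otimes> f)"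
    "f \<otimes> ((a \<oplus> f) \<otimes> u \<otimes> (a \<oplus> f)) \<otimes> e = f \<otimes> (u \<otimes> a)"
    "e \<otimes> ((a \<oplus> f) \<otimes> u \<otimes> (a \<oplus> f)) \<otimes> e = a \<otimes> (u \<otimes> a)"
    unfolding ef using a(1) f fa uv wr r_one by algebra+
  moreover have "f \<otimes> (a \<oplus> f) \<otimes> f = f" "e \<otimes> (a \<oplus> f) \<otimes> f = \<zero>" "f \<otimes> (a \<oplus> f) \<otimes> e = \<zero>" 
    "e \<otimes> (a \<oplus> f) \<otimes> e = a"
    unfolding ef using a(1) f fa uv wr r_one by algebra+
  ultimately have b: "f \<otimes> (u \<otimes> f) = f" "a \<otimes> (u \<otimes> f) = \<zero>" "f \<otimes> (u \<otimes> a) = \<zero>" "a \<otimes> (u \<otimes> a) = a"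
    using bub by metis+
  have c: "u \<otimes> f \<in> carrier R" "u \<otimes> a \<in> carrier R" using uv f a by auto
  note wr = wr word_rewrite[OF b(1) f(1) c(1)] word_rewrite[OF b(2) a(1) c(1)] 
    word_rewrite[OF b(3) f(1) c(2)] word_rewrite[OF b(4) a(1) c(2)]
  \<comment> \<open>This is the Schur complement of \<open>fuf = f\<close> in \<open>u\<close>, with
    \<open>f\<close> added to obtain a unit of \<open>R\<close>. As for block matrices, its inverse
    on \<open>eRe\<close> is the corner \<open>e v e\<close> of the inverse \<open>v\<close> of
    \<open>u\<close>. By \<open>auf = 0\<close> the correction term vanishes in
    \<open>a w a\<close>.\<close>
  define w where "w = e \<otimes> u \<otimes> e \<ominus> e \<otimes> u \<otimes> f \<otimes> u \<otimes> e \<oplus> f"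
  have w: "w \<in> carrier R" using uv f e by (simp add: w_def)
  have "w \<in> Units R"
    by (rule UnitsI[of _ "e \<otimes> v \<otimes> e \<oplus> f"]; (use uv f e w in simp; fail)?)
      (unfold w_def ef, (use f uv b wr r_one in algebra)+)
  moreover have "w \<otimes> f = f" "f \<otimes> w = f" "a \<otimes> w \<otimes> a = a"
    unfolding w_def ef using a(1) f fa uv wr b r_one by algebra+
  ultimately show "\<exists>w\<in>Units R. w \<otimes> (\<one> \<ominus> e) = \<one> \<ominus> e \<and> (\<one> \<ominus> e) \<otimes> w = \<one> \<ominus> e \<and> a \<otimes> w \<otimes> a = a"
    unfolding f_def by blast
qed

text \<open>
  Ehrlich's argument. With \<open>z\<close> a reflexive inverse of \<open>a\<close>, right multiplication by the unit is
  \<open>z\<close> on \<open>R(za)\<close> and \<open>b\<close> on \<open>R(1 - za)\<close>; it maps these summands onto \<open>R(az)\<close> and \<open>R(1 - az)\<close>.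
\<close>

lemma regular_left_morphic_pair_imp_unit_regular:
  assumes m: "left_morphic_pair R a b" and y: "y \<in> carrier R" "a \<otimes> y \<otimes> a = a"
  shows "\<exists>u\<in>Units R. a = a \<otimes> u \<otimes> a"
proof -
  have ab: "a \<in> carrier R" "b \<in> carrier R" using m by (auto simp: left_morphic_pair_def)
  have la: "x \<otimes> a = \<zero> \<longleftrightarrow> (\<exists>s\<in>carrier R. x = s \<otimes> b)" 
   and lb: "x \<otimes> b = \<zero> \<longleftrightarrow> (\<exists>s\<in>carrier R. x = s \<otimes> a)" if "x \<in> carrier R" for x
    using m that by (auto simp: left_morphic_pair_def)
  define z where "z = y \<otimes> a \<otimes> y"
  have z: "z \<in> carrier R" using y ab by (simp add: z_def)
  have yc: "y \<otimes> a \<in> carrier R" using y ab by auto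
  have y': "a \<otimes> (y \<otimes> a) = a" using y ab by (simp add: m_assoc)
  have aza: "a \<otimes> (z \<otimes> a) = a" "z \<otimes> (a \<otimes> z) = z"
    unfolding z_def using y ab y' word_rewrite[OF y' ab(1) yc] by algebra+
  have ba: "b \<otimes> a = \<zero>" using la[of b] ab by (auto intro!: bexI[of _ \<one>])
  have ab0: "a \<otimes> b = \<zero>" using lb[of a] ab by (auto intro!: bexI[of _ \<one>])
  have "(\<one> \<ominus> a \<otimes> z) \<otimes> a = \<zero>" using ab z aza r_one by algebra
  then obtain w where w: "w \<in> carrier R" "\<one> \<ominus> a \<otimes> z = w \<otimes> b"
    using la[of "\<one> \<ominus> a \<otimes> z"] ab z by auto
  have bwb: "b \<otimes> (w \<otimes> b) = b"
    unfolding w(2)[symmetric] using ab z ba word_rewrite[OF ba ab(2,1) z] r_one by algebra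
  have "(b \<otimes> w \<ominus> \<one>) \<otimes> b = \<zero>" using ab w(1) bwb by algebra
  then obtain s where s: "s \<in> carrier R" "b \<otimes> w \<ominus> \<one> = s \<otimes> a"
    using lb[of "b \<otimes> w \<ominus> \<one>"] ab w(1) by auto
  have "b \<otimes> w = (b \<otimes> w \<ominus> \<one>) \<oplus> \<one>" using ab w(1) by algebra
  then have bw: "b \<otimes> w = s \<otimes> a \<oplus> \<one>" by (simp add: s)
  have wb': "w \<otimes> b = \<one> \<ominus> a \<otimes> z" using w by simp
  have zc: "z \<otimes> a \<in> carrier R" "a \<otimes> z \<in> carrier R" using z ab by auto
  note wr = word_rewrite[OF ba ab(2,1)] word_rewrite[OF ab0 ab] word_rewrite[OF aza(1) ab(1) zc(1)]
    word_rewrite[OF aza(2) z zc(2)] word_rewrite[OF bw ab(2) w(1)] word_rewrite[OF wb' w(1) ab(2)]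
  \<comment> \<open>The second summand of the inverse undoes right multiplication by
    \<open>b\<close> between the complements: \<open>w b = 1 - a z\<close>, while
    \<open>b w = 1 + s a\<close> and the extra term dies because
    \<open>a (1 - z a) = 0\<close>.\<close>
  have "z \<oplus> (\<one> \<ominus> z \<otimes> a) \<otimes> b \<in> Units R"
    by (rule UnitsI[of _ "a \<oplus> (\<one> \<ominus> a \<otimes> z) \<otimes> w \<otimes> (\<one> \<ominus> z \<otimes> a)"]; (use ab z w(1) in simp; fail)?)
      (use ab z w(1) s(1) aza ba ab0 bw wb' wr r_one in algebra)+
  moreover have "a = a \<otimes> (z \<oplus> (\<one> \<ominus> z \<otimes> a) \<otimes> b) \<otimes> a"
    using ab z aza ba ab0 wr r_one by algebra
  ultimately show ?thesis by blast
qed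

end

section \<open>Regularity from annihilators, and regularity of sums of corners\<close>

context ring begin

text \<open>\<open>inj\<close> and \<open>surj\<close> say that \<open>r \<mapsto> r c\<close>
  induces an injective map from \<open>l(b) = Ra\<close> to \<open>R/Rb\<close> that reaches the
  coset of \<open>1\<close>. A preimage \<open>z\<close> of that coset satisfies
  \<open>b z = 0\<close>, so multiplying \<open>z c + m b = 1\<close> by \<open>b\<close> on the
  left leaves \<open>b m b = b\<close>.\<close>

lemma left_morphic_pair_imp_unit_regular:
  assumes m: "left_morphic_pair R a b" and c: "c \<in> carrier R"
    and inj: "\<And>r m. r \<in> carrier R \<Longrightarrow> m \<in> carrier R \<Longrightarrow> r \<otimes> b = \<zero> \<Longrightarrow> r \<otimes> c \<oplus> m \<otimes> b = \<zero> \<Longrightarrow> r = \<zero>"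
    and surj: "\<exists>r\<in>carrier R. \<exists>m\<in>carrier R. r \<otimes> b = \<zero> \<and> r \<otimes> c \<oplus> m \<otimes> b = \<one>"
  shows "\<exists>u\<in>Units R. a = a \<otimes> u \<otimes> a"
proof -
  have ab: "a \<in> carrier R" "b \<in> carrier R" using m by (auto simp: left_morphic_pair_def)
  have la: "x \<otimes> a = \<zero> \<longleftrightarrow> (\<exists>s\<in>carrier R. x = s \<otimes> b)" 
   and lb: "x \<otimes> b = \<zero> \<longleftrightarrow> (\<exists>s\<in>carrier R. x = s \<otimes> a)" if "x \<in> carrier R" for x
    using m that by (auto simp: left_morphic_pair_def)
  have ba: "b \<otimes> a = \<zero>" using la[of b] ab by (auto intro!: bexI[of _ \<one>])
  have ab0: "a \<otimes> b = \<zero>" using lb[of a] ab by (auto intro!: bexI[of _ \<one>])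
  obtain z m where z: "z \<in> carrier R" "m \<in> carrier R" "z \<otimes> b = \<zero>" "z \<otimes> c \<oplus> m \<otimes> b = \<one>"
    using surj by auto
  obtain t where t: "t \<in> carrier R" "z = t \<otimes> a" using lb[of z] z by auto
  have "z \<otimes> c \<otimes> a = (z \<otimes> c \<oplus> m \<otimes> b) \<otimes> a"
    using ab z(1,2) c ba by (simp add: l_distr m_assoc)
  then have zca: "z \<otimes> c \<otimes> a = a" using z ab by simp
  \<comment> \<open>By injectivity it suffices that \<open>b z c\<close> lies in
    \<open>Rb = l(a)\<close>; this follows from \<open>z c a = a\<close> and
    \<open>b a = 0\<close>.\<close>
  have "b \<otimes> z = \<zero>"
  proof -
    have bz: "b \<otimes> z \<in> carrier R" using ab z by simp
    have "b \<otimes> z \<otimes> c \<otimes> a = b \<otimes> (z \<otimes> c \<otimes> a)" using ab z(1) c by (simp add: m_assoc)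
    then have "b \<otimes> z \<otimes> c \<otimes> a = \<zero>" using zca ba by simp
    then obtain s where s: "s \<in> carrier R" "b \<otimes> z \<otimes> c = s \<otimes> b"
      using la[of "b \<otimes> z \<otimes> c"] bz c by auto
    have "b \<otimes> z \<otimes> c \<oplus> (\<ominus> s) \<otimes> b = \<zero>" using s ab by (simp add: l_minus r_neg)
    moreover have "b \<otimes> z \<otimes> b = \<zero>" using z ab by (simp add: m_assoc)
    ultimately show ?thesis using inj[of "b \<otimes> z" "\<ominus> s"] bz s by simp
  qed
  then have bzc: "b \<otimes> (z \<otimes> c) = \<zero>" using z(1) ab c by (simp flip: m_assoc)
  have "b \<otimes> m \<otimes> b = b \<otimes> (z \<otimes> c \<oplus> m \<otimes> b)" using z(1,2) c ab bzc by (simp add: m_assoc r_distr)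
  then have bmb: "b \<otimes> m \<otimes> b = b" using z ab by simp
  \<comment> \<open>Regularity passes from \<open>b\<close> to \<open>a\<close>: the element
    \<open>1 - b m\<close> of \<open>l(b) = Ra\<close> has the form \<open>y a\<close>, and
    \<open>a b = 0\<close> then gives \<open>a y a = a\<close>.\<close>
  have "(\<one> \<ominus> b \<otimes> m) \<otimes> b = \<zero>" using bmb ab z(2) by algebra
  then obtain y where y: "y \<in> carrier R" "\<one> \<ominus> b \<otimes> m = y \<otimes> a"
    using lb[of "\<one> \<ominus> b \<otimes> m"] ab z by auto
  have "a \<otimes> y \<otimes> a = a \<otimes> (\<one> \<ominus> b \<otimes> m)" using y ab by (simp add: m_assoc)
  also have "\<dots> = a" using ab z(2) ab0 word_rewrite[OF ab0 ab z(2)] r_one by algebra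
  finally show ?thesis using regular_left_morphic_pair_imp_unit_regular[OF m] y by blast
qed

text \<open>This is regularity of the rectangular corner \<open>eRf\<close>. Letting
  \<open>e\<close> and \<open>f\<close> differ makes it possible to enlarge rows and columns
  separately. The inverse is sought in all of \<open>R\<close>, since \<open>f y e\<close> may
  replace \<open>y\<close>.\<close>

definition regular_between :: "'a \<Rightarrow> 'a \<Rightarrow> bool"
  where "regular_between e f \<longleftrightarrow>
    (\<forall>m\<in>carrier R. e \<otimes> m = m \<longrightarrow> m \<otimes> f = m \<longrightarrow> (\<exists>y\<in>carrier R. m \<otimes> y \<otimes> m = m))"

text \<open>Both \<open>m (1 - n m)\<close> and \<open>(1 - m n) m\<close> equal
  \<open>d = m - m n m\<close>. So surrounding an inverse \<open>y\<close> of \<open>d\<close> by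
  these factors contributes \<open>d y d = d\<close>, and \<open>n\<close> supplies the missing
  \<open>m n m\<close>.\<close>

lemma McCoy_regular:
  assumes "m \<in> carrier R" "n \<in> carrier R" "y \<in> carrier R"
    and "(m \<ominus> m \<otimes> n \<otimes> m) \<otimes> y \<otimes> (m \<ominus> m \<otimes> n \<otimes> m) = m \<ominus> m \<otimes> n \<otimes> m"
  shows "\<exists>y\<in>carrier R. m \<otimes> y \<otimes> m = m"
proof (rule bexI)
  show "n \<oplus> (\<one> \<ominus> n \<otimes> m) \<otimes> y \<otimes> (\<one> \<ominus> m \<otimes> n) \<in> carrier R" using assms(1-3) by simp
  have "m \<otimes> (n \<oplus> (\<one> \<ominus> n \<otimes> m) \<otimes> y \<otimes> (\<one> \<ominus> m \<otimes> n)) \<otimes> m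
    = m \<otimes> n \<otimes> m \<oplus> (m \<ominus> m \<otimes> n \<otimes> m) \<otimes> y \<otimes> (m \<ominus> m \<otimes> n \<otimes> m)"
    using assms(1-3) r_one by algebra
  also have "\<dots> = m" unfolding assms(4) using assms(1-3) by algebra
  finally show "m \<otimes> (n \<oplus> (\<one> \<ominus> n \<otimes> m) \<otimes> y \<otimes> (\<one> \<ominus> m \<otimes> n)) \<otimes> m = m" .
qed

text \<open>An inverse \<open>n\<close> of the row \<open>e m\<close> gives the correction
  \<open>k = n e\<close>, for which the row \<open>e d\<close> of \<open>d = m - m k m\<close>
  vanishes. What is left lies in \<open>e'Rf\<close>, where regularity is assumed, and McCoy's lemma
  leads back to \<open>m\<close>.\<close>

lemma regular_between_add_left:
  assumes e: "e \<in> carrier R" "e' \<in> carrier R" "f \<in> carrier R" "e \<otimes> e = e" "e \<otimes> e' = \<zero>"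
    and r: "regular_between e f" "regular_between e' f"
  shows "regular_between (e \<oplus> e') f"
  unfolding regular_between_def
proof (intro ballI impI)
  fix m assume m: "m \<in> carrier R" "(e \<oplus> e') \<otimes> m = m" "m \<otimes> f = m"
  have em: "e \<otimes> m \<in> carrier R" "e \<otimes> (e \<otimes> m) = e \<otimes> m" "e \<otimes> m \<otimes> f = e \<otimes> m"
    using e m by (simp_all add: m_assoc word_rewrite)
  then obtain n where n: "n \<in> carrier R" "e \<otimes> m \<otimes> n \<otimes> (e \<otimes> m) = e \<otimes> m"
    using r(1) unfolding regular_between_def by blast
  define k where "k = n \<otimes> e"
  have k: "k \<in> carrier R" using n e by (simp add: k_def)
  define d where "d = m \<ominus> m \<otimes> k \<otimes> m"
  have d: "d \<in> carrier R" using m k by (simp add: d_def)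
  have "e \<otimes> d = e \<otimes> m \<ominus> e \<otimes> m \<otimes> n \<otimes> (e \<otimes> m)"
    unfolding d_def k_def using e m(1) n(1) by algebra
  then have ed: "e \<otimes> d = \<zero>" using n(2) em by (simp add: minus_eq_zero_iff)
  have "(e \<oplus> e') \<otimes> d = (e \<oplus> e') \<otimes> m \<ominus> (e \<oplus> e') \<otimes> m \<otimes> k \<otimes> m"
    unfolding d_def using e m(1) k by algebra
  then have "(e \<oplus> e') \<otimes> d = d" unfolding m(2) d_def .
  then have "e' \<otimes> d = d" using ed e d by (simp add: l_distr)
  moreover have "d \<otimes> f = d"
  proof -
    have "d \<otimes> f = m \<otimes> f \<ominus> m \<otimes> k \<otimes> (m \<otimes> f)" unfolding d_def using e(3) m(1) k by algebra
    then show ?thesis unfolding m(3) d_def .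
  qed
  ultimately obtain y where "y \<in> carrier R" "d \<otimes> y \<otimes> d = d"
    using r(2) d unfolding regular_between_def by blast
  then show "\<exists>y\<in>carrier R. m \<otimes> y \<otimes> m = m"
    using m k unfolding d_def by (intro McCoy_regular) auto
qed

text \<open>The mirror image: the column \<open>m f\<close> is cleared by the correction
  \<open>k = f n\<close>.\<close>

lemma regular_between_add_right:
  assumes e: "e \<in> carrier R" "f \<in> carrier R" "f' \<in> carrier R" "f \<otimes> f = f" "f' \<otimes> f = \<zero>"
    and r: "regular_between e f" "regular_between e f'"
  shows "regular_between e (f \<oplus> f')"
  unfolding regular_between_def
proof (intro ballI impI)
  fix m assume m: "m \<in> carrier R" "e \<otimes> m = m" "m \<otimes> (f \<oplus> f') = m"
  have mf: "m \<otimes> f \<in> carrier R" "e \<otimes> (m \<otimes> f) = m \<otimes> f" "m \<otimes> f \<otimes> f = m \<otimes> f"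
    using e m by (simp_all add: m_assoc word_rewrite)
  then obtain n where n: "n \<in> carrier R" "m \<otimes> f \<otimes> n \<otimes> (m \<otimes> f) = m \<otimes> f"
    using r(1) unfolding regular_between_def by blast
  define k where "k = f \<otimes> n"
  have k: "k \<in> carrier R" using n e by (simp add: k_def)
  define d where "d = m \<ominus> m \<otimes> k \<otimes> m"
  have d: "d \<in> carrier R" using m k by (simp add: d_def)
  have "d \<otimes> f = m \<otimes> f \<ominus> m \<otimes> f \<otimes> n \<otimes> (m \<otimes> f)"
    unfolding d_def k_def using e(2) m(1) n(1) by algebra
  then have df: "d \<otimes> f = \<zero>" using n(2) mf by (simp add: minus_eq_zero_iff)
  have "d \<otimes> (f \<oplus> f') = m \<otimes> (f \<oplus> f') \<ominus> m \<otimes> k \<otimes> (m \<otimes> (f \<oplus> f'))"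
    unfolding d_def using e(2,3) m(1) k by algebra
  then have "d \<otimes> (f \<oplus> f') = d" unfolding m(3) d_def .
  then have "d \<otimes> f' = d" using df e d by (simp add: r_distr)
  moreover have "e \<otimes> d = d"
  proof -
    have "e \<otimes> d = e \<otimes> m \<ominus> (e \<otimes> m) \<otimes> k \<otimes> m" unfolding d_def using e(1) m(1) k by algebra
    then show ?thesis unfolding m(2) d_def .
  qed
  ultimately obtain y where "y \<in> carrier R" "d \<otimes> y \<otimes> d = d"
    using r(2) d unfolding regular_between_def by blast
  then show "\<exists>y\<in>carrier R. m \<otimes> y \<otimes> m = m"
    using m k unfolding d_def by (intro McCoy_regular) auto
qed

end

section \<open>Henriksen's theorem for the sum of two orthogonal corners\<close>

text \<open>
  The group \<open>stab\<close> consists of the units acting trivially on the complement \<open>h\<close> of \<open>e + f\<close>;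
  \<open>good \<alpha>\<close> is invariant under multiplication by its elements, so that \<open>\<alpha>\<close>, seen as a
  \<open>2 \<times> 2\<close> matrix with entries \<open>a, b, c, d\<close>, can be brought to a normal form.
\<close>

locale two_corners = ring R for R (structure) +
  fixes e f h
  assumes ef: "e \<in> carrier R" "f \<in> carrier R" "e \<otimes> e = e" "f \<otimes> f = f" "e \<otimes> f = \<zero>" "f \<otimes> e = \<zero>"
    and h_def: "h = \<one> \<ominus> (e \<oplus> f)"
    and regular: "\<And>a. a \<in> carrier R \<Longrightarrow> \<exists>y\<in>carrier R. a \<otimes> y \<otimes> a = a"
begin

lemma h: "h \<in> carrier R" "h \<otimes> h = h" "h \<otimes> e = \<zero>" "h \<otimes> f = \<zero>" "e \<otimes> h = \<zero>" "f \<otimes> h = \<zero>"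
  unfolding h_def using ef word_rewrite[OF ef(3)] word_rewrite[OF ef(4)] r_one
  by (simp; fail | algebra)+

definition "stab = {w \<in> Units R. w \<otimes> h = h \<and> h \<otimes> w = h}"

lemma stab_mult: "v \<in> stab \<Longrightarrow> w \<in> stab \<Longrightarrow> v \<otimes> w \<in> stab"
  using h(1) by (auto simp: stab_def m_assoc Units_closed) (simp add: Units_closed flip: m_assoc)

definition "good \<alpha> \<longleftrightarrow> (\<exists>w\<in>stab. \<alpha> \<otimes> w \<otimes> \<alpha> = \<alpha>)"

text \<open>Cancelling the outer units turns a witness \<open>w\<close> for
  \<open>P \<alpha> Q\<close> into the witness \<open>Q w P\<close> for
  \<open>\<alpha>\<close>.\<close>

lemma good_mult:
  assumes \<alpha>: "\<alpha> \<in> carrier R" and PQ: "P \<in> stab" "Q \<in> stab" and g: "good (P \<otimes> \<alpha> \<otimes> Q)"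
  shows "good \<alpha>"
proof -
  have U: "P \<in> Units R" "Q \<in> Units R" using PQ by (auto simp: stab_def)
  obtain w where w: "w \<in> stab" and eq: "(P \<otimes> \<alpha> \<otimes> Q) \<otimes> w \<otimes> (P \<otimes> \<alpha> \<otimes> Q) = P \<otimes> \<alpha> \<otimes> Q"
    using g by (auto simp: good_def)
  have w': "w \<in> carrier R" using w by (auto simp: stab_def)
  have "P \<otimes> (\<alpha> \<otimes> (Q \<otimes> w \<otimes> P) \<otimes> \<alpha>) \<otimes> Q = P \<otimes> \<alpha> \<otimes> Q"
    using eq \<alpha> U w' by (simp add: m_assoc Units_closed)
  then have "P \<otimes> (\<alpha> \<otimes> (Q \<otimes> w \<otimes> P) \<otimes> \<alpha>) = P \<otimes> \<alpha>"
    using U \<alpha> w' mult_Unit_eq_iff[of Q "P \<otimes> (\<alpha> \<otimes> (Q \<otimes> w \<otimes> P) \<otimes> \<alpha>)" "P \<otimes> \<alpha> \<otimes> Q"]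
    by (simp add: m_assoc Units_closed)
  then have "\<alpha> \<otimes> (Q \<otimes> w \<otimes> P) \<otimes> \<alpha> = \<alpha>"
    using U \<alpha> w' Units_l_cancel[of P "\<alpha> \<otimes> (Q \<otimes> w \<otimes> P) \<otimes> \<alpha>" \<alpha>] by (simp add: Units_closed)
  then show ?thesis unfolding good_def using PQ w stab_mult by blast
qed

lemma one_plus_stab:
  assumes "n \<in> carrier R" "n \<otimes> n = \<zero>" "n \<otimes> h = \<zero>" "h \<otimes> n = \<zero>"
  shows "\<one> \<oplus> n \<in> stab"
  using assms one_plus_square_zero_Units[of n] h(1) by (simp add: stab_def l_distr r_distr)

lemma one_minus_stab:
  assumes "n \<in> carrier R" "n \<otimes> n = \<zero>" "n \<otimes> h = \<zero>" "h \<otimes> n = \<zero>"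
  shows "\<one> \<ominus> n \<in> stab"
  using assms one_plus_stab[of "\<ominus> n"] h(1) by (simp add: minus_eq l_minus r_minus)

text \<open>For idempotents \<open>p\<close>, \<open>q\<close> this is membership in the Peirce
  component \<open>pRq\<close>, that is, an entry in row \<open>p\<close> and column
  \<open>q\<close>.\<close>

definition "block p q a \<longleftrightarrow> a \<in> carrier R \<and> p \<otimes> a = a \<and> a \<otimes> q = a"

lemma block_mult_zero:
  assumes "block p q a" "block p' q' b" "q \<otimes> p' = \<zero>" "q \<in> carrier R" "p' \<in> carrier R"
  shows "a \<otimes> b = \<zero>"
proof -
  have c: "a \<in> carrier R" "b \<in> carrier R" using assms by (auto simp: block_def)
  have "a \<otimes> b = (a \<otimes> q) \<otimes> (p' \<otimes> b)" using assms by (auto simp: block_def)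
  also have "\<dots> = a \<otimes> ((q \<otimes> p') \<otimes> b)" using c assms(4,5) by (simp add: m_assoc)
  also have "\<dots> = \<zero>" using c assms(3) by simp
  finally show ?thesis .
qed

lemma block_mult:
  assumes "block p q a" "block p' q' b" "p \<in> carrier R" "q' \<in> carrier R"
  shows "block p q' (a \<otimes> b)"
  using assms by (auto simp: block_def m_assoc) (simp flip: m_assoc)

lemma block_diff:
  assumes "block p q a" "block p q b" "p \<in> carrier R" "q \<in> carrier R"
  shows "block p q (a \<ominus> b)"
  using assms by (auto simp: block_def minus_eq l_distr r_distr l_minus r_minus)

lemma block_add:
  assumes "block p q a" "block p q b" "p \<in> carrier R" "q \<in> carrier R"
  shows "block p q (a \<oplus> b)"
  using assms by (auto simp: block_def l_distr r_distr)

lemma block_carrier: "block p q a \<Longrightarrow> a \<in> carrier R"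
  by (simp add: block_def)

lemma block_orthogonal:
  "block p e a \<Longrightarrow> block f q b \<Longrightarrow> a \<otimes> b = \<zero>"
  "block p f a \<Longrightarrow> block e q b \<Longrightarrow> a \<otimes> b = \<zero>"
  using block_mult_zero[of p e a f q b] block_mult_zero[of p f a e q b] ef by auto

lemma block_h:
  "block e q a \<Longrightarrow> h \<otimes> a = \<zero>" "block f q a \<Longrightarrow> h \<otimes> a = \<zero>"
  "block p e a \<Longrightarrow> a \<otimes> h = \<zero>" "block p f a \<Longrightarrow> a \<otimes> h = \<zero>"
  using block_mult_zero[of h h h e q a] block_mult_zero[of h h h f q a]
    block_mult_zero[of p e a h h h] block_mult_zero[of p f a h h h] h ef
  by (auto simp: block_def)

text \<open>For any inner inverse \<open>y\<close> of \<open>c\<close>, the element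
  \<open>y c y\<close> is a reflexive one, and cutting it down to \<open>qRp\<close> is harmless
  because \<open>c\<close> lies in \<open>pRq\<close>.\<close>

lemma obtain_quasi_inverse:
  assumes c: "block p q c" and pq: "p \<in> carrier R" "q \<in> carrier R" "p \<otimes> p = p" "q \<otimes> q = q"
  obtains n where "block q p n" "c \<otimes> (n \<otimes> c) = c" "n \<otimes> (c \<otimes> n) = n"
proof -
  have c': "c \<in> carrier R" "p \<otimes> c = c" "c \<otimes> q = c" using c by (auto simp: block_def)
  obtain y where y: "y \<in> carrier R" "c \<otimes> (y \<otimes> c) = c" using regular[of c] c' by (auto simp: m_assoc)
  have yc: "y \<otimes> c \<in> carrier R" using y c' by simp
  define n where "n = q \<otimes> y \<otimes> c \<otimes> y \<otimes> p"
  note wr = word_rewrite[OF c'(2) pq(1) c'(1)] word_rewrite[OF c'(3) c'(1) pq(2)]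
    word_rewrite[OF y(2) c'(1) yc] word_rewrite[OF pq(3) pq(1) pq(1)] word_rewrite[OF pq(4) pq(2) pq(2)]
  show ?thesis
  proof (rule that)
    show "block q p n" unfolding block_def n_def 
      by (intro conjI; (use y(1) c'(1) pq in simp; fail)?) (use y c' pq wr in algebra)+
    show "c \<otimes> (n \<otimes> c) = c" "n \<otimes> (c \<otimes> n) = n"
      unfolding n_def using y c' pq wr by algebra+
  qed
qed

text \<open>By \<open>d c = 0\<close> and \<open>c a = 0\<close> the entry \<open>c\<close> lies in
  \<open>(f - d)R(e - a)\<close>, away from both diagonal idempotents. So a reflexive inverse
  \<open>n\<close> of \<open>c\<close> from the opposite corner does not interfere with
  them.\<close>

lemma good_normal_form:
  assumes bl: "block e e a" "block f e c" "block f f d"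
    and id: "a \<otimes> a = a" "d \<otimes> d = d" and z: "d \<otimes> c = \<zero>" "c \<otimes> a = \<zero>"
  shows "good (a \<oplus> c \<oplus> d)"
proof -
  have cl: "a \<in> carrier R" "c \<in> carrier R" "d \<in> carrier R" using bl by (auto simp: block_def)
  have bl': "e \<otimes> a = a" "a \<otimes> e = a" "f \<otimes> c = c" "c \<otimes> e = c" "f \<otimes> d = d" "d \<otimes> f = d"
    using bl by (auto simp: block_def)
  define p where "p = f \<ominus> d"
  define q where "q = e \<ominus> a"
  have pq: "p \<in> carrier R" "q \<in> carrier R" "p \<otimes> p = p" "q \<otimes> q = q" "block p q c"
    unfolding p_def q_def block_def using ef bl' cl id z by (simp; fail | (intro conjI)?; algebra)+
  obtain n where n: "block q p n" "c \<otimes> (n \<otimes> c) = c" "n \<otimes> (c \<otimes> n) = n"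
    by (rule obtain_quasi_inverse[OF pq(5,1-4)])
  have nc: "n \<in> carrier R" "q \<otimes> n = n" "n \<otimes> p = n" using n by (auto simp: block_def)
  have eq: "e \<otimes> q = q" "p \<otimes> f = p" "a \<otimes> q = \<zero>" "p \<otimes> d = \<zero>"
    unfolding p_def q_def using ef bl' cl id by algebra+
  have "e \<otimes> n = n" "n \<otimes> f = n"
    using word_rewrite[OF eq(1) ef(1) pq(2) nc(1)] eq(2) pq(1) ef(2) nc by (simp_all add: nc(2) m_assoc) (metis m_assoc)
  then have bn: "block e f n" using nc by (simp add: block_def)
  have "a \<otimes> n = a \<otimes> q \<otimes> n" using cl nc(1,2) pq(2) by (simp add: m_assoc)
  moreover have "n \<otimes> d = n \<otimes> (p \<otimes> d)" using cl nc(1,3) pq(1) by (simp flip: m_assoc)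
  ultimately have an: "a \<otimes> n = \<zero>" "n \<otimes> d = \<zero>" using eq nc by simp_all
  note o = block_orthogonal
  have zs: "a \<otimes> c = \<zero>" "a \<otimes> d = \<zero>" "d \<otimes> a = \<zero>" "c \<otimes> d = \<zero>" "c \<otimes> c = \<zero>" "n \<otimes> n = \<zero>"
    "n \<otimes> a = \<zero>" "d \<otimes> n = \<zero>"
    by (rule o(1) o(2), (rule bl bn)+)+
  have hz: "h \<otimes> c = \<zero>" "c \<otimes> h = \<zero>" "h \<otimes> n = \<zero>" "n \<otimes> h = \<zero>"
    by (rule block_h, (rule bl bn))+
  have cn: "c \<otimes> n \<in> carrier R" "n \<otimes> c \<in> carrier R" using nc cl by auto
  note wr = word_rewrite[OF zs(5) cl(2) cl(2)] word_rewrite[OF zs(6) nc(1) nc(1)]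
    word_rewrite[OF n(2) cl(2) cn(2)] word_rewrite[OF n(3) nc(1) cn(1)] word_rewrite[OF an(1) cl(1) nc(1)]
    word_rewrite[OF an(2) nc(1) cl(3)] word_rewrite[OF zs(7) nc(1) cl(1)] word_rewrite[OF zs(8) cl(3) nc(1)]
    word_rewrite[OF zs(1) cl(1,2)] word_rewrite[OF zs(4) cl(2,3)]
    word_rewrite[OF z(1) cl(3,2)] word_rewrite[OF z(2) cl(2,1)]
  \<comment> \<open>This involution exchanges the idempotents \<open>c n\<close> and
    \<open>n c\<close> by means of \<open>c\<close> and \<open>n\<close>, and is the identity on the
    remaining \<open>1 - c n - n c\<close>. It fixes \<open>a\<close> and \<open>d\<close> from both
    sides, and on \<open>c\<close> it acts as \<open>n\<close>:
    \<open>c w c = c n c = c\<close>.\<close>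
  define w where "w = c \<oplus> n \<oplus> \<one> \<ominus> c \<otimes> n \<ominus> n \<otimes> c"
  have wc: "w \<in> carrier R" using cl nc by (simp add: w_def)
  have "w \<otimes> w = \<one>" unfolding w_def using cl nc(1) zs n(2,3) wr r_one by algebra
  then have "w \<in> Units R" using wc UnitsI by blast
  moreover have "w \<otimes> h = h" "h \<otimes> w = h"
    unfolding w_def using cl nc(1) h(1) hz word_rewrite[OF hz(1) h(1) cl(2)] 
      word_rewrite[OF hz(3) h(1) nc(1)] r_one by algebra+
  moreover have "(a \<oplus> c \<oplus> d) \<otimes> w \<otimes> (a \<oplus> c \<oplus> d) = a \<oplus> c \<oplus> d"
    unfolding w_def using cl nc(1) zs id z an n(2,3) wr r_one by algebra
  ultimately show ?thesis unfolding good_def stab_def by blast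
qed

lemma stab_block:
  assumes "block e f n \<or> block f e n"
  shows "\<one> \<oplus> n \<in> stab" "\<one> \<ominus> n \<in> stab"
proof -
  have "n \<in> carrier R" "n \<otimes> n = \<zero>" "n \<otimes> h = \<zero>" "h \<otimes> n = \<zero>"
    using assms block_orthogonal block_h block_carrier by blast+
  then show "\<one> \<oplus> n \<in> stab" "\<one> \<ominus> n \<in> stab" by (auto intro: one_plus_stab one_minus_stab)
qed

lemma one_stab: "\<one> \<in> stab"
  using h by (simp add: stab_def)

lemma good_multI:
  assumes "\<alpha> \<in> carrier R" "P \<in> stab" "Q \<in> stab" "good \<beta>" "P \<otimes> \<alpha> \<otimes> Q = \<beta>"
  shows "good \<alpha>"
  using good_mult assms by blast

text \<open>Diagonal idempotents act as pivots for \<open>c\<close>: right multiplication by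
  \<open>1 - d c\<close> removes \<open>d c\<close>, and then left multiplication by
  \<open>1 - c' a\<close> removes \<open>c' a\<close>. The remaining entry is killed by
  \<open>d\<close> on the left and by \<open>a\<close> on the right, as the normal form
  requires.\<close>

lemma good_lower_triangular_idempotent:
  assumes bl: "block e e a" "block f e c" "block f f d"
    and id: "a \<otimes> a = a" "d \<otimes> d = d"
  shows "good (a \<oplus> c \<oplus> d)"
proof -
  have cl: "a \<in> carrier R" "c \<in> carrier R" "d \<in> carrier R" using bl by (auto simp: block_def)
  note o = block_orthogonal
  have zs: "a \<otimes> c = \<zero>" "a \<otimes> d = \<zero>" "d \<otimes> a = \<zero>" "c \<otimes> d = \<zero>" "c \<otimes> c = \<zero>"
    by (rule o(1) o(2), (rule bl)+)+
  note wr = word_rewrite[OF zs(1) cl(1,2)] word_rewrite[OF zs(2) cl(1,3)] word_rewrite[OF zs(3) cl(3,1)]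
    word_rewrite[OF zs(4) cl(2,3)] word_rewrite[OF zs(5) cl(2,2)] word_rewrite[OF id(1) cl(1,1)] 
    word_rewrite[OF id(2) cl(3,3)]
  define c' where "c' = c \<ominus> d \<otimes> c"
  define c'' where "c'' = c' \<ominus> c' \<otimes> a"
  have bc': "block f e c'" unfolding c'_def by (intro block_diff bl block_mult[OF bl(3,2)] ef)
  have bc'': "block f e c''" unfolding c''_def by (intro block_diff bc' block_mult[OF bc' bl(1)] ef)
  show ?thesis
  proof (rule good_multI)
    show "a \<oplus> c \<oplus> d \<in> carrier R" using cl by simp
    show "\<one> \<ominus> c' \<otimes> a \<in> stab" by (intro stab_block disjI2 block_mult[OF bc' bl(1)] ef)
    show "\<one> \<ominus> d \<otimes> c \<in> stab" by (intro stab_block disjI2 block_mult[OF bl(3,2)] ef)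
    show "good (a \<oplus> c'' \<oplus> d)"
      by (intro good_normal_form bl bc'' id; unfold c''_def c'_def; use cl zs id wr in algebra)
    show "(\<one> \<ominus> c' \<otimes> a) \<otimes> (a \<oplus> c \<oplus> d) \<otimes> (\<one> \<ominus> d \<otimes> c) = a \<oplus> c'' \<oplus> d"
      unfolding c''_def c'_def using cl zs id wr r_one by algebra
  qed
qed

text \<open>A unit that is trivial on \<open>1 - p\<close> is trivial on \<open>h\<close>, and
  \<open>q w = q\<close> because \<open>q = q (1 - p)\<close>. So the column of \<open>q\<close> is
  left alone while the block at \<open>p\<close> is adjusted.\<close>

lemma corner_stab:
  assumes corner: "unit_regular_corner p" and pq: "p \<in> carrier R" "q \<in> carrier R" "p \<otimes> p = p"
    and o: "q \<otimes> p = \<zero>" "h \<otimes> p = \<zero>" "p \<otimes> h = \<zero>" and bl: "block p p d"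
  obtains w where "w \<in> stab" "q \<otimes> w = q" "p \<otimes> w \<otimes> p = p \<otimes> w" "d \<otimes> w \<otimes> d = d"
proof -
  have d: "d \<in> carrier R" using bl by (auto simp: block_def)
  obtain w where w: "w \<in> Units R" "w \<otimes> (\<one> \<ominus> p) = \<one> \<ominus> p" "(\<one> \<ominus> p) \<otimes> w = \<one> \<ominus> p" "d \<otimes> w \<otimes> d = d"
    using corner bl unfolding unit_regular_corner_def block_def by blast
  have wc: "w \<in> carrier R" using w by auto
  have pc: "\<one> \<ominus> p \<in> carrier R" using pq by simp
  have fp: "(\<one> \<ominus> p) \<otimes> h = h" "h \<otimes> (\<one> \<ominus> p) = h" "q \<otimes> (\<one> \<ominus> p) = q" "p \<otimes> (\<one> \<ominus> p) = \<zero>"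
    using pq h o r_one by algebra+
  have "w \<in> stab"
    using w(1) word_rewrite[OF w(2) wc pc h(1)] word_rewrite[OF fp(2) h(1) pc wc]
    by (simp add: stab_def fp w)
  moreover have "q \<otimes> w = q"
    using word_rewrite[OF fp(3) pq(2) pc wc] by (simp add: fp w)
  moreover have "p \<otimes> w = p \<otimes> w \<otimes> p \<oplus> p \<otimes> (w \<otimes> (\<one> \<ominus> p))" using wc pq r_one by algebra
  then have "p \<otimes> w \<otimes> p = p \<otimes> w" using fp w wc pq by simp
  ultimately show ?thesis using that w by blast
qed

lemma block_mult_corner:
  assumes "block p q a" "w \<in> carrier R" "q \<in> carrier R" "q \<otimes> w \<otimes> q = q \<otimes> w" "p \<in> carrier R"
  shows "block p q (a \<otimes> w)"
proof -
  have a: "a \<in> carrier R" "p \<otimes> a = a" "a \<otimes> q = a" using assms by (auto simp: block_def)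
  have "a \<otimes> w = a \<otimes> (q \<otimes> w)" using word_rewrite[OF a(3,1) assms(3,2)] by simp
  also have "\<dots> \<otimes> q = a \<otimes> (q \<otimes> w \<otimes> q)" using a(1) assms(2,3) by (simp add: m_assoc)
  also have "\<dots> = a \<otimes> w" unfolding assms(4) using word_rewrite[OF a(3,1) assms(3,2)] by simp
  finally have "a \<otimes> w \<otimes> q = a \<otimes> w" using word_rewrite[OF a(3,1) assms(3,2)] by simp
  then show ?thesis using a assms(2) word_rewrite[OF a(2) assms(5) a(1) assms(2)] by (simp add: block_def)
qed

lemma mult_corner_fixed:
  assumes "block p q a" "w \<in> carrier R" "q \<in> carrier R" "q \<otimes> w = q"
  shows "a \<otimes> w = a"
  using word_rewrite[of a q a w] assms by (simp add: block_def)

text \<open>Right multiplication by a unit from the corner at \<open>f\<close> makes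
  \<open>d\<close> idempotent and leaves the column of \<open>e\<close>, which holds
  \<open>a\<close> and \<open>c\<close>, unchanged.\<close>

lemma good_lower_triangular:
  assumes bl: "block e e a" "block f e c" "block f f d"
    and id: "a \<otimes> a = a" and corner: "unit_regular_corner f"
  shows "good (a \<oplus> c \<oplus> d)"
proof -
  have cl: "a \<in> carrier R" "c \<in> carrier R" "d \<in> carrier R" using bl by (auto simp: block_def)
  obtain w where w: "w \<in> stab" "e \<otimes> w = e" "f \<otimes> w \<otimes> f = f \<otimes> w" "d \<otimes> w \<otimes> d = d"
    by (rule corner_stab[OF corner ef(2,1) ef(4,5) h(4,6) bl(3)])
  have wc: "w \<in> carrier R" using w by (auto simp: stab_def)
  have aw: "a \<otimes> w = a" "c \<otimes> w = c"
    using mult_corner_fixed[OF _ wc ef(1) w(2)] bl by auto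
  show ?thesis
  proof (rule good_multI[OF _ one_stab w(1)])
    show "good (a \<oplus> c \<oplus> d \<otimes> w)"
      by (intro good_lower_triangular_idempotent bl block_mult_corner[OF bl(3) wc ef(2) w(3) ef(2)] id)
        (use w(4) cl wc in \<open>simp flip: m_assoc\<close>)
  qed (use cl wc aw in \<open>simp_all add: l_distr\<close>)
qed

text \<open>Because \<open>a b = 0\<close>, the entry \<open>b\<close> lies in
  \<open>(e - a)Rf\<close>. The column operation \<open>1 + n\<close>, with \<open>n\<close> a
  reflexive inverse of \<open>b\<close>, enlarges the pivot to the idempotent
  \<open>a' = a + b n\<close>. Now \<open>a' b = b\<close>, so \<open>1 - b\<close> clears
  \<open>b\<close> and a lower triangular element remains.\<close>

lemma good_upper_left_idempotent:
  assumes bl: "block e e a" "block e f b" "block f e c" "block f f d"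
    and id: "a \<otimes> a = a" and ab: "a \<otimes> b = \<zero>" and corner: "unit_regular_corner f"
  shows "good (a \<oplus> b \<oplus> c \<oplus> d)"
proof -
  have cl: "a \<in> carrier R" "b \<in> carrier R" "c \<in> carrier R" "d \<in> carrier R" using bl by (auto simp: block_def)
  have b: "e \<otimes> b = b" "b \<otimes> f = b" "e \<otimes> a = a" "a \<otimes> e = a" using bl by (auto simp: block_def)
  define q where "q = e \<ominus> a"
  have q: "q \<in> carrier R" "q \<otimes> q = q" "block q f b"
    unfolding q_def block_def using ef b cl id ab by (simp; fail | (intro conjI)?; algebra)+
  obtain n where n: "block f q n" "b \<otimes> (n \<otimes> b) = b" "n \<otimes> (b \<otimes> n) = n"
    by (rule obtain_quasi_inverse[OF q(3,1) ef(2) q(2) ef(4)])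
  have nc: "n \<in> carrier R" "f \<otimes> n = n" "n \<otimes> q = n" using n by (auto simp: block_def)
  have qe: "q \<otimes> e = q" "q \<otimes> a = \<zero>" unfolding q_def using ef b cl id by algebra+
  have na: "n \<otimes> a = \<zero>" using word_rewrite[OF nc(3,1) q(1) cl(1)] qe nc by simp
  have "n \<otimes> e = n" using word_rewrite[OF nc(3,1) q(1) ef(1)] qe nc by simp
  then have bn: "block f e n" using nc by (simp add: block_def)
  note o = block_orthogonal
  have zs: "b \<otimes> a = \<zero>" "b \<otimes> b = \<zero>" "a \<otimes> n = \<zero>" "c \<otimes> n = \<zero>" "n \<otimes> n = \<zero>" "d \<otimes> b = \<zero>"
    by (rule o(1) o(2), (rule bl bn)+)+
  have cn: "n \<otimes> b \<in> carrier R" "b \<otimes> n \<in> carrier R" using nc cl by auto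
  note wr = word_rewrite[OF zs(1) cl(2,1)] word_rewrite[OF zs(2) cl(2,2)] word_rewrite[OF zs(3) cl(1) nc(1)]
    word_rewrite[OF zs(4) cl(3) nc(1)] word_rewrite[OF zs(5) nc(1,1)] word_rewrite[OF zs(6) cl(4,2)]
    word_rewrite[OF na nc(1) cl(1)] word_rewrite[OF n(2) cl(2) cn(1)] word_rewrite[OF n(3) nc(1) cn(2)]
    word_rewrite[OF id cl(1,1)] word_rewrite[OF ab cl(1,2)]
  define a' where "a' = a \<oplus> b \<otimes> n"
  define c' where "c' = c \<oplus> d \<otimes> n"
  define d' where "d' = d \<ominus> c' \<otimes> b"
  have ba': "block e e a'" unfolding a'_def by (intro block_add bl block_mult[OF bl(2) bn] ef)
  have bc': "block f e c'" unfolding c'_def by (intro block_add bl block_mult[OF bl(4) bn] ef)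
  have bd': "block f f d'" unfolding d'_def by (intro block_diff bl block_mult[OF bc' bl(2)] ef)
  show ?thesis
  proof (rule good_multI)
    show "a \<oplus> b \<oplus> c \<oplus> d \<in> carrier R" using cl by simp
    show "\<one> \<in> stab" by (rule one_stab)
    show "(\<one> \<oplus> n) \<otimes> (\<one> \<ominus> b) \<in> stab" using bl bn stab_block by (intro stab_mult) auto
    show "good (a' \<oplus> c' \<oplus> d')"
      by (intro good_lower_triangular ba' bc' bd' corner; unfold a'_def; use cl nc(1) zs id na n(2,3) wr in algebra)
    show "\<one> \<otimes> (a \<oplus> b \<oplus> c \<oplus> d) \<otimes> ((\<one> \<oplus> n) \<otimes> (\<one> \<ominus> b)) = a' \<oplus> c' \<oplus> d'"
      unfolding a'_def c'_def d'_def using cl nc(1) zs id na ab n(2,3) wr r_one by algebra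
  qed
qed

text \<open>The unit \<open>w\<close> turns \<open>a\<close> into an idempotent \<open>a'\<close>
  without touching the column of \<open>f\<close>, and \<open>1 - a' b\<close> then replaces
  \<open>b\<close> by a \<open>b'\<close> with \<open>a' b' = 0\<close>.\<close>

lemma good_blocks:
  assumes bl: "block e e a" "block e f b" "block f e c" "block f f d"
    and corner: "unit_regular_corner e" "unit_regular_corner f"
  shows "good (a \<oplus> b \<oplus> c \<oplus> d)"
proof -
  have cl: "a \<in> carrier R" "b \<in> carrier R" "c \<in> carrier R" "d \<in> carrier R" using bl by (auto simp: block_def)
  obtain w where w: "w \<in> stab" "f \<otimes> w = f" "e \<otimes> w \<otimes> e = e \<otimes> w" "a \<otimes> w \<otimes> a = a"
    by (rule corner_stab[OF corner(1) ef(1,2) ef(3,6) h(3,5) bl(1)])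
  have wc: "w \<in> carrier R" using w by (auto simp: stab_def)
  define a' where "a' = a \<otimes> w"
  have bw: "b \<otimes> w = b" "d \<otimes> w = d"
    using mult_corner_fixed[OF _ wc ef(2) w(2)] bl by auto
  have ba': "block e e a'" unfolding a'_def by (rule block_mult_corner[OF bl(1) wc ef(1) w(3) ef(1)])
  have bc': "block f e (c \<otimes> w)" by (rule block_mult_corner[OF bl(3) wc ef(1) w(3) ef(2)])
  have a': "a' \<in> carrier R" "a' \<otimes> a' = a'" 
    unfolding a'_def using w(4) cl wc by (simp_all flip: m_assoc)
  have bab: "block e f (a' \<otimes> b)" by (intro block_mult[OF ba' bl(2)] ef)
  have z: "b \<otimes> (a' \<otimes> b) = \<zero>" "d \<otimes> (a' \<otimes> b) = \<zero>"
    by (rule block_orthogonal(2), (rule bl bab)+)+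
  define b' where "b' = b \<ominus> a' \<otimes> b"
  define d' where "d' = d \<ominus> c \<otimes> w \<otimes> (a' \<otimes> b)"
  have bb': "block e f b'" unfolding b'_def by (intro block_diff bl bab ef)
  have bd': "block f f d'" unfolding d'_def by (intro block_diff bl block_mult[OF bc' bab] ef)
  show ?thesis
  proof (rule good_multI[OF _ one_stab])
    show "w \<otimes> (\<one> \<ominus> a' \<otimes> b) \<in> stab" by (intro stab_mult w stab_block disjI1 bab)
    show "good (a' \<oplus> b' \<oplus> c \<otimes> w \<oplus> d')"
      by (intro good_upper_left_idempotent ba' bb' bc' bd' a' corner; unfold b'_def;
          use a' cl word_rewrite[OF a'(2,1,1)] in algebra)
    have "\<one> \<otimes> (a \<oplus> b \<oplus> c \<oplus> d) \<otimes> (w \<otimes> (\<one> \<ominus> a' \<otimes> b)) 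
      = (a \<otimes> w \<oplus> b \<otimes> w \<oplus> c \<otimes> w \<oplus> d \<otimes> w) \<otimes> (\<one> \<ominus> a' \<otimes> b)"
      using cl wc a' by algebra
    also have "\<dots> = (a' \<oplus> b \<oplus> c \<otimes> w \<oplus> d) \<otimes> (\<one> \<ominus> a' \<otimes> b)" by (simp add: bw a'_def)
    also have "\<dots> = a' \<oplus> b' \<oplus> c \<otimes> w \<oplus> d'"
      unfolding b'_def d'_def using cl wc a' z word_rewrite[OF a'(2,1,1)] r_one by algebra
    finally show "\<one> \<otimes> (a \<oplus> b \<oplus> c \<oplus> d) \<otimes> (w \<otimes> (\<one> \<ominus> a' \<otimes> b)) = a' \<oplus> b' \<oplus> c \<otimes> w \<oplus> d'" .
  qed (use cl in simp)
qed

lemma unit_regular_corner_sum: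
  assumes corner: "unit_regular_corner e" "unit_regular_corner f"
  shows "unit_regular_corner (e \<oplus> f)"
  unfolding unit_regular_corner_def h_def[symmetric]
proof (intro ballI impI)
  fix \<alpha> assume \<alpha>: "\<alpha> \<in> carrier R" "(e \<oplus> f) \<otimes> \<alpha> = \<alpha>" "\<alpha> \<otimes> (e \<oplus> f) = \<alpha>"
  have bl: "block p q (p \<otimes> \<alpha> \<otimes> q)" if "p \<in> carrier R" "p \<otimes> p = p" "q \<in> carrier R" "q \<otimes> q = q" for p q
    using that \<alpha>(1) word_rewrite[OF that(2,1,1), of "\<alpha> \<otimes> q"] by (simp add: block_def m_assoc)
  have "good (e \<otimes> \<alpha> \<otimes> e \<oplus> e \<otimes> \<alpha> \<otimes> f \<oplus> f \<otimes> \<alpha> \<otimes> e \<oplus> f \<otimes> \<alpha> \<otimes> f)"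
    by (intro good_blocks bl ef corner)
  also have "e \<otimes> \<alpha> \<otimes> e \<oplus> e \<otimes> \<alpha> \<otimes> f \<oplus> f \<otimes> \<alpha> \<otimes> e \<oplus> f \<otimes> \<alpha> \<otimes> f = (e \<oplus> f) \<otimes> \<alpha> \<otimes> (e \<oplus> f)"
    using ef \<alpha>(1) by algebra
  also have "\<dots> = \<alpha>" using \<alpha> by simp
  finally show "\<exists>w\<in>Units R. w \<otimes> h = h \<and> h \<otimes> w = h \<and> \<alpha> \<otimes> w \<otimes> \<alpha> = \<alpha>"
    by (auto simp: good_def stab_def)
qed

end

section \<open>Truncated extensions\<close>

lemma (in monoid) commuting_factor_Units:
  assumes "a \<in> carrier G" "b \<in> carrier G" "a \<otimes> b \<in> Units G" "b \<otimes> a = a \<otimes> b"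
  shows "a \<in> Units G"
proof -
  define v where "v = inv (a \<otimes> b)"
  have v: "v \<in> carrier G" "a \<otimes> (b \<otimes> v) = \<one>" "(v \<otimes> b) \<otimes> a = \<one>"
    using assms by (simp_all add: v_def flip: m_assoc) (simp add: m_assoc)
  have "v \<otimes> b = (v \<otimes> b) \<otimes> (a \<otimes> (b \<otimes> v))" using v assms by simp
  also have "\<dots> = ((v \<otimes> b) \<otimes> a) \<otimes> (b \<otimes> v)" using v(1) assms(1,2) by (simp add: m_assoc)
  also have "\<dots> = b \<otimes> v" unfolding v(3) using v(1) assms(2) by simp
  finally have "(b \<otimes> v) \<otimes> a = \<one>" using v by simp
  then show ?thesis using v assms unfolding Units_def by blast
qed

text \<open>The axioms express \<open>T \<cong> S[x]/(x\<^sup>n)\<close>, with \<open>\<iota>\<close> the embedding of the coefficients.\<close>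

locale truncated_extension = ring T + S: ring S for T (structure) and S +
  fixes \<iota> x and n :: nat
  assumes hom: "\<iota> \<in> ring_hom S T"
    and x_closed [simp, intro]: "x \<in> carrier T"
    and x_central: "\<And>t. t \<in> carrier T \<Longrightarrow> t \<otimes> x = x \<otimes> t"
    and x_nilpotent: "x [^] n = \<zero>"
    and x_annihilator: "\<And>t i. t \<in> carrier T \<Longrightarrow> i \<le> n \<Longrightarrow> x [^] i \<otimes> t = \<zero> \<Longrightarrow>
      \<exists>s\<in>carrier T. t = x [^] (n - i) \<otimes> s"
    and decomposition: "\<And>t. t \<in> carrier T \<Longrightarrow> \<exists>r\<in>carrier S. \<exists>s\<in>carrier T. t = \<iota> r \<oplus> x \<otimes> s"
    and residue_inj: "\<And>r s. r \<in> carrier S \<Longrightarrow> s \<in> carrier T \<Longrightarrow> \<iota> r = x \<otimes> s \<Longrightarrow> r = \<zero>\<^bsub>S\<^esub>"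
begin

sublocale hom: ring_hom_ring S T \<iota>
  by unfold_locales (rule hom)

lemma x_pow_central: "t \<in> carrier T \<Longrightarrow> t \<otimes> x [^] (i::nat) = x [^] i \<otimes> t"
proof (induction i)
  case (Suc i)
  then have "t \<otimes> (x [^] i \<otimes> x) = x [^] i \<otimes> (t \<otimes> x)" by (simp flip: m_assoc)
  also have "\<dots> = x [^] i \<otimes> x \<otimes> t" using Suc.prems by (simp only: x_central[OF Suc.prems] m_assoc x_closed nat_pow_closed)
  finally show ?case by simp
qed simp

lemma x_pow_left_commute:
  "t \<in> carrier T \<Longrightarrow> s \<in> carrier T \<Longrightarrow> t \<otimes> (x [^] (i::nat) \<otimes> s) = x [^] i \<otimes> (t \<otimes> s)"
  by (simp add: x_pow_central flip: m_assoc)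

lemma x_left_commute:
  "t \<in> carrier T \<Longrightarrow> s \<in> carrier T \<Longrightarrow> t \<otimes> (x \<otimes> s) = x \<otimes> (t \<otimes> s)"
  by (simp add: x_central flip: m_assoc)

lemma x_pow_add:
  "s \<in> carrier T \<Longrightarrow> x [^] (i + j :: nat) \<otimes> s = x [^] i \<otimes> (x [^] j \<otimes> s)"
  by (simp add: m_assoc flip: nat_pow_mult)

text \<open>Downward induction on \<open>i\<close>, beginning with \<open>x^n = 0\<close>. For
  \<open>y = x^i s\<close> the product \<open>(1 + y)(1 - y) = 1 - y^2\<close> is a unit by
  induction, since \<open>y^2\<close> is divisible by \<open>x^(2i)\<close> and
  \<open>2i \<ge> i + 1\<close>.\<close>

lemma one_plus_x_pow_Units:
  assumes "s \<in> carrier T" "0 < i" "i \<le> n"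
  shows "\<one> \<oplus> x [^] i \<otimes> s \<in> Units T"
  using assms(3,2,1)
proof (induction arbitrary: s rule: inc_induct)
  case base
  then show ?case by (simp add: x_nilpotent)
next
  case (step i)
  define y where "y = x [^] i \<otimes> s"
  have y: "y \<in> carrier T" using step by (simp add: y_def)
  have "y \<otimes> y = x [^] i \<otimes> (x [^] i \<otimes> (s \<otimes> s))"
    unfolding y_def using step.prems by (simp add: m_assoc x_pow_left_commute[of s])
  also have "\<dots> = x [^] (Suc i + (i - 1)) \<otimes> (s \<otimes> s)"
    using step.prems by (simp flip: x_pow_add)
  finally have "y \<otimes> y = x [^] Suc i \<otimes> (x [^] (i - 1) \<otimes> (s \<otimes> s))"
    using step.prems x_pow_add[of "s \<otimes> s" "Suc i" "i - 1"] by simp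
  then have "\<one> \<ominus> y \<otimes> y = \<one> \<oplus> x [^] Suc i \<otimes> (\<ominus> (x [^] (i - 1) \<otimes> (s \<otimes> s)))"
    using step.prems by (subst r_minus) (simp_all add: minus_eq del: nat_pow_Suc)
  then have u: "\<one> \<ominus> y \<otimes> y \<in> Units T"
    using step by simp
  have eq: "(\<one> \<oplus> y) \<otimes> (\<one> \<ominus> y) = \<one> \<ominus> y \<otimes> y" "(\<one> \<ominus> y) \<otimes> (\<one> \<oplus> y) = \<one> \<ominus> y \<otimes> y"
    using y r_one by algebra+
  show ?case unfolding y_def[symmetric]
    by (rule commuting_factor_Units[of _ "\<one> \<ominus> y"]) (use y u eq in simp_all)
qed

lemma one_plus_x_Units:
  assumes "s \<in> carrier T"
  shows "\<one> \<oplus> x \<otimes> s \<in> Units T"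
proof (cases "n = 0")
  \<comment> \<open>For \<open>n = 0\<close> the axiom on nilpotency reads \<open>1 = 0\<close>, so
    \<open>T\<close> is the zero ring.\<close>
  case True
  then have "\<one> = \<zero>" using x_nilpotent by simp
  then have "t = \<zero>" if "t \<in> carrier T" for t using that by (metis l_null l_one)
  then show ?thesis using assms Units_one_closed by (metis a_closed m_closed one_closed x_closed)
next
  case False
  then show ?thesis using one_plus_x_pow_Units[of s 1] assms by simp
qed

text \<open>One half of \<open>left_morphic_pair\<close>, restricted to the left ideal
  \<open>Tf\<close> of an idempotent. For \<open>f = 1\<close>, this half and the one with
  \<open>D\<close> and \<open>D'\<close> exchanged form the pair.\<close>

definition "diag_annihilator f D D' \<longleftrightarrow>
  (\<forall>t\<in>carrier T. t \<otimes> f = t \<longrightarrow> (t \<otimes> D = \<zero> \<longleftrightarrow> (\<exists>s\<in>carrier T. t = s \<otimes> D')))"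

text \<open>Split \<open>t\<close> into \<open>t f\<close> and \<open>t e\<close>. The first part is
  governed by the hypothesis on \<open>D\<close> and \<open>D'\<close>. On the second, annihilation
  by \<open>x^i\<close> means divisibility by \<open>x^(n - i)\<close>, which is why the exponents
  of the two pivots add up to \<open>n\<close>.\<close>

lemma diag_annihilator_add:
  assumes f: "f \<in> carrier T" "e \<in> carrier T" "f \<otimes> f = f" "e \<otimes> e = e" "f \<otimes> e = \<zero>" "e \<otimes> f = \<zero>"
    and D: "D \<in> carrier T" "f \<otimes> D = D" "D \<otimes> f = D" "D' \<in> carrier T" "f \<otimes> D' = D'" "D' \<otimes> f = D'"
    and diag: "diag_annihilator f D D'" and ij: "i + j = n"
  shows "diag_annihilator (f \<oplus> e) (D \<oplus> x [^] i \<otimes> e) (D' \<oplus> x [^] j \<otimes> e)"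
  unfolding diag_annihilator_def
proof (intro ballI impI iffI)
  fix t assume t: "t \<in> carrier T" "t \<otimes> (f \<oplus> e) = t" and z: "t \<otimes> (D \<oplus> x [^] i \<otimes> e) = \<zero>"
  have xe: "x [^] i \<otimes> e \<in> carrier T" using f(2) by simp
  note wr = word_rewrite[OF f(6) f(2,1)] word_rewrite[OF f(5) f(1,2)] word_rewrite[OF f(4) f(2,2)]
  have "D \<otimes> e = D \<otimes> f \<otimes> e" using D by simp
  then have De: "D \<otimes> e = \<zero>" using D(1) f by (simp add: m_assoc)
  have "t \<otimes> (D \<oplus> x [^] i \<otimes> e) \<otimes> f = t \<otimes> D"
    using t(1) D f xe by (simp add: l_distr r_distr m_assoc)
  then have tD: "t \<otimes> D = \<zero>" using z f by simp
  then have "t \<otimes> f \<otimes> D = \<zero>" "t \<otimes> f \<otimes> f = t \<otimes> f" using D f t(1) by (simp_all add: m_assoc)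
  then obtain s where s: "s \<in> carrier T" "t \<otimes> f = s \<otimes> D'"
    using diag t(1) f(1) unfolding diag_annihilator_def by (meson m_closed)
  have "t \<otimes> (x [^] i \<otimes> e) = \<zero>" using z tD t(1) D(1) xe by (simp add: r_distr)
  then have "x [^] i \<otimes> (t \<otimes> e) = \<zero>" using t(1) f(2) by (simp add: x_pow_left_commute[of t])
  then obtain s' where s': "s' \<in> carrier T" "t \<otimes> e = x [^] j \<otimes> s'"
    using x_annihilator[of "t \<otimes> e" i] t(1) f(2) ij by auto
  have "t \<otimes> e = t \<otimes> e \<otimes> e" using t(1) f by (simp add: m_assoc)
  also have "\<dots> = x [^] j \<otimes> (s' \<otimes> e)" unfolding s' using f s'(1) by (simp add: m_assoc)
  finally have te: "t \<otimes> e = x [^] j \<otimes> (s' \<otimes> e)" .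
  have eD: "e \<otimes> D' = \<zero>" using D word_rewrite[OF f(6) f(2,1), of D'] by simp
  have "(s \<otimes> f \<oplus> s' \<otimes> e) \<otimes> (D' \<oplus> x [^] j \<otimes> e) = s \<otimes> D' \<oplus> x [^] j \<otimes> (s' \<otimes> e)"
    using s(1) s'(1) f D(4,5) eD by (simp add: l_distr r_distr m_assoc x_pow_left_commute[of f] x_pow_left_commute[of e] x_pow_left_commute[of s'])
  also have "\<dots> = t \<otimes> f \<oplus> t \<otimes> e" unfolding s te ..
  also have "\<dots> = t" using t f by (simp flip: r_distr)
  finally show "\<exists>s\<in>carrier T. t = s \<otimes> (D' \<oplus> x [^] j \<otimes> e)"
    using s(1) s'(1) f by (intro bexI[of _ "s \<otimes> f \<oplus> s' \<otimes> e"]) auto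
next
  fix t assume t: "t \<in> carrier T" and "\<exists>s\<in>carrier T. t = s \<otimes> (D' \<oplus> x [^] j \<otimes> e)"
  then obtain s where s: "s \<in> carrier T" "t = s \<otimes> (D' \<oplus> x [^] j \<otimes> e)" by auto
  have "\<exists>s\<in>carrier T. D' = s \<otimes> D'" using D by (intro bexI[of _ \<one>]) auto
  then have DD: "D' \<otimes> D = \<zero>" using diag D unfolding diag_annihilator_def by blast
  have "D' \<otimes> e = D' \<otimes> f \<otimes> e" "e \<otimes> D = e \<otimes> f \<otimes> D" using D f(1,2) by (simp_all add: m_assoc)
  then have De: "D' \<otimes> e = \<zero>" "e \<otimes> D = \<zero>" using D(1,4) f by (simp_all add: m_assoc)
  have "(D' \<oplus> x [^] j \<otimes> e) \<otimes> (D \<oplus> x [^] i \<otimes> e) = x [^] (j + i) \<otimes> e"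
    using D(1,4) f De DD by (simp add: l_distr r_distr m_assoc x_pow_left_commute[of D'] x_pow_left_commute[of e] x_pow_add)
  also have "\<dots> = \<zero>" using ij f x_nilpotent by (simp add: add.commute)
  finally show "t \<otimes> (D \<oplus> x [^] i \<otimes> e) = \<zero>"
    unfolding s using s(1) D(1,4) f by (simp add: m_assoc)
qed

text \<open>
  One elimination step: \<open>e\<close> serves as pivot for \<open>e + x\<gamma>\<close>. The factor \<open>q\<close> makes the
  row of \<open>e\<close> equal to \<open>e\<close>, and then the left factor clears the column of \<open>e\<close>.
\<close>

lemma clear_pivot:
  assumes f: "f \<in> carrier T" "e \<in> carrier T" "f \<otimes> f = f" "e \<otimes> e = e" "f \<otimes> e = \<zero>" "e \<otimes> f = \<zero>"
    and \<gamma>: "\<gamma> \<in> carrier T" "f \<otimes> \<gamma> = \<zero>" "\<gamma> \<otimes> f = \<zero>"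
  shows "\<exists>P\<in>Units T. \<exists>Q\<in>Units T. \<exists>\<gamma>'\<in>carrier T. P \<otimes> f = f \<and> f \<otimes> Q = f \<and>
    (f \<oplus> e) \<otimes> \<gamma>' = \<zero> \<and> \<gamma>' \<otimes> (f \<oplus> e) = \<zero> \<and>
    P \<otimes> (e \<oplus> x \<otimes> \<gamma>) \<otimes> Q = e \<oplus> x \<otimes> \<gamma>'"
proof -
  define d where "d = x \<otimes> \<gamma>"
  have d: "d \<in> carrier T" "f \<otimes> d = \<zero>" "d \<otimes> f = \<zero>"
    unfolding d_def using \<gamma> f(1,2) by (simp_all add: x_left_commute[of f] m_assoc)
  define p where "p = \<one> \<oplus> e \<otimes> d"
  have "p = \<one> \<oplus> x \<otimes> (e \<otimes> \<gamma>)"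
    unfolding p_def d_def using f(2) \<gamma>(1) by (simp add: x_left_commute[of e])
  then have p: "p \<in> Units T" using f \<gamma> one_plus_x_Units by simp
  define q where "q = inv p"
  have q: "q \<in> Units T" "q \<in> carrier T" "p \<otimes> q = \<one>" "q \<otimes> p = \<one>" using p by (simp_all add: q_def)
  have "f \<otimes> p = f" "p \<otimes> f = f"
    unfolding p_def using f d word_rewrite[OF f(6) f(2,1) d(1)] word_rewrite[OF f(5) f(1,2) d(1)] by (simp_all add: l_distr r_distr m_assoc)
  then have fq: "f \<otimes> q = f" "q \<otimes> f = f"
    using word_rewrite[of f p f q] word_rewrite[OF q(4) q(2), of f] q Units_closed[OF p] f(1) by simp_all
  have edq: "e \<otimes> (d \<otimes> q) = \<one> \<ominus> q"
  proof -
    have "e \<otimes> (d \<otimes> q) = p \<otimes> q \<ominus> q" unfolding p_def using f(2) d(1) q(2) by algebra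
    then show ?thesis using q by simp
  qed
  have eq: "e \<otimes> q = q \<ominus> \<one> \<oplus> e"
  proof -
    have "e \<otimes> (\<one> \<ominus> q) = e \<otimes> (e \<otimes> (d \<otimes> q))" unfolding edq ..
    also have "\<dots> = e \<otimes> (d \<otimes> q)" using d(1) q(2) by (intro word_rewrite f) simp
    also note edq
    finally have "e \<otimes> (\<one> \<ominus> q) = \<one> \<ominus> q" .
    moreover have "e \<otimes> q = e \<ominus> e \<otimes> (\<one> \<ominus> q)" using f(2) q(2) r_one by algebra
    ultimately show ?thesis using f(2) q(2) by (simp, algebra)
  qed
  have dq: "d \<otimes> q \<in> carrier T" using d q by simp
  note wr = word_rewrite[OF edq f(2) dq] word_rewrite[OF eq f(2) q(2)] word_rewrite[OF f(4) f(2,2)]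
  \<comment> \<open>At this point \<open>(e + d) q = e + \<delta>\<close> with
    \<open>e \<delta> = 0\<close>. Hence \<open>P = 1 - \<delta> e\<close> turns it into
    \<open>e + \<delta> (1 - e)\<close>, and the last term is \<open>x \<gamma>'\<close>.\<close>
  define \<delta> where "\<delta> = (\<one> \<ominus> e) \<otimes> d \<otimes> q"
  define P where "P = \<one> \<ominus> \<delta> \<otimes> e"
  define \<gamma>' where "\<gamma>' = (\<one> \<ominus> e) \<otimes> \<gamma> \<otimes> q \<otimes> (\<one> \<ominus> e)"
  have "e \<otimes> \<delta> = (e \<ominus> e \<otimes> e) \<otimes> d \<otimes> q"
    unfolding \<delta>_def using f(2) d(1) q(2) r_one by algebra
  then have \<delta>: "\<delta> \<in> carrier T" "e \<otimes> \<delta> = \<zero>"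
    using f(2,4) d(1) q(2) by (simp_all add: \<delta>_def minus_eq r_neg)
  have "P \<in> Units T"
    unfolding P_def using f(2) \<delta>(1) word_rewrite[OF \<delta>(2) f(2) \<delta>(1) f(2)]
    by (intro one_minus_square_zero_Units) (simp_all add: m_assoc)
  moreover have "P \<otimes> f = f" unfolding P_def using f \<delta> by algebra
  moreover have g': "\<gamma>' \<in> carrier T" unfolding \<gamma>'_def using f \<gamma> q by simp
  moreover have "(f \<oplus> e) \<otimes> \<gamma>' = \<zero>"
    unfolding \<gamma>'_def using f(1,2,4,5,6) \<gamma> q(2) word_rewrite[OF f(5) f(1,2)] word_rewrite[OF \<gamma>(2) f(1) \<gamma>(1)] 
      word_rewrite[OF f(4) f(2,2)] by algebra
  moreover have "\<gamma>' \<otimes> (f \<oplus> e) = \<zero>"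
    unfolding \<gamma>'_def using f(1,2,4,5,6) \<gamma> q(2) fq word_rewrite[OF \<gamma>(2) f(1) \<gamma>(1)] r_one by algebra
  moreover have "P \<otimes> (e \<oplus> x \<otimes> \<gamma>) \<otimes> q = e \<oplus> x \<otimes> \<gamma>'"
  proof -
    have "P \<otimes> (e \<oplus> d) \<otimes> q = e \<oplus> (\<one> \<ominus> e) \<otimes> d \<otimes> q \<otimes> (\<one> \<ominus> e)"
      unfolding P_def \<delta>_def using f(2,4) d(1) q(2) edq eq wr r_one by algebra
    also have "(\<one> \<ominus> e) \<otimes> d \<otimes> q \<otimes> (\<one> \<ominus> e) = x \<otimes> \<gamma>'"
      unfolding \<gamma>'_def d_def using f(2) \<gamma>(1) q(2) by (simp add: m_assoc x_left_commute[of "\<one> \<ominus> e"])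
    finally show ?thesis unfolding d_def .
  qed
  ultimately show ?thesis using q(1) fq(1) by blast
qed

text \<open>
  After \<open>k\<close> elimination steps, \<open>D = \<Sum> e\<^sub>i x\<^sup>i\<close> and \<open>D' = \<Sum> e\<^sub>i x\<^sup>n\<^sup>-\<^sup>i\<close> over \<open>i < k\<close>,
  the idempotents \<open>e\<^sub>i\<close> sum to \<open>\<iota> \<phi>\<close>, and \<open>\<beta>\<close> lies in the complementary corner.
\<close>

definition "partially_diagonal k \<alpha> \<longleftrightarrow>
  (\<exists>P\<in>Units T. \<exists>Q\<in>Units T. \<exists>\<phi>\<in>carrier S. \<exists>D\<in>carrier T. \<exists>D'\<in>carrier T. \<exists>\<beta>\<in>carrier T.
    \<phi> \<otimes>\<^bsub>S\<^esub> \<phi> = \<phi> \<and> \<iota> \<phi> \<otimes> D = D \<and> D \<otimes> \<iota> \<phi> = D \<and> \<iota> \<phi> \<otimes> D' = D' \<and> D' \<otimes> \<iota> \<phi> = D' \<and>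
    diag_annihilator (\<iota> \<phi>) D D' \<and> diag_annihilator (\<iota> \<phi>) D' D \<and>
    \<iota> \<phi> \<otimes> \<beta> = \<zero> \<and> \<beta> \<otimes> \<iota> \<phi> = \<zero> \<and> P \<otimes> \<alpha> \<otimes> Q = D \<oplus> x [^] (k::nat) \<otimes> \<beta>)"

lemma partially_diagonal_0:
  assumes "\<alpha> \<in> carrier T"
  shows "partially_diagonal 0 \<alpha>"
  unfolding partially_diagonal_def
  by (intro bexI[of _ \<one>] bexI[of _ "\<zero>\<^bsub>S\<^esub>"] bexI[of _ \<zero>] bexI[of _ \<alpha>] conjI)
    (use assms in \<open>auto simp: diag_annihilator_def\<close>)

text \<open>The constant term of \<open>\<beta>\<close>, compressed to the corner of
  \<open>\<psi> = 1 - \<phi>\<close>, becomes an idempotent \<open>\<epsilon> = \<rho> w\<close>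
  after multiplication by a unit. It supplies the new pivot \<open>x^k e\<close>, paired with
  \<open>x^(n - k) e\<close>. The new units \<open>P'\<close>, \<open>\<iota> w\<close> and
  \<open>Q'\<close> fix \<open>f\<close> on the side facing \<open>D\<close>, so \<open>D\<close>
  survives.\<close>

lemma partially_diagonal_Suc:
  assumes ur: "unit_regular_ring S" and k: "k < n" and \<alpha>: "\<alpha> \<in> carrier T" "partially_diagonal k \<alpha>"
  shows "partially_diagonal (Suc k) \<alpha>"
proof -
  obtain P Q \<phi> D D' \<beta> where PQ: "P \<in> Units T" "Q \<in> Units T"
    and \<phi>: "\<phi> \<in> carrier S" "\<phi> \<otimes>\<^bsub>S\<^esub> \<phi> = \<phi>"
    and D: "D \<in> carrier T" "\<iota> \<phi> \<otimes> D = D" "D \<otimes> \<iota> \<phi> = D" "D' \<in> carrier T" "\<iota> \<phi> \<otimes> D' = D'" "D' \<otimes> \<iota> \<phi> = D'"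
    and diag: "diag_annihilator (\<iota> \<phi>) D D'" "diag_annihilator (\<iota> \<phi>) D' D"
    and \<beta>: "\<beta> \<in> carrier T" "\<iota> \<phi> \<otimes> \<beta> = \<zero>" "\<beta> \<otimes> \<iota> \<phi> = \<zero>"
    and eq: "P \<otimes> \<alpha> \<otimes> Q = D \<oplus> x [^] k \<otimes> \<beta>"
    using \<alpha>(2) unfolding partially_diagonal_def by blast
  obtain r s where rs: "r \<in> carrier S" "s \<in> carrier T" "\<beta> = \<iota> r \<oplus> x \<otimes> s"
    using decomposition[OF \<beta>(1)] by blast
  define \<psi> where "\<psi> = \<one>\<^bsub>S\<^esub> \<ominus>\<^bsub>S\<^esub> \<phi>"
  have \<psi>: "\<psi> \<in> carrier S" "\<psi> \<otimes>\<^bsub>S\<^esub> \<psi> = \<psi>" "\<psi> \<otimes>\<^bsub>S\<^esub> \<phi> = \<zero>\<^bsub>S\<^esub>" "\<phi> \<otimes>\<^bsub>S\<^esub> \<psi> = \<zero>\<^bsub>S\<^esub>"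
    "\<one>\<^bsub>S\<^esub> \<ominus>\<^bsub>S\<^esub> \<psi> = \<phi>"
    unfolding \<psi>_def using \<phi> S.r_one by (simp; fail | algebra)+
  define f where "f = \<iota> \<phi>"
  define g where "g = \<iota> \<psi>"
  have "\<psi> \<oplus>\<^bsub>S\<^esub> \<phi> = \<one>\<^bsub>S\<^esub>" unfolding \<psi>_def using \<phi> by algebra
  then have "\<iota> (\<psi> \<oplus>\<^bsub>S\<^esub> \<phi>) = \<one>" by simp
  then have gf1: "g \<oplus> f = \<one>" using \<psi> \<phi> by (simp add: f_def g_def)
  have f: "f \<in> carrier T" "f \<otimes> f = f" using \<phi> by (simp_all add: f_def flip: hom.hom_mult)
  have g: "g \<in> carrier T" "g \<otimes> f = \<zero>" "f \<otimes> g = \<zero>"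
    using \<psi> \<phi> by (simp_all add: f_def g_def flip: hom.hom_mult)
  note D' = D[folded f_def] and \<beta>' = \<beta>[folded f_def]
  have "g \<otimes> \<beta> = \<beta>" "\<beta> \<otimes> g = \<beta>"
    using arg_cong[OF gf1, of "\<lambda>z. z \<otimes> \<beta>"] arg_cong[OF gf1, of "\<lambda>z. \<beta> \<otimes> z"] \<beta>' f g
    by (simp_all add: l_distr r_distr)
  then have "\<beta> = g \<otimes> (\<iota> r \<oplus> x \<otimes> s) \<otimes> g" using rs by simp
  \<comment> \<open>Since \<open>\<beta> = g \<beta> g\<close>, the constant term \<open>r\<close>
    may be replaced by \<open>\<psi> r \<psi>\<close>; this makes the pivot orthogonal to
    \<open>\<phi>\<close>.\<close>
  define \<rho> where "\<rho> = \<psi> \<otimes>\<^bsub>S\<^esub> r \<otimes>\<^bsub>S\<^esub> \<psi>"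
  have \<rho>: "\<rho> \<in> carrier S" "\<psi> \<otimes>\<^bsub>S\<^esub> \<rho> = \<rho>" "\<rho> \<otimes>\<^bsub>S\<^esub> \<psi> = \<rho>"
    using \<psi> rs S.word_rewrite[OF \<psi>(2,1,1)] by (simp_all add: \<rho>_def S.m_assoc)
  have \<beta>_eq: "\<beta> = \<iota> \<rho> \<oplus> x \<otimes> (g \<otimes> s \<otimes> g)"
  proof -
    have "\<beta> = g \<otimes> (\<iota> r \<oplus> x \<otimes> s) \<otimes> g" by fact
    also have "\<dots> = \<iota> \<rho> \<oplus> x \<otimes> (g \<otimes> s \<otimes> g)"
      using rs \<psi>(1) by (simp add: \<rho>_def g_def l_distr r_distr m_assoc x_left_commute[of "\<iota> \<psi>"])
    finally show ?thesis .
  qed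
  obtain w where w: "w \<in> Units S" "w \<otimes>\<^bsub>S\<^esub> \<phi> = \<phi>" "\<phi> \<otimes>\<^bsub>S\<^esub> w = \<phi>" "\<rho> \<otimes>\<^bsub>S\<^esub> w \<otimes>\<^bsub>S\<^esub> \<rho> = \<rho>"
    using S.unit_regular_cornerI[OF ur \<psi>(1,2)] \<rho> unfolding S.unit_regular_corner_def \<psi>(5) by blast
  have wc: "w \<in> carrier S" "inv\<^bsub>S\<^esub> w \<in> carrier S" using w(1) by auto
  have W: "\<iota> w \<in> Units T"
    by (rule UnitsI[of _ "\<iota> (inv\<^bsub>S\<^esub> w)"]) (use w(1) wc in \<open>simp_all flip: hom.hom_mult\<close>)
  define \<epsilon> where "\<epsilon> = \<rho> \<otimes>\<^bsub>S\<^esub> w"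
  have \<epsilon>: "\<epsilon> \<in> carrier S" using \<rho> wc by (simp add: \<epsilon>_def)
  have "\<epsilon> \<otimes>\<^bsub>S\<^esub> \<epsilon> = \<rho> \<otimes>\<^bsub>S\<^esub> w \<otimes>\<^bsub>S\<^esub> \<rho> \<otimes>\<^bsub>S\<^esub> w" using \<rho> wc by (simp add: \<epsilon>_def S.m_assoc)
  then have \<epsilon>2: "\<epsilon> \<otimes>\<^bsub>S\<^esub> \<epsilon> = \<epsilon>" using w by (simp add: \<epsilon>_def)
  have "\<phi> \<otimes>\<^bsub>S\<^esub> \<rho> = \<zero>\<^bsub>S\<^esub>" using S.word_rewrite[OF \<psi>(4) \<phi>(1) \<psi>(1) \<rho>(1)] \<rho> by simp
  then have \<phi>\<epsilon>: "\<phi> \<otimes>\<^bsub>S\<^esub> \<epsilon> = \<zero>\<^bsub>S\<^esub>" using \<phi> \<rho> wc by (simp add: \<epsilon>_def flip: S.m_assoc)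
  have "\<rho> \<otimes>\<^bsub>S\<^esub> \<phi> = \<zero>\<^bsub>S\<^esub>" using S.word_rewrite[OF \<rho>(3,1) \<psi>(1) \<phi>(1)] \<psi> \<rho> by simp
  then have \<epsilon>\<phi>: "\<epsilon> \<otimes>\<^bsub>S\<^esub> \<phi> = \<zero>\<^bsub>S\<^esub>" using \<phi> \<rho> wc w by (simp add: \<epsilon>_def S.m_assoc)
  define e where "e = \<iota> \<epsilon>"
  have e: "e \<in> carrier T" "e \<otimes> e = e" "f \<otimes> e = \<zero>" "e \<otimes> f = \<zero>"
    using \<epsilon> \<epsilon>2 \<phi>\<epsilon> \<epsilon>\<phi> \<phi> by (simp_all add: e_def f_def flip: hom.hom_mult)
  define \<gamma> where "\<gamma> = g \<otimes> s \<otimes> g \<otimes> \<iota> w"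
  have Wf: "\<iota> w \<otimes> f = f" "f \<otimes> \<iota> w = f" using w wc \<phi> by (simp_all add: f_def flip: hom.hom_mult)
  have \<gamma>: "\<gamma> \<in> carrier T" "f \<otimes> \<gamma> = \<zero>" "\<gamma> \<otimes> f = \<zero>"
    using g rs(2) wc f Wf word_rewrite[OF g(3) f(1) g(1)] by (simp_all add: \<gamma>_def m_assoc)
  have \<beta>W: "\<beta> \<otimes> \<iota> w = e \<oplus> x \<otimes> \<gamma>"
    unfolding \<beta>_eq \<gamma>_def e_def \<epsilon>_def using \<rho> wc g rs(2) by (simp add: l_distr m_assoc)
  obtain P' Q' \<gamma>' where PQ': "P' \<in> Units T" "Q' \<in> Units T" and \<gamma>': "\<gamma>' \<in> carrier T"
    and f': "P' \<otimes> f = f" "f \<otimes> Q' = f" "(f \<oplus> e) \<otimes> \<gamma>' = \<zero>" "\<gamma>' \<otimes> (f \<oplus> e) = \<zero>"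
    and piv: "P' \<otimes> (e \<oplus> x \<otimes> \<gamma>) \<otimes> Q' = e \<oplus> x \<otimes> \<gamma>'"
    using clear_pivot[OF f(1) e(1) f(2) e(2-4) \<gamma>] by blast
  have PQc: "P' \<in> carrier T" "Q' \<in> carrier T" "\<iota> w \<in> carrier T" "P \<in> carrier T" "Q \<in> carrier T"
    using PQ' W PQ by auto
  have fe: "f \<oplus> e = \<iota> (\<phi> \<oplus>\<^bsub>S\<^esub> \<epsilon>)" using \<phi> \<epsilon> by (simp add: f_def e_def)
  have De: "e \<otimes> D = \<zero>" "D \<otimes> e = \<zero>" "e \<otimes> D' = \<zero>" "D' \<otimes> e = \<zero>"
    subgoal using word_rewrite[OF e(4) e(1) f(1), of D] D'(1,2) by simp
    subgoal using word_rewrite[OF D'(3) D'(1) f(1) e(1)] D'(1) e(3) by simp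
    subgoal using word_rewrite[OF e(4) e(1) f(1), of D'] D'(4,5) by simp
    subgoal using word_rewrite[OF D'(6) D'(4) f(1) e(1)] D'(4) e(3) by simp
    done
  have PDQ: "P' \<otimes> D = D" "D \<otimes> \<iota> w = D" "D \<otimes> Q' = D"
    subgoal using word_rewrite[OF f'(1) PQc(1) f(1), of D] D'(1,2) by simp
    subgoal using word_rewrite[OF D'(3) D'(1) f(1) PQc(3)] D'(3) Wf by simp
    subgoal using word_rewrite[OF D'(3) D'(1) f(1) PQc(2)] D'(3) f' by simp
    done
  have "(P' \<otimes> P) \<otimes> \<alpha> \<otimes> (Q \<otimes> \<iota> w \<otimes> Q') = P' \<otimes> (P \<otimes> \<alpha> \<otimes> Q) \<otimes> \<iota> w \<otimes> Q'"
    using PQc \<alpha>(1) by (simp add: m_assoc)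
  also have "\<dots> = P' \<otimes> (D \<oplus> x [^] k \<otimes> \<beta>) \<otimes> \<iota> w \<otimes> Q'" unfolding eq ..
  also have "\<dots> = P' \<otimes> D \<otimes> \<iota> w \<otimes> Q' \<oplus> x [^] k \<otimes> (P' \<otimes> (\<beta> \<otimes> \<iota> w) \<otimes> Q')"
    using PQc D'(1) \<beta>(1) by (simp add: m_assoc l_distr r_distr x_pow_left_commute[of P'])
  also have "\<dots> = D \<oplus> x [^] k \<otimes> (e \<oplus> x \<otimes> \<gamma>')" by (simp add: PDQ \<beta>W piv)
  also have "\<dots> = (D \<oplus> x [^] k \<otimes> e) \<oplus> x [^] Suc k \<otimes> \<gamma>'"
    using D'(1) e \<gamma>' by (simp add: r_distr a_assoc m_assoc)
  finally have eq': "(P' \<otimes> P) \<otimes> \<alpha> \<otimes> (Q \<otimes> \<iota> w \<otimes> Q') = (D \<oplus> x [^] k \<otimes> e) \<oplus> x [^] Suc k \<otimes> \<gamma>'" .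
  have idem: "(\<phi> \<oplus>\<^bsub>S\<^esub> \<epsilon>) \<otimes>\<^bsub>S\<^esub> (\<phi> \<oplus>\<^bsub>S\<^esub> \<epsilon>) = \<phi> \<oplus>\<^bsub>S\<^esub> \<epsilon>"
    using \<phi> \<epsilon> \<epsilon>2 \<phi>\<epsilon> \<epsilon>\<phi> by (simp add: S.l_distr S.r_distr)
  have absorb: "(f \<oplus> e) \<otimes> (d \<oplus> x [^] i \<otimes> e) = d \<oplus> x [^] i \<otimes> e"
    "(d \<oplus> x [^] i \<otimes> e) \<otimes> (f \<oplus> e) = d \<oplus> x [^] i \<otimes> e"
    if "d \<in> carrier T" "f \<otimes> d = d" "d \<otimes> f = d" "e \<otimes> d = \<zero>" "d \<otimes> e = \<zero>" for d and i :: nat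
    using that f e by (simp_all add: l_distr r_distr m_assoc x_pow_left_commute[of f] x_pow_left_commute[of e])
  have diag': "diag_annihilator (f \<oplus> e) (D \<oplus> x [^] k \<otimes> e) (D' \<oplus> x [^] (n - k) \<otimes> e)"
    "diag_annihilator (f \<oplus> e) (D' \<oplus> x [^] (n - k) \<otimes> e) (D \<oplus> x [^] k \<otimes> e)"
    using diag_annihilator_add[OF f(1) e(1) f(2) e(2-4) D'(1-6) diag(1)[folded f_def], of k "n - k"]
      diag_annihilator_add[OF f(1) e(1) f(2) e(2-4) D'(4-6) D'(1-3) diag(2)[folded f_def], of "n - k" k] k
    by simp_all
  show ?thesis unfolding partially_diagonal_def
  proof (rule bexI[of _ "P' \<otimes> P"], rule bexI[of _ "Q \<otimes> \<iota> w \<otimes> Q'"],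
      rule bexI[of _ "\<phi> \<oplus>\<^bsub>S\<^esub> \<epsilon>"], rule bexI[of _ "D \<oplus> x [^] k \<otimes> e"],
      rule bexI[of _ "D' \<oplus> x [^] (n - k) \<otimes> e"], rule bexI[of _ \<gamma>'], intro conjI)
    show "P' \<otimes> P \<in> Units T" "Q \<otimes> \<iota> w \<otimes> Q' \<in> Units T" using PQ PQ' W by simp_all
    show "\<phi> \<oplus>\<^bsub>S\<^esub> \<epsilon> \<in> carrier S" using \<phi> \<epsilon> by simp
    show "(P' \<otimes> P) \<otimes> \<alpha> \<otimes> (Q \<otimes> \<iota> w \<otimes> Q') = (D \<oplus> x [^] k \<otimes> e) \<oplus> x [^] Suc k \<otimes> \<gamma>'" by (rule eq')
    show "(\<phi> \<oplus>\<^bsub>S\<^esub> \<epsilon>) \<otimes>\<^bsub>S\<^esub> (\<phi> \<oplus>\<^bsub>S\<^esub> \<epsilon>) = \<phi> \<oplus>\<^bsub>S\<^esub> \<epsilon>" by (rule idem)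
    show "diag_annihilator (\<iota> (\<phi> \<oplus>\<^bsub>S\<^esub> \<epsilon>)) (D \<oplus> x [^] k \<otimes> e) (D' \<oplus> x [^] (n - k) \<otimes> e)"
      "diag_annihilator (\<iota> (\<phi> \<oplus>\<^bsub>S\<^esub> \<epsilon>)) (D' \<oplus> x [^] (n - k) \<otimes> e) (D \<oplus> x [^] k \<otimes> e)"
      unfolding fe[symmetric] by (rule diag')+
  qed (unfold fe[symmetric], use D' e \<gamma>' f' De absorb in auto)
qed

theorem unit_regular_imp_left_morphic:
  assumes ur: "unit_regular_ring S"
  shows "left_morphic_ring T"
  unfolding left_morphic_ring_def
proof
  fix \<alpha> assume \<alpha>: "\<alpha> \<in> carrier T"
  have "k \<le> n \<Longrightarrow> partially_diagonal k \<alpha>" for k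
    by (induction k) (use partially_diagonal_0 partially_diagonal_Suc ur \<alpha> in auto)
  then have "partially_diagonal n \<alpha>" by simp
  then obtain P Q \<phi> D D' \<beta> where PQ: "P \<in> Units T" "Q \<in> Units T"
    and \<phi>: "\<phi> \<in> carrier S" "\<phi> \<otimes>\<^bsub>S\<^esub> \<phi> = \<phi>"
    and D: "D \<in> carrier T" "\<iota> \<phi> \<otimes> D = D" "D \<otimes> \<iota> \<phi> = D" "D' \<in> carrier T" "\<iota> \<phi> \<otimes> D' = D'" "D' \<otimes> \<iota> \<phi> = D'"
    and diag: "diag_annihilator (\<iota> \<phi>) D D'" "diag_annihilator (\<iota> \<phi>) D' D"
    and \<beta>: "\<beta> \<in> carrier T"
    and eq: "P \<otimes> \<alpha> \<otimes> Q = D \<oplus> x [^] n \<otimes> \<beta>"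
    unfolding partially_diagonal_def by blast
  define f where "f = \<iota> \<phi>"
  define g where "g = \<one> \<ominus> f"
  have f: "f \<in> carrier T" "f \<otimes> f = f" using \<phi> by (simp_all add: f_def flip: hom.hom_mult)
  have g: "g \<in> carrier T" "g \<otimes> g = g" "f \<otimes> g = \<zero>" "g \<otimes> f = \<zero>" "f \<oplus> g = \<one>"
    unfolding g_def using f r_one by (simp; fail | algebra)+
  note D' = D[folded f_def]
  \<comment> \<open>The complement \<open>g\<close> of all pivots joins as the last one, with
    exponent \<open>n\<close>: it adds \<open>x^n g = 0\<close> to \<open>D\<close> and
    \<open>x^0 g = g\<close> to \<open>D'\<close>.\<close>
  have z: "x [^] n \<otimes> g = \<zero>" "x [^] (0::nat) \<otimes> g = g" using x_nilpotent g by simp_all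
  have "diag_annihilator \<one> D (D' \<oplus> g)" "diag_annihilator \<one> (D' \<oplus> g) D"
    using diag_annihilator_add[OF f(1) g(1) f(2) g(2-4) D'(1-6) diag(1)[folded f_def], of n 0]
      diag_annihilator_add[OF f(1) g(1) f(2) g(2-4) D'(4-6) D'(1-3) diag(2)[folded f_def], of 0 n] D'(1,4) g
    by (simp_all add: z del: nat_pow_0)
  then have "left_morphic_pair T D (D' \<oplus> g)"
    using D' g unfolding left_morphic_pair_def diag_annihilator_def by auto
  then have "left_morphic_pair T (inv P \<otimes> D \<otimes> inv Q) (inv (inv Q) \<otimes> (D' \<oplus> g) \<otimes> inv (inv P))"
    using PQ by (intro left_morphic_pair_mult_Units) auto
  moreover have "inv P \<otimes> D \<otimes> inv Q = \<alpha>"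
  proof -
    have "D = P \<otimes> \<alpha> \<otimes> Q" using eq \<beta> D(1) x_nilpotent by simp
    then have "inv P \<otimes> D \<otimes> inv Q = (inv P \<otimes> P) \<otimes> \<alpha> \<otimes> (Q \<otimes> inv Q)"
      using PQ[THEN Units_closed] PQ[THEN Units_inv_closed] \<alpha> by (simp only: m_assoc m_closed)
    then show ?thesis using PQ \<alpha> by simp
  qed
  ultimately show "left_morphic_element T \<alpha>"
    using left_morphic_element_iff[OF \<alpha>] by auto
qed

text \<open>Since \<open>x\<close> is central, each axiom is equivalent to its mirror image.\<close>

lemma truncated_extension_opposite_ring:
  "truncated_extension (opposite_ring T) (opposite_ring S) \<iota> x n"
proof -
  interpret oT: ring "opposite_ring T" by (rule ring_opposite_ring[OF ring_axioms])
  interpret oS: ring "opposite_ring S" by (rule ring_opposite_ring[OF S.ring_axioms])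
  show ?thesis
  proof (unfold_locales, goal_cases)
    case 1 then show ?case
      using hom by (auto simp: ring_hom_def)
  next
    case (5 t i)
    then show ?case using x_annihilator[of t i]
      by (auto simp: pow_opposite_ring[OF ring_axioms] x_pow_central)
  next
    case (6 t)
    then show ?case using decomposition[of t] by (auto simp: x_central)
  next
    case (7 r s)
    then show ?case using residue_inj[of r s] by (auto simp: x_central)
  qed (auto simp: pow_opposite_ring[OF ring_axioms] x_central x_nilpotent)
qed

theorem unit_regular_imp_morphic:
  assumes "unit_regular_ring S"
  shows "morphic_ring T"
proof -
  interpret op: truncated_extension "opposite_ring T" "opposite_ring S" \<iota> x n
    by (rule truncated_extension_opposite_ring)
  show ?thesis
    using unit_regular_imp_left_morphic[OF assms] 
      op.unit_regular_imp_left_morphic[OF unit_regular_ring_opposite_ring[OF S.ring_axioms assms]]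
    by (simp add: morphic_ring_def right_morphic_ring_opposite_ring)
qed

end

section \<open>The case \<open>n = 2\<close>: from left morphic elements to unit regularity\<close>

context truncated_extension begin

text \<open>For \<open>n = 2\<close> the map \<open>(r, m) \<mapsto> pair r m\<close> identifies \<open>S \<propto> S\<close> with \<open>T\<close>.\<close>

definition "pair r m = \<iota> r \<oplus> x \<otimes> \<iota> m"

lemma pair_closed [simp]: "r \<in> carrier S \<Longrightarrow> m \<in> carrier S \<Longrightarrow> pair r m \<in> carrier T"
  by (simp add: pair_def)

lemma x_square: "n = 2 \<Longrightarrow> x \<otimes> x = \<zero>"
  using x_nilpotent by (simp add: numeral_2_eq_2)

lemma pair_surj:
  assumes n: "n = 2" and t: "t \<in> carrier T"
  obtains r m where "r \<in> carrier S" "m \<in> carrier S" "t = pair r m"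
proof -
  obtain r s where r: "r \<in> carrier S" "s \<in> carrier T" "t = \<iota> r \<oplus> x \<otimes> s"
    using decomposition[OF t] by blast
  obtain m s' where m: "m \<in> carrier S" "s' \<in> carrier T" "s = \<iota> m \<oplus> x \<otimes> s'"
    using decomposition[OF r(2)] by blast
  have "x \<otimes> (x \<otimes> s') = \<zero>" using x_square[OF n] m by (simp flip: m_assoc)
  then have "x \<otimes> s = x \<otimes> \<iota> m" using m by (simp add: r_distr)
  then show ?thesis using that[of r m] r m by (simp add: pair_def)
qed

lemma pair_mult:
  assumes "n = 2" "r \<in> carrier S" "m \<in> carrier S" "b \<in> carrier S" "c \<in> carrier S"
  shows "pair r m \<otimes> pair b c = pair (r \<otimes>\<^bsub>S\<^esub> b) (r \<otimes>\<^bsub>S\<^esub> c \<oplus>\<^bsub>S\<^esub> m \<otimes>\<^bsub>S\<^esub> b)"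
proof -
  have "x \<otimes> (x \<otimes> s) = \<zero>" if "s \<in> carrier T" for s
    using x_square[OF assms(1)] that by (simp flip: m_assoc)
  then show ?thesis using assms
    by (simp add: pair_def l_distr r_distr m_assoc x_left_commute[of "\<iota> r"] x_left_commute[of "\<iota> m"] a_ac)
qed

lemma pair_eq_zero:
  assumes n: "n = 2" and rm: "r \<in> carrier S" "m \<in> carrier S" and z: "pair r m = \<zero>"
  shows "r = \<zero>\<^bsub>S\<^esub>" "m = \<zero>\<^bsub>S\<^esub>"
proof -
  have "\<iota> r = x \<otimes> (\<ominus> \<iota> m)"
    using z rm minus_equality[of "\<iota> r" "x \<otimes> \<iota> m"] by (simp add: pair_def r_minus)
  then show r: "r = \<zero>\<^bsub>S\<^esub>" using residue_inj[of r "\<ominus> \<iota> m"] rm(1) hom.hom_closed[OF rm(2)] by blast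
  then have "x [^] (1::nat) \<otimes> \<iota> m = \<zero>" using z rm by (simp add: pair_def)
  \<comment> \<open>With \<open>n = 2\<close> and \<open>i = 1\<close> the annihilator of
    \<open>x\<close> lies in \<open>xT\<close>, so \<open>\<iota> m\<close> is a multiple of
    \<open>x\<close> as well.\<close>
  from x_annihilator[OF _ _ this] obtain s where "s \<in> carrier T" "\<iota> m = x \<otimes> s"
    using n rm by auto
  then show "m = \<zero>\<^bsub>S\<^esub>" using residue_inj rm by simp
qed

lemma pair_inject:
  assumes n: "n = 2" and c: "r \<in> carrier S" "m \<in> carrier S" "r' \<in> carrier S" "m' \<in> carrier S"
  shows "pair r m = pair r' m' \<longleftrightarrow> r = r' \<and> m = m'"
proof
  assume eq: "pair r m = pair r' m'"
  have "pair (r \<ominus>\<^bsub>S\<^esub> r') (m \<ominus>\<^bsub>S\<^esub> m') = pair r m \<ominus> pair r' m'"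
    using c by (simp add: pair_def S.minus_eq minus_eq r_distr r_minus minus_add a_ac)
  also have "\<dots> = \<zero>" using eq c by (simp add: minus_eq r_neg)
  finally have "r \<ominus>\<^bsub>S\<^esub> r' = \<zero>\<^bsub>S\<^esub>" "m \<ominus>\<^bsub>S\<^esub> m' = \<zero>\<^bsub>S\<^esub>"
    by (rule pair_eq_zero[OF n, rotated 2], use c in simp_all)+
  then show "r = r' \<and> m = m'" using c by (simp add: S.minus_eq_zero_iff)
qed simp

lemma pair_eq_zero_iff:
  assumes "n = 2" "r \<in> carrier S" "m \<in> carrier S"
  shows "pair r m = \<zero> \<longleftrightarrow> r = \<zero>\<^bsub>S\<^esub> \<and> m = \<zero>\<^bsub>S\<^esub>"
  using pair_inject[OF assms S.zero_closed S.zero_closed] by (simp add: pair_def)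

lemma pair_zero_left: "a \<in> carrier S \<Longrightarrow> pair \<zero>\<^bsub>S\<^esub> a = x \<otimes> \<iota> a"
  by (simp add: pair_def)

theorem left_morphic_imp_unit_regular:
  assumes n: "n = 2" and morphic: "\<And>a. a \<in> carrier S \<Longrightarrow> left_morphic_element T (x \<otimes> \<iota> a)"
  shows "unit_regular_ring S"
  unfolding unit_regular_ring_def
proof
  fix a assume a: "a \<in> carrier S"
  let ?A = "pair \<zero>\<^bsub>S\<^esub> a"
  have "\<exists>B. left_morphic_pair T ?A B"
    using morphic[OF a] a by (simp add: pair_zero_left left_morphic_element_iff)
  then obtain B where B: "left_morphic_pair T ?A B" by blast
  then have "B \<in> carrier T" by (simp add: left_morphic_pair_def)
  then obtain b c where bc: "b \<in> carrier S" "c \<in> carrier S" "B = pair b c"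
    by (rule pair_surj[OF n])
  have multA: "pair r m \<otimes> ?A = pair \<zero>\<^bsub>S\<^esub> (r \<otimes>\<^bsub>S\<^esub> a)" if "r \<in> carrier S" "m \<in> carrier S" for r m
    using pair_mult[OF n that, of "\<zero>\<^bsub>S\<^esub>" a] a that by simp
  note multB = pair_mult[OF n _ _ bc(1,2)]
  \<comment> \<open>The product with \<open>(0, a)\<close> does not see \<open>m\<close>, so if
    \<open>r a = 0\<close> then every \<open>m\<close> is reached. At \<open>r = 0\<close>,
    \<open>m = 1\<close> this becomes \<open>surj\<close>; at \<open>m = 0\<close> it gives one
    inclusion of \<open>l(a) = Rb\<close>.\<close>
  have lA: "r \<otimes>\<^bsub>S\<^esub> a = \<zero>\<^bsub>S\<^esub> \<longleftrightarrow> (\<exists>s\<in>carrier S. \<exists>s'\<in>carrier S. r = s \<otimes>\<^bsub>S\<^esub> b \<and> m = s \<otimes>\<^bsub>S\<^esub> c \<oplus>\<^bsub>S\<^esub> s' \<otimes>\<^bsub>S\<^esub> b)"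
    if "r \<in> carrier S" "m \<in> carrier S" for r m
  proof -
    have "r \<otimes>\<^bsub>S\<^esub> a = \<zero>\<^bsub>S\<^esub> \<longleftrightarrow> pair r m \<otimes> ?A = \<zero>"
      unfolding multA[OF that] using that a by (simp add: pair_eq_zero_iff[OF n])
    also have "\<dots> \<longleftrightarrow> (\<exists>t\<in>carrier T. pair r m = t \<otimes> B)"
      using B that by (simp add: left_morphic_pair_def)
    also have "\<dots> \<longleftrightarrow> (\<exists>s\<in>carrier S. \<exists>s'\<in>carrier S. pair r m = pair s s' \<otimes> B)"
      by (metis pair_surj[OF n] pair_closed)
    also have "\<dots> \<longleftrightarrow> (\<exists>s\<in>carrier S. \<exists>s'\<in>carrier S. r = s \<otimes>\<^bsub>S\<^esub> b \<and> m = s \<otimes>\<^bsub>S\<^esub> c \<oplus>\<^bsub>S\<^esub> s' \<otimes>\<^bsub>S\<^esub> b)"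
      unfolding bc(3) using bc(1,2) that by (simp add: multB pair_inject[OF n] cong: bex_cong)
    finally show ?thesis .
  qed
  \<comment> \<open>Multiples of \<open>(0, a)\<close> have first coordinate \<open>0\<close>, which
    yields \<open>inj\<close>; at \<open>r = 0\<close> the equivalence reduces to
    \<open>l(b) = Ra\<close>.\<close>
  have lB: "r \<otimes>\<^bsub>S\<^esub> b = \<zero>\<^bsub>S\<^esub> \<and> r \<otimes>\<^bsub>S\<^esub> c \<oplus>\<^bsub>S\<^esub> m \<otimes>\<^bsub>S\<^esub> b = \<zero>\<^bsub>S\<^esub> \<longleftrightarrow> r = \<zero>\<^bsub>S\<^esub> \<and> (\<exists>s\<in>carrier S. m = s \<otimes>\<^bsub>S\<^esub> a)"
    if "r \<in> carrier S" "m \<in> carrier S" for r m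
  proof -
    have "r \<otimes>\<^bsub>S\<^esub> b = \<zero>\<^bsub>S\<^esub> \<and> r \<otimes>\<^bsub>S\<^esub> c \<oplus>\<^bsub>S\<^esub> m \<otimes>\<^bsub>S\<^esub> b = \<zero>\<^bsub>S\<^esub> \<longleftrightarrow> pair r m \<otimes> B = \<zero>"
      unfolding bc(3) multB[OF that] using that bc(1,2) by (simp add: pair_eq_zero_iff[OF n])
    also have "\<dots> \<longleftrightarrow> (\<exists>t\<in>carrier T. pair r m = t \<otimes> ?A)"
      using B that by (simp add: left_morphic_pair_def)
    also have "\<dots> \<longleftrightarrow> (\<exists>s\<in>carrier S. \<exists>s'\<in>carrier S. pair r m = pair s s' \<otimes> ?A)"
      by (metis pair_surj[OF n] pair_closed)
    also have "\<dots> \<longleftrightarrow> r = \<zero>\<^bsub>S\<^esub> \<and> (\<exists>s\<in>carrier S. m = s \<otimes>\<^bsub>S\<^esub> a)"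
      using a that by (auto simp: multA pair_inject[OF n] cong: bex_cong)
    finally show ?thesis .
  qed
  have pair_ab: "left_morphic_pair S a b"
    unfolding left_morphic_pair_def
  proof (intro conjI ballI)
    fix r assume r: "r \<in> carrier S"
    show "r \<otimes>\<^bsub>S\<^esub> a = \<zero>\<^bsub>S\<^esub> \<longleftrightarrow> (\<exists>s\<in>carrier S. r = s \<otimes>\<^bsub>S\<^esub> b)"
    proof
      assume "\<exists>s\<in>carrier S. r = s \<otimes>\<^bsub>S\<^esub> b"
      then obtain s where "s \<in> carrier S" "r = s \<otimes>\<^bsub>S\<^esub> b" by blast
      then show "r \<otimes>\<^bsub>S\<^esub> a = \<zero>\<^bsub>S\<^esub>"
        using lA[of r "s \<otimes>\<^bsub>S\<^esub> c \<oplus>\<^bsub>S\<^esub> \<zero>\<^bsub>S\<^esub> \<otimes>\<^bsub>S\<^esub> b"] r bc(1,2) by (metis S.a_closed S.m_closed S.zero_closed)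
    qed (use lA[OF r S.zero_closed] in blast)
    show "r \<otimes>\<^bsub>S\<^esub> b = \<zero>\<^bsub>S\<^esub> \<longleftrightarrow> (\<exists>s\<in>carrier S. r = s \<otimes>\<^bsub>S\<^esub> a)"
      using lB[OF S.zero_closed r] r bc(1,2) by simp
  qed (use a bc in simp_all)
  show "\<exists>u\<in>Units S. a = a \<otimes>\<^bsub>S\<^esub> u \<otimes>\<^bsub>S\<^esub> a"
  proof (rule S.left_morphic_pair_imp_unit_regular[OF pair_ab bc(2)])
    show "r = \<zero>\<^bsub>S\<^esub>" if "r \<in> carrier S" "m \<in> carrier S" "r \<otimes>\<^bsub>S\<^esub> b = \<zero>\<^bsub>S\<^esub>"
      "r \<otimes>\<^bsub>S\<^esub> c \<oplus>\<^bsub>S\<^esub> m \<otimes>\<^bsub>S\<^esub> b = \<zero>\<^bsub>S\<^esub>" for r m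
      using lB[of r m] that by simp
    show "\<exists>r\<in>carrier S. \<exists>m\<in>carrier S. r \<otimes>\<^bsub>S\<^esub> b = \<zero>\<^bsub>S\<^esub> \<and> r \<otimes>\<^bsub>S\<^esub> c \<oplus>\<^bsub>S\<^esub> m \<otimes>\<^bsub>S\<^esub> b = \<one>\<^bsub>S\<^esub>"
      using lA[of "\<zero>\<^bsub>S\<^esub>" "\<one>\<^bsub>S\<^esub>"] a by (metis S.l_null S.one_closed S.zero_closed)
  qed
qed

end

section \<open>The trivial extension as a truncated extension with \<open>n = 2\<close>\<close>

lemma trivial_extension_regular_simps [simp]:
  "carrier (R \<propto> regular_bimodule R) = carrier R \<times> carrier R"
  "(r, m) \<otimes>\<^bsub>R \<propto> regular_bimodule R\<^esub> (s, k) = (r \<otimes>\<^bsub>R\<^esub> s, r \<otimes>\<^bsub>R\<^esub> k \<oplus>\<^bsub>R\<^esub> m \<otimes>\<^bsub>R\<^esub> s)"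
  "\<one>\<^bsub>R \<propto> regular_bimodule R\<^esub> = (\<one>\<^bsub>R\<^esub>, \<zero>\<^bsub>R\<^esub>)"
  "\<zero>\<^bsub>R \<propto> regular_bimodule R\<^esub> = (\<zero>\<^bsub>R\<^esub>, \<zero>\<^bsub>R\<^esub>)"
  "(r, m) \<oplus>\<^bsub>R \<propto> regular_bimodule R\<^esub> (s, k) = (r \<oplus>\<^bsub>R\<^esub> s, m \<oplus>\<^bsub>R\<^esub> k)"
  by (simp_all add: trivial_extension_def regular_bimodule_def)

context ring begin

lemma ring_trivial_extension: "ring (R \<propto> regular_bimodule R)"
proof (rule ringI)
  show "abelian_group (R \<propto> regular_bimodule R)"
  proof (rule abelian_groupI)
    fix p assume "p \<in> carrier (R \<propto> regular_bimodule R)"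
    then show "\<exists>q\<in>carrier (R \<propto> regular_bimodule R).
        q \<oplus>\<^bsub>R \<propto> regular_bimodule R\<^esub> p = \<zero>\<^bsub>R \<propto> regular_bimodule R\<^esub>"
      by (intro bexI[of _ "(\<ominus> fst p, \<ominus> snd p)"]) (auto simp: l_neg)
  qed (auto simp: a_ac)
  show "Group.monoid (R \<propto> regular_bimodule R)"
    by unfold_locales (auto simp: m_assoc l_distr r_distr a_ac)
qed (auto simp: l_distr r_distr a_ac)

text \<open>The element \<open>(0, 1)\<close> takes the part of \<open>x\<close>: its square is
  \<open>0\<close>, and \<open>(r, m)\<close> is \<open>r + x m\<close>.\<close>

lemma truncated_extension_trivial_extension:
  "truncated_extension (R \<propto> regular_bimodule R) R (\<lambda>r. (r, \<zero>)) (\<zero>, \<one>) 2"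
proof -
  interpret E: ring "R \<propto> regular_bimodule R" by (rule ring_trivial_extension)
  show ?thesis
  proof (unfold_locales, goal_cases)
    case 1 then show ?case by (auto simp: ring_hom_def)
  next
    case (4) show ?case by (simp add: numeral_2_eq_2)
  next
    case (5 t i)
    then have "i = 0 \<or> i = 1 \<or> i = 2" by auto
    then consider "i = 0" | "i = 1" | "i = 2" by blast
    then show ?case
    proof cases
      case 1
      then show ?thesis using 5 by (intro bexI[of _ t]) (auto simp: numeral_2_eq_2)
    next
      case 2
      then show ?thesis using 5 by (intro bexI[of _ "(snd t, \<zero>)"]) auto
    next
      case 3
      then show ?thesis using 5 by (intro bexI[of _ t]) auto
    qed
  next
    case (6 t)
    then show ?case by (intro bexI[of _ "fst t"] bexI[of _ "(snd t, \<zero>)"]) auto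
  qed auto
qed

end

section \<open>Matrix rings\<close>

lemma (in abelian_monoid) finsum_swap:
  assumes "finite A" "finite B" "\<And>i j. i \<in> A \<Longrightarrow> j \<in> B \<Longrightarrow> f i j \<in> carrier G"
  shows "(\<Oplus>i\<in>A. \<Oplus>j\<in>B. f i j) = (\<Oplus>j\<in>B. \<Oplus>i\<in>A. f i j)"
  using assms(1,3)
proof (induction A)
  case (insert a A)
  have "(\<Oplus>i\<in>insert a A. \<Oplus>j\<in>B. f i j) = (\<Oplus>j\<in>B. f a j) \<oplus> (\<Oplus>i\<in>A. \<Oplus>j\<in>B. f i j)"
    using insert by (intro finsum_insert) auto
  also have "\<dots> = (\<Oplus>j\<in>B. f a j) \<oplus> (\<Oplus>j\<in>B. \<Oplus>i\<in>A. f i j)" using insert by simp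
  also have "\<dots> = (\<Oplus>j\<in>B. f a j \<oplus> (\<Oplus>i\<in>A. f i j))"
    using insert by (intro finsum_addf[symmetric]) auto
  also have "\<dots> = (\<Oplus>j\<in>B. \<Oplus>i\<in>insert a A. f i j)"
    using insert by (intro finsum_cong' refl finsum_insert[symmetric]) auto
  finally show ?case .
qed (use assms(2) in simp)

lemma (in abelian_monoid) finsum_delta:
  assumes "finite A" "i \<in> A" "f i \<in> carrier G" "\<And>l. l \<in> A \<Longrightarrow> l \<noteq> i \<Longrightarrow> f l = \<zero>"
  shows "finsum G f A = f i"
proof -
  have "finsum G f A = (\<Oplus>l\<in>A. if i = l then f l else \<zero>)"
    using assms by (intro finsum_cong') auto
  also have "\<dots> = f i" using assms by (intro finsum_singleton; auto) (metis zero_closed)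
  finally show ?thesis .
qed

lemma carrier_matrix_ring: "carrier (matrix_ring k S) = {..<k} \<times> {..<k} \<rightarrow>\<^sub>E carrier S"
  by (simp add: matrix_ring_def)

lemma matrix_ring_simps [simp]:
  "i < k \<Longrightarrow> j < k \<Longrightarrow> (A \<otimes>\<^bsub>matrix_ring k S\<^esub> B) (i, j) = (\<Oplus>\<^bsub>S\<^esub>l\<in>{..<k}. A (i, l) \<otimes>\<^bsub>S\<^esub> B (l, j))"
  "i < k \<Longrightarrow> j < k \<Longrightarrow> (A \<oplus>\<^bsub>matrix_ring k S\<^esub> B) (i, j) = A (i, j) \<oplus>\<^bsub>S\<^esub> B (i, j)"
  "i < k \<Longrightarrow> j < k \<Longrightarrow> \<one>\<^bsub>matrix_ring k S\<^esub> (i, j) = (if i = j then \<one>\<^bsub>S\<^esub> else \<zero>\<^bsub>S\<^esub>)"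
  "i < k \<Longrightarrow> j < k \<Longrightarrow> \<zero>\<^bsub>matrix_ring k S\<^esub> (i, j) = \<zero>\<^bsub>S\<^esub>"
  by (simp_all add: matrix_ring_def)

lemma matrix_eqI:
  assumes "A \<in> carrier (matrix_ring k S)" "B \<in> carrier (matrix_ring k S)"
    "\<And>i j. i < k \<Longrightarrow> j < k \<Longrightarrow> A (i, j) = B (i, j)"
  shows "A = B"
  using assms unfolding carrier_matrix_ring by (intro PiE_ext[of A "{..<k} \<times> {..<k}" "\<lambda>_. carrier S" B]) auto

lemma matrix_entry_closed:
  "A \<in> carrier (matrix_ring k S) \<Longrightarrow> i < k \<Longrightarrow> j < k \<Longrightarrow> A (i, j) \<in> carrier S"
  by (auto simp: carrier_matrix_ring)

definition diag_matrix :: "nat \<Rightarrow> ('a, 'k) ring_scheme \<Rightarrow> (nat \<Rightarrow> 'a) \<Rightarrow> nat \<times> nat \<Rightarrow> 'a"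
  where "diag_matrix k S d = (\<lambda>(i, j)\<in>{..<k} \<times> {..<k}. if i = j then d i else \<zero>\<^bsub>S\<^esub>)"

lemma diag_matrix_apply [simp]:
  "i < k \<Longrightarrow> j < k \<Longrightarrow> diag_matrix k S d (i, j) = (if i = j then d i else \<zero>\<^bsub>S\<^esub>)"
  by (simp add: diag_matrix_def)

context ring begin

lemma matrix_mult_closed:
  assumes "A \<in> carrier (matrix_ring k R)" "B \<in> carrier (matrix_ring k R)"
  shows "A \<otimes>\<^bsub>matrix_ring k R\<^esub> B \<in> carrier (matrix_ring k R)"
  using assms by (auto simp: matrix_ring_def PiE_iff intro!: finsum_closed)

lemma matrix_add_closed:
  assumes "A \<in> carrier (matrix_ring k R)" "B \<in> carrier (matrix_ring k R)"
  shows "A \<oplus>\<^bsub>matrix_ring k R\<^esub> B \<in> carrier (matrix_ring k R)"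
  using assms by (auto simp: matrix_ring_def PiE_iff)

lemma diag_matrix_closed:
  "(\<And>i. i < k \<Longrightarrow> d i \<in> carrier R) \<Longrightarrow> diag_matrix k R d \<in> carrier (matrix_ring k R)"
  by (auto simp: diag_matrix_def carrier_matrix_ring)

lemma one_matrix: "\<one>\<^bsub>matrix_ring k R\<^esub> = diag_matrix k R (\<lambda>_. \<one>)"
  and zero_matrix: "\<zero>\<^bsub>matrix_ring k R\<^esub> = diag_matrix k R (\<lambda>_. \<zero>)"
  by (auto simp: matrix_ring_def diag_matrix_def)

lemma diag_matrix_mult_left:
  assumes "A \<in> carrier (matrix_ring k R)" "\<And>i. i < k \<Longrightarrow> d i \<in> carrier R" "i < k" "j < k"
  shows "(diag_matrix k R d \<otimes>\<^bsub>matrix_ring k R\<^esub> A) (i, j) = d i \<otimes> A (i, j)"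
  using assms matrix_entry_closed[OF assms(1)]
  by (simp, subst finsum_delta[of _ i]) auto

lemma diag_matrix_mult_right:
  assumes "A \<in> carrier (matrix_ring k R)" "\<And>i. i < k \<Longrightarrow> d i \<in> carrier R" "i < k" "j < k"
  shows "(A \<otimes>\<^bsub>matrix_ring k R\<^esub> diag_matrix k R d) (i, j) = A (i, j) \<otimes> d j"
  using assms matrix_entry_closed[OF assms(1)]
  by (simp, subst finsum_delta[of _ j]) auto

lemma ring_matrix_ring: "ring (matrix_ring k R)"
proof (rule ringI)
  let ?M = "matrix_ring k R"
  note c = matrix_entry_closed[where S = R and k = k]
  show "abelian_group ?M"
  proof (rule abelian_groupI)
    fix A assume A: "A \<in> carrier ?M"
    show "\<exists>B\<in>carrier ?M. B \<oplus>\<^bsub>?M\<^esub> A = \<zero>\<^bsub>?M\<^esub>"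
    proof (rule bexI)
      show B: "(\<lambda>p\<in>{..<k} \<times> {..<k}. \<ominus> A p) \<in> carrier ?M" using A by (auto simp: carrier_matrix_ring)
      show "(\<lambda>p\<in>{..<k} \<times> {..<k}. \<ominus> A p) \<oplus>\<^bsub>?M\<^esub> A = \<zero>\<^bsub>?M\<^esub>"
        by (rule matrix_eqI[OF matrix_add_closed[OF B A]])
          (use c[OF A] in \<open>auto simp: zero_matrix diag_matrix_closed l_neg\<close>)
    qed
  next
    show "\<zero>\<^bsub>?M\<^esub> \<in> carrier ?M" by (simp only: zero_matrix diag_matrix_closed zero_closed)
  next
    fix A B C assume A: "A \<in> carrier ?M" and B: "B \<in> carrier ?M" and C: "C \<in> carrier ?M"
    show "A \<oplus>\<^bsub>?M\<^esub> B \<oplus>\<^bsub>?M\<^esub> C = A \<oplus>\<^bsub>?M\<^esub> (B \<oplus>\<^bsub>?M\<^esub> C)"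
      by (rule matrix_eqI[where S = R and k = k]; (intro matrix_add_closed A B C)?)
        (simp add: c[OF A] c[OF B] c[OF C] a_assoc)
  next
    fix A B assume A: "A \<in> carrier ?M" and B: "B \<in> carrier ?M"
    show "A \<oplus>\<^bsub>?M\<^esub> B \<in> carrier ?M" by (rule matrix_add_closed[OF A B])
    show "A \<oplus>\<^bsub>?M\<^esub> B = B \<oplus>\<^bsub>?M\<^esub> A"
      by (rule matrix_eqI[where S = R and k = k]; (intro matrix_add_closed A B)?)
        (simp add: c[OF A] c[OF B] a_comm)
  next
    fix A assume A: "A \<in> carrier ?M"
    show "\<zero>\<^bsub>?M\<^esub> \<oplus>\<^bsub>?M\<^esub> A = A"
      by (rule matrix_eqI[where S = R and k = k]; (intro matrix_add_closed A)?)
        (simp_all add: c[OF A] zero_matrix diag_matrix_closed)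
  qed
  show "Group.monoid ?M"
  proof
    fix A B assume A: "A \<in> carrier ?M" and B: "B \<in> carrier ?M"
    then show "A \<otimes>\<^bsub>?M\<^esub> B \<in> carrier ?M" by (rule matrix_mult_closed)
  next
    show "\<one>\<^bsub>?M\<^esub> \<in> carrier ?M" by (simp only: one_matrix diag_matrix_closed one_closed)
  next
    fix A B C assume A: "A \<in> carrier ?M" and B: "B \<in> carrier ?M" and C: "C \<in> carrier ?M"
    note c' = c[OF A] c[OF B] c[OF C]
    show "A \<otimes>\<^bsub>?M\<^esub> B \<otimes>\<^bsub>?M\<^esub> C = A \<otimes>\<^bsub>?M\<^esub> (B \<otimes>\<^bsub>?M\<^esub> C)"
    proof (rule matrix_eqI[where S = R and k = k]; (intro matrix_mult_closed A B C)?)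
      fix i j assume ij: "i < k" "j < k"
      have "(A \<otimes>\<^bsub>?M\<^esub> B \<otimes>\<^bsub>?M\<^esub> C) (i, j) = (\<Oplus>l\<in>{..<k}. (\<Oplus>m\<in>{..<k}. A (i, m) \<otimes> B (m, l)) \<otimes> C (l, j))"
        using ij by simp (intro finsum_cong', auto intro!: finsum_closed simp: c')
      also have "\<dots> = (\<Oplus>l\<in>{..<k}. \<Oplus>m\<in>{..<k}. A (i, m) \<otimes> B (m, l) \<otimes> C (l, j))"
        using ij by (intro finsum_cong' refl finsum_ldistr) (auto intro!: finsum_closed simp: c')
      also have "\<dots> = (\<Oplus>m\<in>{..<k}. \<Oplus>l\<in>{..<k}. A (i, m) \<otimes> B (m, l) \<otimes> C (l, j))"
        using ij by (intro finsum_swap) (auto simp: c')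
      also have "\<dots> = (\<Oplus>m\<in>{..<k}. \<Oplus>l\<in>{..<k}. A (i, m) \<otimes> (B (m, l) \<otimes> C (l, j)))"
        using ij by (intro finsum_cong' refl m_assoc) (auto intro!: finsum_closed simp: c')
      also have "\<dots> = (\<Oplus>m\<in>{..<k}. A (i, m) \<otimes> (\<Oplus>l\<in>{..<k}. B (m, l) \<otimes> C (l, j)))"
        using ij by (intro finsum_cong' refl finsum_rdistr[symmetric]) (auto intro!: finsum_closed simp: c')
      also have "\<dots> = (A \<otimes>\<^bsub>?M\<^esub> (B \<otimes>\<^bsub>?M\<^esub> C)) (i, j)"
        using ij by simp (intro finsum_cong', auto intro!: finsum_closed simp: c')
      finally show "(A \<otimes>\<^bsub>?M\<^esub> B \<otimes>\<^bsub>?M\<^esub> C) (i, j) = (A \<otimes>\<^bsub>?M\<^esub> (B \<otimes>\<^bsub>?M\<^esub> C)) (i, j)" .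
    qed
  next
    fix A assume A: "A \<in> carrier ?M"
    show "\<one>\<^bsub>?M\<^esub> \<otimes>\<^bsub>?M\<^esub> A = A" "A \<otimes>\<^bsub>?M\<^esub> \<one>\<^bsub>?M\<^esub> = A"
      unfolding one_matrix
      by (rule matrix_eqI[where S = R and k = k]; (intro matrix_mult_closed A diag_matrix_closed one_closed)?;
        simp only: diag_matrix_mult_left[OF A] diag_matrix_mult_right[OF A] c[OF A] l_one r_one one_closed)+
  qed
  fix A B C assume A: "A \<in> carrier ?M" and B: "B \<in> carrier ?M" and C: "C \<in> carrier ?M"
  note c' = c[OF A] c[OF B] c[OF C]
  show "(A \<oplus>\<^bsub>?M\<^esub> B) \<otimes>\<^bsub>?M\<^esub> C = A \<otimes>\<^bsub>?M\<^esub> C \<oplus>\<^bsub>?M\<^esub> B \<otimes>\<^bsub>?M\<^esub> C"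
  proof (rule matrix_eqI[where S = R and k = k]; (intro matrix_mult_closed matrix_add_closed A B C)?)
    fix i j assume ij: "i < k" "j < k"
    have "((A \<oplus>\<^bsub>?M\<^esub> B) \<otimes>\<^bsub>?M\<^esub> C) (i, j) = (\<Oplus>l\<in>{..<k}. A (i, l) \<otimes> C (l, j) \<oplus> B (i, l) \<otimes> C (l, j))"
      using ij by (simp) (intro finsum_cong', auto simp: c' l_distr)
    then show "((A \<oplus>\<^bsub>?M\<^esub> B) \<otimes>\<^bsub>?M\<^esub> C) (i, j) = (A \<otimes>\<^bsub>?M\<^esub> C \<oplus>\<^bsub>?M\<^esub> B \<otimes>\<^bsub>?M\<^esub> C) (i, j)"
      using ij by (simp add: finsum_addf c' Pi_def)
  qed
  show "C \<otimes>\<^bsub>?M\<^esub> (A \<oplus>\<^bsub>?M\<^esub> B) = C \<otimes>\<^bsub>?M\<^esub> A \<oplus>\<^bsub>?M\<^esub> C \<otimes>\<^bsub>?M\<^esub> B"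
  proof (rule matrix_eqI[where S = R and k = k]; (intro matrix_mult_closed matrix_add_closed A B C)?)
    fix i j assume ij: "i < k" "j < k"
    have "(C \<otimes>\<^bsub>?M\<^esub> (A \<oplus>\<^bsub>?M\<^esub> B)) (i, j) = (\<Oplus>l\<in>{..<k}. C (i, l) \<otimes> A (l, j) \<oplus> C (i, l) \<otimes> B (l, j))"
      using ij by (simp) (intro finsum_cong', auto simp: c' r_distr)
    then show "(C \<otimes>\<^bsub>?M\<^esub> (A \<oplus>\<^bsub>?M\<^esub> B)) (i, j) = (C \<otimes>\<^bsub>?M\<^esub> A \<oplus>\<^bsub>?M\<^esub> C \<otimes>\<^bsub>?M\<^esub> B) (i, j)"
      using ij by (simp add: finsum_addf c' Pi_def)
  qed
qed

end

section \<open>Diagonal matrix units and Henriksen's theorem\<close>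

context ring begin

lemma diag_matrix_cong:
  "(\<And>i. i < k \<Longrightarrow> d i = d' i) \<Longrightarrow> diag_matrix k R d = diag_matrix k R d'"
  by (auto simp: diag_matrix_def)

lemma diag_matrix_mult:
  assumes "\<And>i. i < k \<Longrightarrow> d i \<in> carrier R" "\<And>i. i < k \<Longrightarrow> d' i \<in> carrier R"
  shows "diag_matrix k R d \<otimes>\<^bsub>matrix_ring k R\<^esub> diag_matrix k R d' = diag_matrix k R (\<lambda>i. d i \<otimes> d' i)"
  by (rule matrix_eqI[where S = R and k = k]; (intro matrix_mult_closed diag_matrix_closed)?)
    (simp_all add: assms diag_matrix_mult_left diag_matrix_closed del: matrix_ring_simps(1))

lemma diag_matrix_add:
  assumes "\<And>i. i < k \<Longrightarrow> d i \<in> carrier R" "\<And>i. i < k \<Longrightarrow> d' i \<in> carrier R"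
  shows "diag_matrix k R d \<oplus>\<^bsub>matrix_ring k R\<^esub> diag_matrix k R d' = diag_matrix k R (\<lambda>i. d i \<oplus> d' i)"
  by (rule matrix_eqI[where S = R and k = k]; (intro matrix_add_closed diag_matrix_closed)?)
    (simp_all add: assms)

lemma diag_matrix_Units:
  assumes "\<And>i. i < k \<Longrightarrow> d i \<in> Units R"
  shows "diag_matrix k R d \<in> Units (matrix_ring k R)"
proof -
  interpret M: ring "matrix_ring k R" by (rule ring_matrix_ring)
  show ?thesis
    by (rule M.UnitsI[of _ "diag_matrix k R (\<lambda>i. inv (d i))"])
      (auto intro!: diag_matrix_closed diag_matrix_cong simp: assms Units_closed diag_matrix_mult one_matrix)
qed

text \<open>These are the matrix unit at position \<open>(i, i)\<close> and, in
  \<open>diag_segment\<close>, the sum of the first \<open>j\<close> of them. The segments rise from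
  \<open>0\<close> to \<open>1\<close> by one orthogonal idempotent at a time, and the inductions on
  corners run along them.\<close>

definition "diag_unit k i = diag_matrix k R (\<lambda>p. if p = i then \<one> else \<zero>)"
definition "diag_segment k j = diag_matrix k R (\<lambda>p. if p < j then \<one> else \<zero>)"

lemma diag_unit_closed: "diag_unit k i \<in> carrier (matrix_ring k R)"
  and diag_segment_closed: "diag_segment k i \<in> carrier (matrix_ring k R)"
  unfolding diag_unit_def diag_segment_def by (auto intro!: diag_matrix_closed)

lemma diag_unit_idempotents:
  "diag_unit k i \<otimes>\<^bsub>matrix_ring k R\<^esub> diag_unit k i = diag_unit k i"
  "diag_segment k i \<otimes>\<^bsub>matrix_ring k R\<^esub> diag_segment k i = diag_segment k i"
  "diag_unit k i \<otimes>\<^bsub>matrix_ring k R\<^esub> diag_segment k i = \<zero>\<^bsub>matrix_ring k R\<^esub>"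
  "diag_segment k i \<otimes>\<^bsub>matrix_ring k R\<^esub> diag_unit k i = \<zero>\<^bsub>matrix_ring k R\<^esub>"
  "diag_segment k i \<oplus>\<^bsub>matrix_ring k R\<^esub> diag_unit k i = diag_segment k (Suc i)"
  "diag_segment k 0 = \<zero>\<^bsub>matrix_ring k R\<^esub>"
  "diag_segment k k = \<one>\<^bsub>matrix_ring k R\<^esub>"
  unfolding diag_unit_def diag_segment_def
  by (auto intro!: diag_matrix_cong simp: diag_matrix_mult diag_matrix_add one_matrix zero_matrix)

lemma matrix_corner_entry:
  assumes A: "A \<in> carrier (matrix_ring k R)"
    "diag_unit k i \<otimes>\<^bsub>matrix_ring k R\<^esub> A = A" "A \<otimes>\<^bsub>matrix_ring k R\<^esub> diag_unit k j = A"
    and pq: "p < k" "q < k" "p \<noteq> i \<or> q \<noteq> j"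
  shows "A (p, q) = \<zero>"
proof -
  have "A (p, q) = (if p = i then \<one> else \<zero>) \<otimes> A (p, q)"
    by (subst A(2)[symmetric], unfold diag_unit_def, rule diag_matrix_mult_left[OF A(1) _ pq(1,2)]) simp
  moreover have "A (p, q) = A (p, q) \<otimes> (if q = j then \<one> else \<zero>)"
    by (subst A(3)[symmetric], unfold diag_unit_def, rule diag_matrix_mult_right[OF A(1) _ pq(1,2)]) simp
  ultimately show ?thesis using pq matrix_entry_closed[OF A(1)] by (auto split: if_splits)
qed

lemma regular_between_diag_units:
  assumes reg: "\<And>a. a \<in> carrier R \<Longrightarrow> \<exists>y\<in>carrier R. a \<otimes> y \<otimes> a = a" and ij: "i < k" "j < k"
  shows "ring.regular_between (matrix_ring k R) (diag_unit k i) (diag_unit k j)"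
proof -
  let ?M = "matrix_ring k R"
  interpret M: ring ?M by (rule ring_matrix_ring)
  show ?thesis unfolding M.regular_between_def
  proof (intro ballI impI)
    fix A assume A: "A \<in> carrier ?M" "diag_unit k i \<otimes>\<^bsub>?M\<^esub> A = A" "A \<otimes>\<^bsub>?M\<^esub> diag_unit k j = A"
    note c = matrix_entry_closed[OF A(1)]
    note A0 = matrix_corner_entry[OF A]
    obtain y where y: "y \<in> carrier R" "A (i, j) \<otimes> y \<otimes> A (i, j) = A (i, j)"
      using reg c ij by blast
    \<comment> \<open>The corner at \<open>(i, j)\<close> is a copy of \<open>R\<close>; the inverse
      \<open>y\<close> sits at the transposed position \<open>(j, i)\<close>, so that
      \<open>A Y A\<close> has the entry \<open>A(i, j) y A(i, j)\<close>.\<close>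
    define Y where "Y = (\<lambda>(p, q)\<in>{..<k} \<times> {..<k}. if p = j \<and> q = i then y else \<zero>)"
    have Y: "Y \<in> carrier ?M" using y by (auto simp: Y_def carrier_matrix_ring)
    have AY: "(A \<otimes>\<^bsub>?M\<^esub> Y) (p, q) = A (p, j) \<otimes> Y (j, q)" if "p < k" "q < k" for p q
      using that ij y c by (simp, subst finsum_delta[of _ j]) (auto simp: Y_def)
    have "A \<otimes>\<^bsub>?M\<^esub> Y \<otimes>\<^bsub>?M\<^esub> A = A"
    proof (rule matrix_eqI[where S = R and k = k]; (intro matrix_mult_closed A Y)?)
      fix p q assume pq: "p < k" "q < k"
      have "(A \<otimes>\<^bsub>?M\<^esub> Y \<otimes>\<^bsub>?M\<^esub> A) (p, q) = (\<Oplus>l\<in>{..<k}. A (p, j) \<otimes> Y (j, l) \<otimes> A (l, q))"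
        using pq ij c matrix_entry_closed[OF Y] matrix_ring_simps(1)[OF pq, of R "A \<otimes>\<^bsub>?M\<^esub> Y" A]
        by (simp only:) (intro finsum_cong', auto simp: AY simp del: matrix_ring_simps(1))
      also have "\<dots> = A (p, j) \<otimes> Y (j, i) \<otimes> A (i, q)"
        using pq ij y c by (subst finsum_delta[of _ i]) (auto simp: Y_def)
      also have "\<dots> = A (p, q)"
      proof (cases "p = i \<and> q = j")
        case True
        then show ?thesis using y ij by (simp add: Y_def)
      next
        case False
        then have "A (p, j) = \<zero> \<or> A (i, q) = \<zero>" "A (p, q) = \<zero>" using A0 pq ij by auto
        then show ?thesis using c y pq ij by (auto simp: Y_def)
      qed
      finally show "(A \<otimes>\<^bsub>?M\<^esub> Y \<otimes>\<^bsub>?M\<^esub> A) (p, q) = A (p, q)" .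
    qed
    then show "\<exists>Y\<in>carrier ?M. A \<otimes>\<^bsub>?M\<^esub> Y \<otimes>\<^bsub>?M\<^esub> A = A" using Y by blast
  qed
qed

text \<open>Fact \<open>1\<close> fixes a row and adds columns one by one, and fact \<open>2\<close>
  then adds the rows; at the end both idempotents are the identity. The result supplies the
  regularity hypothesis of \<open>two_corners\<close>.\<close>

lemma matrix_ring_regular:
  assumes reg: "\<And>a. a \<in> carrier R \<Longrightarrow> \<exists>y\<in>carrier R. a \<otimes> y \<otimes> a = a" and A: "A \<in> carrier (matrix_ring k R)"
  shows "\<exists>Y\<in>carrier (matrix_ring k R). A \<otimes>\<^bsub>matrix_ring k R\<^esub> Y \<otimes>\<^bsub>matrix_ring k R\<^esub> A = A"
proof -
  let ?M = "matrix_ring k R"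
  interpret M: ring ?M by (rule ring_matrix_ring)
  note id = diag_unit_idempotents and cl = diag_unit_closed diag_segment_closed
  have 1: "M.regular_between (diag_unit k i) (diag_segment k j)" if "i < k" "j \<le> k" for i j
    using that(2)
  proof (induction j)
    case 0
    then show ?case unfolding M.regular_between_def id by (auto intro: bexI[of _ "\<zero>\<^bsub>?M\<^esub>"])
  next
    case (Suc j)
    then show ?case unfolding id(5)[symmetric]
      by (intro M.regular_between_add_right cl id regular_between_diag_units reg) (use that in auto)
  qed
  have 2: "M.regular_between (diag_segment k i) (diag_segment k k)" if "i \<le> k" for i
    using that
  proof (induction i)
    case 0
    then show ?case unfolding M.regular_between_def id by (auto intro: bexI[of _ "\<zero>\<^bsub>?M\<^esub>"])
  next
    case (Suc i)
    then show ?case unfolding id(5)[symmetric]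
      by (intro M.regular_between_add_left cl id 1) auto
  qed
  show ?thesis using 2[of k] A unfolding M.regular_between_def id by simp
qed

lemma unit_regular_corner_diag_unit:
  assumes ur: "unit_regular_ring R" and i: "i < k"
  shows "ring.unit_regular_corner (matrix_ring k R) (diag_unit k i)"
proof -
  let ?M = "matrix_ring k R"
  interpret M: ring ?M by (rule ring_matrix_ring)
  define h where "h = diag_matrix k R (\<lambda>p. if p = i then \<zero> else \<one>)"
  have h: "h \<in> carrier ?M" unfolding h_def by (intro diag_matrix_closed) auto
  have "h \<oplus>\<^bsub>?M\<^esub> diag_unit k i = \<one>\<^bsub>?M\<^esub>"
    unfolding h_def diag_unit_def by (auto intro!: diag_matrix_cong simp: diag_matrix_add one_matrix)
  then have h_eq: "\<one>\<^bsub>?M\<^esub> \<ominus>\<^bsub>?M\<^esub> diag_unit k i = h"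
    using h diag_unit_closed by (metis M.a_assoc M.minus_eq M.r_neg M.r_zero M.a_inv_closed)
  show ?thesis unfolding M.unit_regular_corner_def h_eq
  proof (intro ballI impI)
    fix A assume A: "A \<in> carrier ?M" "diag_unit k i \<otimes>\<^bsub>?M\<^esub> A = A" "A \<otimes>\<^bsub>?M\<^esub> diag_unit k i = A"
    note c = matrix_entry_closed[OF A(1)]
    note A0 = matrix_corner_entry[OF A]
    obtain w where w: "w \<in> Units R" "A (i, i) = A (i, i) \<otimes> w \<otimes> A (i, i)"
      using ur c i unfolding unit_regular_ring_def by blast
    \<comment> \<open>The entry \<open>1\<close> at all positions other than \<open>i\<close> makes
      the diagonal unit fix \<open>h\<close> on both sides.\<close>
    define d where "d = (\<lambda>p. if p = i then w else \<one>)"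
    have d: "d p \<in> Units R" "d p \<in> carrier R" for p using w by (auto simp: d_def)
    define W where "W = diag_matrix k R d"
    have W: "W \<in> Units ?M" "W \<in> carrier ?M"
      unfolding W_def using d by (auto intro: diag_matrix_Units diag_matrix_closed)
    have "A \<otimes>\<^bsub>?M\<^esub> W \<otimes>\<^bsub>?M\<^esub> A = A"
    proof (rule matrix_eqI[where S = R and k = k]; (intro matrix_mult_closed A W)?)
      fix p q assume pq: "p < k" "q < k"
      have "(A \<otimes>\<^bsub>?M\<^esub> W \<otimes>\<^bsub>?M\<^esub> A) (p, q) = (\<Oplus>l\<in>{..<k}. A (p, l) \<otimes> d l \<otimes> A (l, q))"
        using pq c d matrix_ring_simps(1)[OF pq, of R "A \<otimes>\<^bsub>?M\<^esub> W" A] unfolding W_def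
        by (simp only:) (intro finsum_cong', auto simp: diag_matrix_mult_right[OF A(1)] simp del: matrix_ring_simps(1))
      also have "\<dots> = A (p, i) \<otimes> d i \<otimes> A (i, q)"
        using pq i d c A0 by (subst finsum_delta[of _ i]) auto
      also have "\<dots> = A (p, q)"
      proof (cases "p = i \<and> q = i")
        case True
        then show ?thesis using w by (simp add: d_def)
      next
        case False
        then have "A (p, i) = \<zero> \<or> A (i, q) = \<zero>" "A (p, q) = \<zero>" using A0 pq i by auto
        then show ?thesis using c d pq i by auto
      qed
      finally show "(A \<otimes>\<^bsub>?M\<^esub> W \<otimes>\<^bsub>?M\<^esub> A) (p, q) = A (p, q)" .
    qed
    moreover have "W \<otimes>\<^bsub>?M\<^esub> h = h" "h \<otimes>\<^bsub>?M\<^esub> W = h"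
      unfolding h_def W_def
      by (subst diag_matrix_mult, simp_all add: d(2), rule diag_matrix_cong, use w(1) in \<open>simp add: d_def Units_closed\<close>)+
    ultimately show "\<exists>W\<in>Units ?M. W \<otimes>\<^bsub>?M\<^esub> h = h \<and> h \<otimes>\<^bsub>?M\<^esub> W = h \<and> A \<otimes>\<^bsub>?M\<^esub> W \<otimes>\<^bsub>?M\<^esub> A = A"
      using W by blast
  qed
qed

text \<open>Induction along the diagonal segments, each step adding one corner by
  \<open>unit_regular_corner_sum\<close>. At \<open>j = k\<close> the complement of the segment is
  \<open>0\<close>, so fixing it is no restriction on the unit.\<close>

theorem unit_regular_matrix_ring:
  assumes ur: "unit_regular_ring R"
  shows "unit_regular_ring (matrix_ring k R)"
proof -
  let ?M = "matrix_ring k R"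
  interpret M: ring ?M by (rule ring_matrix_ring)
  note id = diag_unit_idempotents and cl = diag_unit_closed diag_segment_closed
  have reg: "\<exists>y\<in>carrier R. a \<otimes> y \<otimes> a = a" if "a \<in> carrier R" for a
    using ur that unfolding unit_regular_ring_def by (metis Units_closed)
  have "M.unit_regular_corner (diag_segment k j)" if "j \<le> k" for j
    using that
  proof (induction j)
    case 0
    show ?case unfolding id M.unit_regular_corner_def
      by (intro ballI impI bexI[of _ "\<one>\<^bsub>?M\<^esub>"]) (auto simp: M.minus_eq)
  next
    case (Suc j)
    interpret two_corners ?M "diag_segment k j" "diag_unit k j" 
      "\<one>\<^bsub>?M\<^esub> \<ominus>\<^bsub>?M\<^esub> (diag_segment k j \<oplus>\<^bsub>?M\<^esub> diag_unit k j)"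
      by unfold_locales (use id cl matrix_ring_regular[OF reg] in auto)
    show ?case
      using unit_regular_corner_sum unit_regular_corner_diag_unit[OF ur, of j k] Suc unfolding id by simp
  qed
  from this[of k] show ?thesis
    unfolding id M.unit_regular_corner_def unit_regular_ring_def by (auto, metis)
qed

text \<open>Condition (5) speaks of \<open>R[x]/(x^n)\<close> through its matrix rings, so the
  converse reaches \<open>matrix_ring 1 R\<close> first; unit regularity is carried back along the
  entry at \<open>(0, 0)\<close>.\<close>

lemma unit_regular_matrix_ring_1:
  assumes ur: "unit_regular_ring (matrix_ring 1 R)"
  shows "unit_regular_ring R"
  unfolding unit_regular_ring_def
proof
  let ?M = "matrix_ring 1 R"
  interpret M: ring ?M by (rule ring_matrix_ring)
  have mult: "(A \<otimes>\<^bsub>?M\<^esub> B) (0, 0) = A (0, 0) \<otimes> B (0, 0)" if "A \<in> carrier ?M" "B \<in> carrier ?M" for A B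
    using matrix_entry_closed[OF that(1), of 0 0] matrix_entry_closed[OF that(2), of 0 0] 
    by (subst matrix_ring_simps; simp?) (subst finsum_delta[of _ 0]; simp)
  fix a assume a: "a \<in> carrier R"
  let ?A = "diag_matrix 1 R (\<lambda>_. a)"
  have A: "?A \<in> carrier ?M" using a by (intro diag_matrix_closed)
  obtain U where U: "U \<in> Units ?M" "?A = ?A \<otimes>\<^bsub>?M\<^esub> U \<otimes>\<^bsub>?M\<^esub> ?A"
    using ur A unfolding unit_regular_ring_def by blast
  define V where "V = inv\<^bsub>?M\<^esub> U"
  have UV: "U \<in> carrier ?M" "V \<in> carrier ?M" "U \<otimes>\<^bsub>?M\<^esub> V = \<one>\<^bsub>?M\<^esub>" "V \<otimes>\<^bsub>?M\<^esub> U = \<one>\<^bsub>?M\<^esub>"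
    unfolding V_def using U(1)
    by (blast intro: M.Units_closed M.Units_inv_closed M.Units_r_inv M.Units_l_inv)+
  have "U (0, 0) \<otimes> V (0, 0) = \<one>" "V (0, 0) \<otimes> U (0, 0) = \<one>"
    using mult[OF UV(1,2)] mult[OF UV(2,1)] unfolding UV(3,4) by simp_all
  then have "U (0, 0) \<in> Units R"
    using matrix_entry_closed[OF UV(1), of 0 0] matrix_entry_closed[OF UV(2), of 0 0] by (auto intro: UnitsI)
  moreover have "a = a \<otimes> U (0, 0) \<otimes> a"
    using arg_cong[OF U(2), of "\<lambda>A. A (0, 0)"] unfolding mult[OF M.m_closed[OF A UV(1)] A] mult[OF A UV(1)]
    by simp
  ultimately show "\<exists>u\<in>Units R. a = a \<otimes> u \<otimes> a" by blast
qed

end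

section \<open>Matrices over a truncated extension\<close>

context truncated_extension begin

text \<open>With \<open>x\<close> taken as a scalar matrix, this is the identification of
  \<open>M_k(S[x]/(x^n))\<close> with \<open>M_k(S)[x]/(x^n)\<close>. Multiplication by a scalar
  matrix is entrywise, so divisibility, decomposition and residues reduce to the entries, whose
  cofactors are chosen separately.\<close>

theorem truncated_extension_matrix_ring:
  "truncated_extension (matrix_ring k T) (matrix_ring k S)
     (\<lambda>A. \<lambda>p\<in>{..<k} \<times> {..<k}. \<iota> (A p)) (diag_matrix k T (\<lambda>_. x)) n"
proof -
  let ?MT = "matrix_ring k T" and ?MS = "matrix_ring k S" and ?X = "diag_matrix k T (\<lambda>_. x)"
  let ?\<iota> = "\<lambda>A. \<lambda>p\<in>{..<k} \<times> {..<k}. \<iota> (A p)"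
  interpret MT: ring ?MT by (rule ring_matrix_ring)
  interpret MS: ring ?MS by (rule S.ring_matrix_ring)
  note cT = matrix_entry_closed[where S = T and k = k] and cS = matrix_entry_closed[where S = S and k = k]
  have X: "?X \<in> carrier ?MT" by (intro diag_matrix_closed) simp
  have \<iota>: "?\<iota> A \<in> carrier ?MT" if "A \<in> carrier ?MS" for A
    using cS[OF that] by (auto simp: carrier_matrix_ring)
  have pow: "?X [^]\<^bsub>?MT\<^esub> i = diag_matrix k T (\<lambda>_. x [^] i)" for i :: nat
    by (induction i) (auto simp: one_matrix diag_matrix_mult intro!: diag_matrix_cong)
  have XA: "(diag_matrix k T (\<lambda>_. y) \<otimes>\<^bsub>?MT\<^esub> A) (i, j) = y \<otimes> A (i, j)"
    if "A \<in> carrier ?MT" "y \<in> carrier T" "i < k" "j < k" for A y i j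
    using that by (intro diag_matrix_mult_left)
  show ?thesis
  proof (unfold_locales, goal_cases)
    case 1
    show ?case
    proof (rule ring_hom_memI)
      fix A assume A: "A \<in> carrier ?MS"
      show "?\<iota> A \<in> carrier ?MT" by (rule \<iota>[OF A])
    next
      fix A B assume A: "A \<in> carrier ?MS" and B: "B \<in> carrier ?MS"
      show "?\<iota> (A \<otimes>\<^bsub>?MS\<^esub> B) = ?\<iota> A \<otimes>\<^bsub>?MT\<^esub> ?\<iota> B"
      proof (rule matrix_eqI[OF \<iota>[OF MS.m_closed[OF A B]] MT.m_closed[OF \<iota>[OF A] \<iota>[OF B]]])
        fix i j assume ij: "i < k" "j < k"
        have "\<iota> (\<Oplus>\<^bsub>S\<^esub>l\<in>{..<k}. A (i, l) \<otimes>\<^bsub>S\<^esub> B (l, j)) = (\<Oplus>l\<in>{..<k}. \<iota> (A (i, l)) \<otimes> \<iota> (B (l, j)))"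
          using cS[OF A] cS[OF B] ij
          by (subst hom.hom_finsum) (auto intro!: finsum_cong')
        also have "\<dots> = (\<Oplus>l\<in>{..<k}. ?\<iota> A (i, l) \<otimes> ?\<iota> B (l, j))"
          using cS[OF A] cS[OF B] ij by (intro finsum_cong') auto
        finally show "?\<iota> (A \<otimes>\<^bsub>?MS\<^esub> B) (i, j) = (?\<iota> A \<otimes>\<^bsub>?MT\<^esub> ?\<iota> B) (i, j)"
          using ij by simp
      qed
      show "?\<iota> (A \<oplus>\<^bsub>?MS\<^esub> B) = ?\<iota> A \<oplus>\<^bsub>?MT\<^esub> ?\<iota> B"
        by (rule matrix_eqI[OF \<iota>[OF MS.a_closed[OF A B]] MT.a_closed[OF \<iota>[OF A] \<iota>[OF B]]])
          (use cS[OF A] cS[OF B] in simp)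
    next
      show "?\<iota> \<one>\<^bsub>?MS\<^esub> = \<one>\<^bsub>?MT\<^esub>"
        by (rule matrix_eqI[OF \<iota>[OF MS.one_closed] MT.one_closed]) simp
    qed
  next
    case 2
    show ?case by (rule X)
  next
    case (3 A)
    show ?case
      by (rule matrix_eqI[OF MT.m_closed[OF 3 X] MT.m_closed[OF X 3]])
        (simp add: XA[OF 3] diag_matrix_mult_right[OF 3] x_central cT[OF 3] del: matrix_ring_simps(1))
  next
    case 4
    show ?case unfolding pow x_nilpotent zero_matrix ..
  next
    case (5 A i)
    have "\<exists>s\<in>carrier T. A (p, q) = x [^] (n - i) \<otimes> s" if "p < k" "q < k" for p q
    proof (rule x_annihilator)
      show "x [^] i \<otimes> A (p, q) = \<zero>"
        using arg_cong[OF 5(3), of "\<lambda>A. A (p, q)"] that by (simp add: pow XA[OF 5(1)] del: matrix_ring_simps(1))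
    qed (use 5 cT that in auto)
    then obtain s where s: "\<And>p q. p < k \<Longrightarrow> q < k \<Longrightarrow> s p q \<in> carrier T \<and> A (p, q) = x [^] (n - i) \<otimes> s p q"
      by metis
    define B where "B = (\<lambda>(p, q)\<in>{..<k} \<times> {..<k}. s p q)"
    have B: "B \<in> carrier ?MT" using s by (auto simp: B_def carrier_matrix_ring)
    have "A = ?X [^]\<^bsub>?MT\<^esub> (n - i) \<otimes>\<^bsub>?MT\<^esub> B"
      by (rule matrix_eqI[OF 5(1) MT.m_closed[OF MT.nat_pow_closed[OF X] B]])
        (unfold pow, simp add: XA[OF B] s del: matrix_ring_simps(1), simp add: B_def s)
    then show ?case using B by blast
  next
    case (6 A)
    have "\<exists>r\<in>carrier S. \<exists>s\<in>carrier T. A (p, q) = \<iota> r \<oplus> x \<otimes> s" if "p < k" "q < k" for p q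
      using decomposition cT[OF 6] that by blast
    then obtain r s where rs: "\<And>p q. p < k \<Longrightarrow> q < k \<Longrightarrow>
        r p q \<in> carrier S \<and> s p q \<in> carrier T \<and> A (p, q) = \<iota> (r p q) \<oplus> x \<otimes> s p q"
      by metis
    define B where "B = (\<lambda>(p, q)\<in>{..<k} \<times> {..<k}. r p q)"
    define C where "C = (\<lambda>(p, q)\<in>{..<k} \<times> {..<k}. s p q)"
    have B: "B \<in> carrier ?MS" using rs by (auto simp: B_def carrier_matrix_ring)
    have C: "C \<in> carrier ?MT" using rs by (auto simp: C_def carrier_matrix_ring)
    have "A = ?\<iota> B \<oplus>\<^bsub>?MT\<^esub> ?X \<otimes>\<^bsub>?MT\<^esub> C"
      by (rule matrix_eqI[OF 6 MT.a_closed[OF \<iota>[OF B] MT.m_closed[OF X C]]])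
        (simp add: XA[OF C] rs del: matrix_ring_simps(1), simp add: B_def C_def)
    then show ?case using B C by blast
  next
    case (7 A B)
    show ?case
    proof (rule matrix_eqI[OF 7(1) MS.zero_closed])
      fix i j assume ij: "i < k" "j < k"
      have "\<iota> (A (i, j)) = x \<otimes> B (i, j)"
        using arg_cong[OF 7(3), of "\<lambda>A. A (i, j)"] ij by (simp add: XA[OF 7(2)] del: matrix_ring_simps(1))
      then show "A (i, j) = \<zero>\<^bsub>?MS\<^esub> (i, j)"
        using residue_inj[OF cS[OF 7(1) ij] cT[OF 7(2) ij]] ij by simp
    qed
  qed
qed

end

section \<open>Truncated polynomial rings\<close>

context UP_ring begin

lemma coeff_monom_one_mult:
  assumes "p \<in> carrier P"
  shows "coeff P (monom P \<one> i \<otimes>\<^bsub>P\<^esub> p) k = (if i \<le> k then coeff P p (k - i) else \<zero>)"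
proof (cases "i \<le> k")
  case True
  then show ?thesis using assms by (simp, subst R.finsum_delta[of _ i]) auto
next
  case False
  have "(\<Oplus>l\<in>{..k}. coeff P (monom P \<one> i) l \<otimes> coeff P p (k - l)) = (\<Oplus>l\<in>{..k}. \<zero>)"
    using assms False by (intro R.finsum_cong') auto
  then show ?thesis using assms False by simp
qed

lemma coeff_mult_monom_one:
  assumes "p \<in> carrier P"
  shows "coeff P (p \<otimes>\<^bsub>P\<^esub> monom P \<one> i) k = (if i \<le> k then coeff P p (k - i) else \<zero>)"
proof (cases "i \<le> k")
  case True
  then show ?thesis using assms by (simp, subst R.finsum_delta[of _ "k - i"]) auto
next
  case False
  have "(\<Oplus>l\<in>{..k}. coeff P p l \<otimes> coeff P (monom P \<one> i) (k - l)) = (\<Oplus>l\<in>{..k}. \<zero>)"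
    using assms False by (intro R.finsum_cong') auto
  then show ?thesis using assms False by simp
qed

lemma monom_one_central:
  "p \<in> carrier P \<Longrightarrow> p \<otimes>\<^bsub>P\<^esub> monom P \<one> i = monom P \<one> i \<otimes>\<^bsub>P\<^esub> p"
  by (rule up_eqI) (simp_all only: coeff_monom_one_mult coeff_mult_monom_one UP_mult_closed monom_closed R.one_closed)

lemma monom_one_pow: "monom P \<one> 1 [^]\<^bsub>P\<^esub> (i::nat) = monom P \<one> i"
proof (induction i)
  case 0
  show ?case by (simp add: nat_pow_def)
next
  case (Suc i)
  then show ?case using monom_mult[of \<one> \<one> i 1] by (simp add: nat_pow_def)
qed

lemma monom_one_dvdI:
  assumes p: "p \<in> carrier P" and z: "\<And>l. l < i \<Longrightarrow> coeff P p l = \<zero>"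
  shows "\<exists>q\<in>carrier P. p = monom P \<one> i \<otimes>\<^bsub>P\<^esub> q"
proof -
  define q where "q = (\<lambda>k. coeff P p (k + i))"
  have pc: "coeff P p = p" using p by (auto simp: P_def UP_def)
  obtain m where "bound \<zero> m (coeff P p)" unfolding pc using R.bound_upD[of p] p by (auto simp: P_def UP_def)
  then have "bound \<zero> m q" by (auto simp: q_def simp add: bound_def)
  then have "q \<in> up R" using coeff_closed[OF p] by (intro mem_upI) (auto simp: q_def)
  then have q: "q \<in> carrier P" "coeff P q k = coeff P p (k + i)" for k
    by (auto simp: P_def UP_def q_def)
  have "p = monom P \<one> i \<otimes>\<^bsub>P\<^esub> q"
    by (rule up_eqI) (use p q(1) z in \<open>simp_all only: coeff_monom_one_mult q(2) UP_mult_closed monom_closed R.one_closed, auto\<close>)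
  then show ?thesis using q by blast
qed

text \<open>The ideal generated by \<open>x^n\<close> is accessed through this description by
  coefficients: a polynomial that becomes zero in the quotient has no coefficients below
  \<open>n\<close>.\<close>

definition "low_zero n = {p \<in> carrier P. \<forall>i<n. coeff P p i = \<zero>}"

lemma ideal_low_zero: "ideal (low_zero n) P"
proof (rule idealI)
  show "ring P" by (rule UP_ring)
  interpret P: ring P by (rule UP_ring)
  show "subgroup (low_zero n) (add_monoid P)"
  proof (unfold_locales, goal_cases)
    case (4 p)
    then show ?case by (auto simp: low_zero_def simp flip: a_inv_def)
  qed (auto simp: low_zero_def)
  fix p q assume "p \<in> low_zero n" "q \<in> carrier P"
  then show "q \<otimes>\<^bsub>P\<^esub> p \<in> low_zero n" "p \<otimes>\<^bsub>P\<^esub> q \<in> low_zero n"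
    by (auto simp: low_zero_def intro!: R.add.finprod_one_eqI)
qed

lemma genideal_subset_low_zero: "genideal P {monom P \<one> n} \<subseteq> low_zero n"
  by (rule ring.genideal_minimal[OF UP_ring ideal_low_zero]) (auto simp: low_zero_def)

end

context ring begin

theorem truncated_extension_truncated_poly_ring:
  assumes n: "1 \<le> n"
  shows "\<exists>\<iota> x. truncated_extension (truncated_poly_ring R n) R \<iota> x n"
proof -
  note R_neg = r_neg
  define P where "P = UP R"
  interpret UP_ring R P by unfold_locales (simp add: P_def)
  interpret P: ring P by (rule UP_ring)
  define I where "I = genideal P {monom P \<one> n}"
  define T where "T = truncated_poly_ring R n"
  have T_eq: "T = P Quot I"
    using monom_one_pow by (simp add: T_def truncated_poly_ring_def P_def I_def)
  interpret I: ideal I P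
    unfolding I_def by (rule P.genideal_ideal) simp
  define \<pi> where "\<pi> = (\<lambda>p. I +>\<^bsub>P\<^esub> p)"
  interpret H: ring_hom_ring P T \<pi>
    unfolding T_eq \<pi>_def by (rule I.rcos_ring_hom_ring)
  have low: "I \<subseteq> low_zero n" unfolding I_def by (rule genideal_subset_low_zero)
  have zero: "p \<in> I" if "p \<in> carrier P" "\<pi> p = \<zero>\<^bsub>T\<^esub>" for p
    using that I.rcos_const_imp_mem by (auto simp: T_eq \<pi>_def FactRing_def)
  have surj: "\<exists>p\<in>carrier P. t = \<pi> p" if "t \<in> carrier T" for t
    using that by (auto simp: T_eq \<pi>_def FactRing_def A_RCOSETS_def')
  define X where "X = monom P \<one> 1"
  have X: "X \<in> carrier P" by (simp add: X_def)
  have pow: "\<pi> X [^]\<^bsub>T\<^esub> i = \<pi> (monom P \<one> i)" for i :: nat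
  proof (induction i)
    case 0
    show ?case by (simp add: nat_pow_def)
  next
    case (Suc i)
    have "\<pi> X [^]\<^bsub>T\<^esub> Suc i = \<pi> X [^]\<^bsub>T\<^esub> i \<otimes>\<^bsub>T\<^esub> \<pi> X" by (simp add: nat_pow_def)
    also have "\<dots> = \<pi> (monom P \<one> i \<otimes>\<^bsub>P\<^esub> X)" using X by (simp add: Suc)
    also have "monom P \<one> i \<otimes>\<^bsub>P\<^esub> X = monom P \<one> (Suc i)" using monom_mult[of \<one> \<one> i 1] by (simp add: X_def)
    finally show ?case .
  qed
  have "truncated_extension T R (\<lambda>r. \<pi> (monom P r 0)) (\<pi> X) n"
  proof (unfold_locales, goal_cases)
    case 1
    show ?case
      using const_ring_hom unfolding ring_hom_def by auto
  next
    case 2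
    show ?case using X by simp
  next
    case (3 t)
    then obtain p where p: "p \<in> carrier P" "t = \<pi> p" using surj by blast
    then show ?case using X monom_one_central[OF p(1), of 1] by (simp add: X_def flip: H.hom_mult)
  next
    case 4
    have "monom P \<one> n \<in> I" unfolding I_def by (rule P.genideal_self') simp
    then have "\<pi> (monom P \<one> n) = \<zero>\<^bsub>T\<^esub>" by (simp add: T_eq \<pi>_def FactRing_def I.a_rcos_const)
    then show ?case unfolding pow .
  next
    case (5 t i)
    then obtain p where p: "p \<in> carrier P" "t = \<pi> p" using surj by blast
    have "\<pi> (monom P \<one> i \<otimes>\<^bsub>P\<^esub> p) = \<zero>\<^bsub>T\<^esub>" using 5 p by (simp add: pow)
    then have "monom P \<one> i \<otimes>\<^bsub>P\<^esub> p \<in> low_zero n" using zero low p by auto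
    then have *: "coeff P (monom P \<one> i \<otimes>\<^bsub>P\<^esub> p) l = \<zero>" if "l < n" for l
      using that by (simp only: low_zero_def mem_Collect_eq)
    \<comment> \<open>Multiplication by \<open>x^i\<close> shifts coefficients up by
      \<open>i\<close>, so those of \<open>x^i p\<close> below \<open>n\<close> are, apart from
      zeros, those of \<open>p\<close> below \<open>n - i\<close>.\<close>
    have "coeff P p l = \<zero>" if "l < n - i" for l
      using *[of "l + i"] that unfolding coeff_monom_one_mult[OF p(1)] by simp
    then obtain q where "q \<in> carrier P" "p = monom P \<one> (n - i) \<otimes>\<^bsub>P\<^esub> q"
      using monom_one_dvdI[OF p(1)] by blast
    then show ?case using p by (intro bexI[of _ "\<pi> q"]) (simp_all add: pow)
  next
    case (6 t)
    then obtain p where p: "p \<in> carrier P" "t = \<pi> p" using surj by blast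
    let ?c = "monom P (coeff P p 0) 0"
    have c: "?c \<in> carrier P" "p \<ominus>\<^bsub>P\<^esub> ?c \<in> carrier P" using p by simp_all
    have "coeff P (p \<ominus>\<^bsub>P\<^esub> ?c) l = \<zero>" if "l < 1" for l
      using that p c by (simp add: P.minus_eq R_neg)
    then obtain q where q: "q \<in> carrier P" "p \<ominus>\<^bsub>P\<^esub> ?c = X \<otimes>\<^bsub>P\<^esub> q"
      using monom_one_dvdI[OF c(2), of 1] unfolding X_def by blast
    have "p = ?c \<oplus>\<^bsub>P\<^esub> (p \<ominus>\<^bsub>P\<^esub> ?c)" using p c by algebra
    then have "\<pi> p = \<pi> (?c \<oplus>\<^bsub>P\<^esub> X \<otimes>\<^bsub>P\<^esub> q)" unfolding q by simp
    then have "t = \<pi> ?c \<oplus>\<^bsub>T\<^esub> \<pi> X \<otimes>\<^bsub>T\<^esub> \<pi> q" using p(2) X q c by simp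
    then show ?case using p q by (intro bexI[of _ "coeff P p 0"] bexI[of _ "\<pi> q"]) simp_all
  next
    case (7 r s)
    then obtain q where q: "q \<in> carrier P" "s = \<pi> q" using surj by blast
    have Xq: "X \<otimes>\<^bsub>P\<^esub> q \<in> carrier P" using X q by simp
    have "\<pi> (monom P r 0 \<ominus>\<^bsub>P\<^esub> X \<otimes>\<^bsub>P\<^esub> q) = \<pi> (monom P r 0) \<ominus>\<^bsub>T\<^esub> \<pi> X \<otimes>\<^bsub>T\<^esub> \<pi> q"
      using X q 7(1) by (simp add: P.minus_eq H.S.minus_eq)
    also have "\<dots> = \<zero>\<^bsub>T\<^esub>" using 7 q X by (simp add: H.S.minus_eq_zero_iff)
    finally have "monom P r 0 \<ominus>\<^bsub>P\<^esub> X \<otimes>\<^bsub>P\<^esub> q \<in> low_zero n"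
      using zero low X q 7(1) by auto
    \<comment> \<open>The hypothesis \<open>1 \<le> n\<close> puts the constant coefficient among
      those that vanish on the ideal.\<close>
    then have "coeff P (monom P r 0 \<ominus>\<^bsub>P\<^esub> X \<otimes>\<^bsub>P\<^esub> q) 0 = \<zero>"
      using n by (simp only: low_zero_def mem_Collect_eq)
    moreover have "coeff P (X \<otimes>\<^bsub>P\<^esub> q) 0 = \<zero>"
      unfolding X_def coeff_monom_one_mult[OF q(1)] by simp
    ultimately show ?case using 7(1) Xq by (simp add: P.minus_eq del: coeff_mult)
  qed
  then show ?thesis unfolding T_def by blast
qed

end

theorem corollary2p19:
  fixes R :: "('a, 'k) ring_scheme"
  assumes "ring R"
  shows "(left_morphic_ring (R \<propto> regular_bimodule R)
            \<longleftrightarrow> (\<forall>a\<in>carrier R. left_morphic_element (R \<propto> regular_bimodule R) (\<zero>\<^bsub>R\<^esub>, a)))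
       \<and> ((\<forall>a\<in>carrier R. left_morphic_element (R \<propto> regular_bimodule R) (\<zero>\<^bsub>R\<^esub>, a))
            \<longleftrightarrow> unit_regular_ring R)
       \<and> (unit_regular_ring R \<longleftrightarrow> morphic_ring (R \<propto> regular_bimodule R))
       \<and> (morphic_ring (R \<propto> regular_bimodule R)
            \<longleftrightarrow> (\<forall>n\<ge>1. strongly_morphic_ring (truncated_poly_ring R n)))"
proof -
  interpret ring R by fact
  let ?E = "R \<propto> regular_bimodule R"
  interpret E: truncated_extension ?E R "\<lambda>r. (r, \<zero>\<^bsub>R\<^esub>)" "(\<zero>\<^bsub>R\<^esub>, \<one>\<^bsub>R\<^esub>)" 2
    by (rule truncated_extension_trivial_extension)
  have 12: "left_morphic_element ?E (\<zero>\<^bsub>R\<^esub>, a)" if "left_morphic_ring ?E" "a \<in> carrier R" for a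
    using that by (auto simp: left_morphic_ring_def)
  have 23: "unit_regular_ring R" if "\<forall>a\<in>carrier R. left_morphic_element ?E (\<zero>\<^bsub>R\<^esub>, a)"
    by (rule E.left_morphic_imp_unit_regular) (use that in simp_all)
  have 34: "morphic_ring ?E" if "unit_regular_ring R"
    using that by (rule E.unit_regular_imp_morphic)
  have 41: "left_morphic_ring ?E" if "morphic_ring ?E"
    using that by (simp add: morphic_ring_def)
  have 35: "strongly_morphic_ring (truncated_poly_ring R n)" if ur: "unit_regular_ring R" and n: "1 \<le> n" for n
    unfolding strongly_morphic_ring_def
  proof (intro allI impI)
    fix k :: nat
    obtain \<iota> x where "truncated_extension (truncated_poly_ring R n) R \<iota> x n"
      using truncated_extension_truncated_poly_ring[OF n] by blast
    then show "morphic_ring (matrix_ring k (truncated_poly_ring R n))"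
      by (rule truncated_extension.unit_regular_imp_morphic[OF truncated_extension.truncated_extension_matrix_ring])
        (rule unit_regular_matrix_ring[OF ur])
  qed
  \<comment> \<open>The instance used is \<open>R[x]/(x^2)\<close> with matrices of size
    \<open>1\<close>: for \<open>n = 2\<close> the elements \<open>x \<iota> a\<close> correspond to
    the \<open>(0, a)\<close> of the trivial extension.\<close>
  have 53: "unit_regular_ring R" if "\<forall>n\<ge>1. strongly_morphic_ring (truncated_poly_ring R n)"
  proof -
    let ?T = "truncated_poly_ring R 2"
    obtain \<iota> x where "truncated_extension ?T R \<iota> x 2"
      using truncated_extension_truncated_poly_ring[of 2] by auto
    then interpret M: truncated_extension "matrix_ring 1 ?T" "matrix_ring 1 R"
      "\<lambda>A. \<lambda>p\<in>{..<1} \<times> {..<1}. \<iota> (A p)" "diag_matrix 1 ?T (\<lambda>_. x)" 2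
      by (rule truncated_extension.truncated_extension_matrix_ring)
    have "left_morphic_ring (matrix_ring 1 ?T)"
      using that by (simp add: strongly_morphic_ring_def morphic_ring_def)
    then have "unit_regular_ring (matrix_ring 1 R)"
      by (intro M.left_morphic_imp_unit_regular refl)
        (simp only: left_morphic_ring_def M.m_closed M.x_closed M.hom.hom_closed)
    then show ?thesis by (rule unit_regular_matrix_ring_1)
  qed
  show ?thesis using 12 23 34 41 35 53 by blast
qed

end
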